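(* Let $\mathcal P$ be a nonempty convex set of probability measures on a measurable space $(\mathcal X,\mathcal F)$ that is dominated by a $\sigma$-finite measure, and let $\theta:\mathcal P\to\mathbb R$ be linear (i.e. $\theta(\lambda P_0+(1-\lambda)P_1)=\lambda\theta(P_0)+(1-\lambda)\theta(P_1)$ for $P_0,P_1\in\mathcal P$, $\lambda\in[0,1]$) and bounded, $\sup_{P\in\mathcal P}|\theta(P)|<\infty$. Let $l:[0,\infty)\to[0,\infty)$ be a non-decreasing loss function with $l(0)=0$ and such that, for some $a\in(1,\infty)$, $l(\tfrac32 t)\le a\,l(t)$ for all $t\ge 0$. Then for every fixed $\alpha\in(0,\infty)$, $$\mathcal M_{n,\alpha}(\mathcal P,\theta)\;\asymp\; l\left(\omega_{TV}\left(n^{-1/2}\right)\right),$$ that is, there exist constants $0<c_0<c_1<\infty$ and $n_0\in\mathbb N$, not depending on $n$, such that $c_0\, l(\omega_{TV}(n^{-1/2}))\le \mathcal M_{n,\alpha}(\mathcal P,\theta)\le c_1\, l(\omega_{TV}(n^{-1/2}))$ for all $n\ge n_0$.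
   Context: Total variation distance: $d_{TV}(P_0,P_1)=\sup_A|P_0(A)-P_1(A)|$. Modulus: $\omega_{TV}(\varepsilon)=\sup\{|\theta(P_0)-\theta(P_1)|: d_{TV}(P_0,P_1)\le\varepsilon,\ P_0,P_1\in\mathcal P\}$. Channels. For $q\in\mathbb N$ let $\mathcal Z=\mathbb R^q$ with its Borel sets. A channel $Q$ is a Markov kernel from $\mathcal X^n$ to $\mathcal Z^n$; $QP^{\otimes n}$ denotes the measure $A\mapsto\int Q(A|x)\,dP^{\otimes n}(x)$. $Q$ is $\alpha$-sequentially interactive if there are Markov kernels $Q_i$ from $\mathcal X\times\mathcal Z^{i-1}$ to $\mathcal Z$, $i=1,\dots,n$, such that for all Borel $A\subseteq\mathcal Z^n$ and $x_1,\dots,x_n\in\mathcal X$, $$Q(A|x_1,\dots,x_n)=\int_{\mathcal Z}\cdots\int_{\mathcal Z}Q_n(A_{z_{1:n-1}}|x_n,z_{1:n-1})\,Q_{n-1}(dz_{n-1}|x_{n-1},z_{1:n-2})\cdots Q_1(dz_1|x_1),$$ where $A_{z_{1:n-1}}=\{z\in\mathcal Z:(z_1,\dots,z_{n-1},z)\in A\}$, and such that for every $i$, all Borel $A\subseteq\mathcal Z$, all $x_i,x_i'\in\mathcal X$ and all $z_1,\dots,z_{i-1}$: $Q_i(A|x_i,z_{1:i-1})\le e^\alpha Q_i(A|x_i',z_{1:i-1})$. Let $\mathcal Q_\alpha$ be the set of all $\alpha$-sequentially interactive channels (over all $q\in\mathbb N$). Risk. $\mathcal M_n(Q,\mathcal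 P,\theta)=\inf_{\hat\theta_n}\sup_{P\in\mathcal P}\mathbb E_{QP^{\otimes n}}[l(|\hat\theta_n-\theta(P)|)]$, the infimum being over all (measurable) estimators $\hat\theta_n:\mathcal Z^n\to\mathbb R$, and $\mathcal M_{n,\alpha}(\mathcal P,\theta)=\inf_{Q\in\mathcal Q_\alpha}\mathcal M_n(Q,\mathcal P,\theta)$. *)

theory Defs
  imports "HOL-Probability.Probability"
begin

(* A measurable space is given by a measure M of which only space and sigma-algebra are used.
   Coordinates of samples are numbered from 0: x :: nat => 'a lives on {..<n}, and the i-th
   kernel (0 <= i < n) sees the i earlier outputs, indexed by {..<i}. *)

definition mixture :: "real \<Rightarrow> 'a measure \<Rightarrow> 'a measure \<Rightarrow> 'a measure" where
  "mixture w P0 P1 = measure_of (space P0) (sets P0)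
     (\<lambda>A. ennreal w * emeasure P0 A + ennreal (1 - w) * emeasure P1 A)"

lemma space_mixture: "space (mixture w P0 P1) = space P0"
  and sets_mixture: "sets (mixture w P0 P1) = sets P0"
  by (simp_all add: mixture_def)

lemma emeasure_mixture:
  assumes "sets P1 = sets P0" "A \<in> sets P0"
  shows "emeasure (mixture w P0 P1) A
    = ennreal w * emeasure P0 A + ennreal (1 - w) * emeasure P1 A"
proof (rule emeasure_measure_of[OF mixture_def])
  show "countably_additive (sets (mixture w P0 P1))
     (\<lambda>A. ennreal w * emeasure P0 A + ennreal (1 - w) * emeasure P1 A)"
    unfolding countably_additive_def
    by (auto simp: sets_mixture assms(1) suminf_add[symmetric] suminf_emeasure)
qed (auto simp: sets_mixture assms positive_def dest: sets.sets_into_space)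

definition convex_measures :: "'a measure set \<Rightarrow> bool" where
  "convex_measures \<P> \<longleftrightarrow>
     (\<forall>P0\<in>\<P>. \<forall>P1\<in>\<P>. \<forall>w\<in>{0..1}. mixture w P0 P1 \<in> \<P>)"

definition linear_functional :: "'a measure set \<Rightarrow> ('a measure \<Rightarrow> real) \<Rightarrow> bool" where
  "linear_functional \<P> \<theta> \<longleftrightarrow>
     (\<forall>P0\<in>\<P>. \<forall>P1\<in>\<P>. \<forall>w\<in>{0..1}.
        \<theta> (mixture w P0 P1) = w * \<theta> P0 + (1 - w) * \<theta> P1)"

definition dominated :: "'a measure \<Rightarrow> 'a measure set \<Rightarrow> bool" where
  "dominated M \<P> \<longleftrightarrow>
     (\<exists>\<mu>. sigma_finite_measure \<mu> \<and> sets \<mu> = sets M \<and> (\<forall>P\<in>\<P>. absolutely_continuous \<mu> P))"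

definition tv_dist :: "'a measure \<Rightarrow> 'a measure \<Rightarrow> real" where
  "tv_dist P0 P1 = (SUP A\<in>sets P0. \<bar>measure P0 A - measure P1 A\<bar>)"

definition modulus_tv :: "'a measure set \<Rightarrow> ('a measure \<Rightarrow> real) \<Rightarrow> real \<Rightarrow> real" where
  "modulus_tv \<P> \<theta> \<epsilon> =
     Sup {\<bar>\<theta> P0 - \<theta> P1\<bar> | P0 P1. P0 \<in> \<P> \<and> P1 \<in> \<P> \<and> tv_dist P0 P1 \<le> \<epsilon>}"

(* R^q as functions nat => real on {..<q}; for finite q the product sigma-algebra is the
   Borel sigma-algebra. *)
definition euclid :: "nat \<Rightarrow> (nat \<Rightarrow> real) measure" where
  "euclid q = PiM {..<q} (\<lambda>_. borel)"

abbreviation outputs :: "nat \<Rightarrow> nat \<Rightarrow> (nat \<Rightarrow> nat \<Rightarrow> real) measure" where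
  "outputs q n \<equiv> PiM {..<n} (\<lambda>_. euclid q)"

(* nested_integral Qs x A m i z: the outputs z of the first i kernels are fixed and the next
   m outputs are integrated out in sequential order. The innermost integral, that of the
   indicator of A, is the measure of the section of A at the earlier outputs. *)
primrec nested_integral ::
  "(nat \<Rightarrow> 'a \<times> (nat \<Rightarrow> nat \<Rightarrow> real) \<Rightarrow> (nat \<Rightarrow> real) measure) \<Rightarrow> (nat \<Rightarrow> 'a) \<Rightarrow>
   (nat \<Rightarrow> nat \<Rightarrow> real) set \<Rightarrow> nat \<Rightarrow> nat \<Rightarrow> (nat \<Rightarrow> nat \<Rightarrow> real) \<Rightarrow> ennreal" where
  "nested_integral Qs x A 0 i z = indicator A z"
| "nested_integral Qs x A (Suc m) i z =
     (\<integral>\<^sup>+ y. nested_integral Qs x A m (Suc i) (z(i := y)) \<partial>Qs i (x i, z))"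

definition channels ::
  "'a measure \<Rightarrow> nat \<Rightarrow> nat \<Rightarrow> ((nat \<Rightarrow> 'a) \<Rightarrow> (nat \<Rightarrow> nat \<Rightarrow> real) measure) set" where
  "channels M q n = PiM {..<n} (\<lambda>_. M) \<rightarrow>\<^sub>M prob_algebra (outputs q n)"

(* The starting point (\<lambda>_. undefined) is the only element of the product over {}. *)
definition sequentially_interactive ::
  "'a measure \<Rightarrow> nat \<Rightarrow> nat \<Rightarrow> real \<Rightarrow> ((nat \<Rightarrow> 'a) \<Rightarrow> (nat \<Rightarrow> nat \<Rightarrow> real) measure) \<Rightarrow> bool" where
  "sequentially_interactive M q n \<alpha> Q \<longleftrightarrow>
     (\<exists>Qs. (\<forall>i<n. Qs i \<in> M \<Otimes>\<^sub>M outputs q i \<rightarrow>\<^sub>M prob_algebra (euclid q)) \<and>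
        (\<forall>A\<in>sets (outputs q n). \<forall>x\<in>space (PiM {..<n} (\<lambda>_. M)).
           emeasure (Q x) A = nested_integral Qs x A n 0 (\<lambda>_. undefined)) \<and>
        (\<forall>i<n. \<forall>A\<in>sets (euclid q). \<forall>x\<in>space M. \<forall>x'\<in>space M. \<forall>z\<in>space (outputs q i).
           emeasure (Qs i (x, z)) A \<le> ennreal (exp \<alpha>) * emeasure (Qs i (x', z)) A))"

definition private_channels ::
  "'a measure \<Rightarrow> nat \<Rightarrow> nat \<Rightarrow> real \<Rightarrow> ((nat \<Rightarrow> 'a) \<Rightarrow> (nat \<Rightarrow> nat \<Rightarrow> real) measure) set" where
  "private_channels M q n \<alpha> = {Q \<in> channels M q n. sequentially_interactive M q n \<alpha> Q}"

definition channel_risk ::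
  "nat \<Rightarrow> nat \<Rightarrow> ((nat \<Rightarrow> 'a) \<Rightarrow> (nat \<Rightarrow> nat \<Rightarrow> real) measure) \<Rightarrow>
   'a measure set \<Rightarrow> ('a measure \<Rightarrow> real) \<Rightarrow> (real \<Rightarrow> real) \<Rightarrow> ennreal" where
  "channel_risk q n Q \<P> \<theta> l =
     (INF T\<in>borel_measurable (outputs q n). SUP P\<in>\<P>.
        \<integral>\<^sup>+ z. ennreal (l \<bar>T z - \<theta> P\<bar>) \<partial>(bind (PiM {..<n} (\<lambda>_. P)) Q))"

definition private_minimax_risk ::
  "'a measure \<Rightarrow> nat \<Rightarrow> real \<Rightarrow> 'a measure set \<Rightarrow> ('a measure \<Rightarrow> real) \<Rightarrow>
   (real \<Rightarrow> real) \<Rightarrow> ennreal" where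
  "private_minimax_risk M n \<alpha> \<P> \<theta> l =
     (INF q\<in>{1..}. INF Q\<in>private_channels M q n \<alpha>. channel_risk q n Q \<P> \<theta> l)"

end

theory Submission
  imports Defs
begin

text \<open>
  Lower bound: if \<open>P0\<close> and \<open>P1\<close> are at total variation distance \<open>\<epsilon>\<close>, then, given the past, the output
  laws of a private kernel under \<open>P0\<close> and \<open>P1\<close> differ relatively by at most
  \<open>\<delta> = (e\<^sup>\<alpha> - 1) \<epsilon>\<close>. Chaining the resulting \<open>\<chi>\<^sup>2\<close>-type bound over the \<open>n\<close> rounds costs a factor
  \<open>(1 + \<delta>\<^sup>2)\<^sup>n\<close>, which stays bounded for \<open>\<epsilon> = n\<^sup>-\<^sup>1\<^sup>/\<^sup>2\<close>, and Le Cam's two-point argument applies.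

  Upper bound: convexity gives \<open>\<theta> P0 - \<theta> P1 \<le> \<omega> + (\<omega> / \<epsilon>) TV(P0, P1)\<close>, and minimax duality turns
  this into a function \<open>\<psi>\<close> with \<open>\<bar>\<psi>\<bar> \<le> \<omega> / \<epsilon>\<close> whose expectation is, up to a constant, within \<open>2 \<omega>\<close> of
  \<open>\<theta>\<close> on all of \<open>\<P>\<close>. Each individual reports a sign whose mean is proportional to \<open>\<psi> (x i)\<close>
  (randomized response); the average of the reports is sub-Gaussian at scale \<open>\<omega>\<close>, and the loss grows
  at most exponentially at that scale.
\<close>

text \<open>The two bounds meet at \<open>\<epsilon> = n powr (-1/2)\<close> for different reasons.
  Below, this is the largest order at which \<open>n * \<delta>\<^sup>2\<close>, hence
  \<open>(1 + \<delta>\<^sup>2) ^ n\<close>, stays bounded. Above, a one-bit private report of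
  \<open>\<psi>\<close> needs an amplitude proportional to its range
  \<open>\<omega> / \<epsilon>\<close>; averaging \<open>n\<close> reports divides the noise by the
  square root of \<open>n\<close>, which cancels \<open>1 / \<epsilon>\<close> and leaves noise of
  order \<open>\<omega>\<close>, the order of the bias. Convexity and linearity serve to pass from
  the local quantity \<open>\<omega>\<close> to a bound on all of \<open>\<P>\<close>: along a
  segment, total variation and the increment of \<open>\<theta>\<close> scale with the same weight.
  The additive \<open>\<omega>\<close> in that bound pays for pairs closer than
  \<open>\<epsilon>\<close> and reappears as bias. The dual function has to be bounded everywhere,
  because its values become coin probabilities; mean square control would not keep them in the range
  that privacy allows.\<close>

section \<open>Minimax duality for bounded test functions\<close>

text \<open>The weights \<open>4 ^ k\<close> leave the summable series \<open>C / 2 ^ k\<close>, so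
  the weighted sum \<open>S\<close> of squares is finite almost everywhere, and each term being at
  most \<open>S\<close> gives \<open>B = sqrt S\<close>. A rate of \<open>8 ^ k\<close> in mean
  square thus yields pointwise decay of the whole sequence, with no passage to a
  subsequence.\<close>

lemma AE_geometric_bound_of_square_integrals:
  fixes f :: "nat \<Rightarrow> 'a \<Rightarrow> real"
  assumes [measurable]: "\<And>k. f k \<in> borel_measurable \<nu>"
    and bound: "\<And>k. (\<integral>\<^sup>+x. ennreal ((f k x)\<^sup>2) \<partial>\<nu>) \<le> ennreal (C / 8 ^ k)"
    and C: "0 \<le> C"
  shows "AE x in \<nu>. \<exists>B. \<forall>k. \<bar>f k x\<bar> \<le> B / 2 ^ k"
proof -
  have "(\<integral>\<^sup>+x. (\<Sum>k. ennreal (4 ^ k * (f k x)\<^sup>2)) \<partial>\<nu>) = (\<Sum>k. \<integral>\<^sup>+x. ennreal (4 ^ k * (f k x)\<^sup>2) \<partial>\<nu>)"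
    by (rule nn_integral_suminf) measurable
  also have "\<dots> \<le> (\<Sum>k. ennreal (C * (1 / 2) ^ k))"
  proof (rule suminf_le)
    fix k
    have "(\<integral>\<^sup>+x. ennreal (4 ^ k * (f k x)\<^sup>2) \<partial>\<nu>) = ennreal (4 ^ k) * (\<integral>\<^sup>+x. ennreal ((f k x)\<^sup>2) \<partial>\<nu>)"
      by (subst nn_integral_cmult[symmetric]) (auto simp: ennreal_mult)
    also have "\<dots> \<le> ennreal (4 ^ k) * ennreal (C / 8 ^ k)"
      by (intro mult_left_mono bound) auto
    also have "\<dots> = ennreal (C * (1 / 2) ^ k)"
    proof -
      have "(8::real) ^ k = 4 ^ k * 2 ^ k"
        by (simp flip: power_mult_distrib)
      then have "4 ^ k * (C / 8 ^ k) = C * (1 / 2) ^ k"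
        by (simp add: power_one_over divide_simps)
      then show ?thesis
        using C by (simp flip: ennreal_mult)
    qed
    finally show "(\<integral>\<^sup>+x. ennreal (4 ^ k * (f k x)\<^sup>2) \<partial>\<nu>) \<le> ennreal (C * (1 / 2) ^ k)" .
  qed auto
  also have "\<dots> = ennreal (\<Sum>k. C * (1 / 2) ^ k)"
    by (rule suminf_ennreal2) (use C in \<open>auto intro!: summable_mult summable_geometric\<close>)
  finally have "(\<integral>\<^sup>+x. (\<Sum>k. ennreal (4 ^ k * (f k x)\<^sup>2)) \<partial>\<nu>) \<noteq> \<infinity>"
    by (metis ennreal_neq_top infinity_ennreal_def neq_top_trans)
  then have "AE x in \<nu>. (\<Sum>k. ennreal (4 ^ k * (f k x)\<^sup>2)) \<noteq> \<infinity>"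
    by (intro nn_integral_PInf_AE) auto
  then show ?thesis
  proof eventually_elim
    case (elim x)
    define S where "S = enn2real (\<Sum>k. ennreal (4 ^ k * (f k x)\<^sup>2))"
    have S: "ennreal S = (\<Sum>k. ennreal (4 ^ k * (f k x)\<^sup>2))"
      using elim by (simp add: S_def less_top)
    have "\<bar>f k x\<bar> \<le> sqrt S / 2 ^ k" for k
    proof -
      have four: "((2::real) ^ k)\<^sup>2 = 4 ^ k"
        by (simp add: power2_eq_square flip: power_mult_distrib)
      have "ennreal (4 ^ k * (f k x)\<^sup>2) \<le> ennreal S"
        unfolding S by (rule order_trans[OF _ sum_le_suminf[of _ "{k}"]]) auto
      then have "4 ^ k * (f k x)\<^sup>2 \<le> S"
        by (subst (asm) ennreal_le_iff) (simp_all add: S_def)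
      then have "(2 ^ k * \<bar>f k x\<bar>)\<^sup>2 \<le> S"
        by (simp add: power_mult_distrib four)
      then have "2 ^ k * \<bar>f k x\<bar> \<le> sqrt S"
        by (rule real_le_rsqrt)
      then show ?thesis
        by (simp add: field_simps)
    qed
    then show ?case by blast
  qed
qed

section \<open>Clipping and the Huber function\<close>

definition clip :: "real \<Rightarrow> real \<Rightarrow> real" where
  "clip L u = max (- L) (min L u)"

lemma abs_clip_le: "0 \<le> L \<Longrightarrow> \<bar>clip L u\<bar> \<le> L"
  by (auto simp: clip_def)

lemma borel_measurable_clip [measurable]: "clip L \<in> borel_measurable borel"
  unfolding clip_def by measurable

definition huber :: "real \<Rightarrow> real \<Rightarrow> real \<Rightarrow> real" where
  "huber L \<eta> u = clip L (u / \<eta>) * u - \<eta> * (clip L (u / \<eta>))\<^sup>2 / 2"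

lemma borel_measurable_huber [measurable]: "huber L \<eta> \<in> borel_measurable borel"
  unfolding huber_def by measurable

text \<open>The Huber function is the conjugate of \<open>m \<mapsto> \<eta> m\<^sup>2 / 2\<close> on \<open>[-L, L]\<close>; the
  quadratic surplus comes from the strong convexity of the latter.\<close>

lemma huber_ge:
  assumes "0 \<le> L" "0 < \<eta>" "\<bar>m\<bar> \<le> L"
  shows "m * u - \<eta> * m\<^sup>2 / 2 + \<eta> / 2 * (clip L (u / \<eta>) - m)\<^sup>2 \<le> huber L \<eta> u"
proof -
  define c where "c = clip L (u / \<eta>)"
  have "(u - \<eta> * c) * (m - c) \<le> 0"
  proof -
    consider "u / \<eta> < - L" | "L < u / \<eta>" | "- L \<le> u / \<eta>" "u / \<eta> \<le> L"
      by linarith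
    then show ?thesis
    proof cases
      case 1
      then have "c = - L" using assms by (auto simp: c_def clip_def)
      moreover have "u \<le> - \<eta> * L" using 1 assms(2) by (simp add: field_simps)
      ultimately show ?thesis using assms(3)
        by (intro mult_nonpos_nonneg) auto
    next
      case 2
      then have "c = L" using assms by (auto simp: c_def clip_def)
      moreover have "\<eta> * L \<le> u" using 2 assms(2) by (simp add: field_simps)
      ultimately show ?thesis using assms(3)
        by (intro mult_nonneg_nonpos) auto
    next
      case 3
      then have "c = u / \<eta>" by (auto simp: c_def clip_def)
      then show ?thesis using assms by simp
    qed
  qed
  moreover have "huber L \<eta> u = c * u - \<eta> * c\<^sup>2 / 2"
    by (simp add: huber_def c_def)
  ultimately show ?thesis
    by (simp add: c_def[symmetric] power2_eq_square algebra_simps)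
qed

lemma huber_ge_abs:
  assumes "0 \<le> L" "0 < \<eta>"
  shows "L * \<bar>u\<bar> - \<eta> * L\<^sup>2 / 2 \<le> huber L \<eta> u"
proof -
  have "\<bar>sgn u * L\<bar> \<le> L"
    using assms by (simp add: sgn_if)
  from huber_ge[OF assms this, of u]
  have "sgn u * L * u - \<eta> * (sgn u * L)\<^sup>2 / 2 \<le> huber L \<eta> u"
    using assms by (smt (verit) mult_nonneg_nonneg zero_le_power2 divide_nonneg_nonneg)
  moreover have "sgn u * L * u = L * \<bar>u\<bar>"
    by (simp add: abs_sgn)
  moreover have "\<eta> * (sgn u * L)\<^sup>2 / 2 \<le> \<eta> * L\<^sup>2 / 2"
    using assms by (auto simp: sgn_if)
  ultimately show ?thesis by linarith
qed

text \<open>With the maximiser \<open>m\<close> fixed, the Huber value of the combination is affine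
  in the point and so splits over \<open>u\<close> and \<open>v\<close>. Only the \<open>u\<close>
  part is bounded by \<open>huber_ge\<close>, which supplies the quadratic surplus; the
  \<open>v\<close> part stays linear in \<open>v\<close>, so that the integral of
  \<open>m * v\<close> survives as a directional derivative.\<close>

lemma huber_convex_combination_le:
  assumes "0 \<le> L" "0 < \<eta>" "0 \<le> t" "t \<le> 1"
  defines "m \<equiv> \<lambda>u v. clip L (((1 - t) * u + t * v) / \<eta>)"
  shows "huber L \<eta> ((1 - t) * u + t * v) \<le>
    (1 - t) * (huber L \<eta> u - \<eta> / 2 * (clip L (u / \<eta>) - m u v)\<^sup>2) +
    t * (m u v * v - \<eta> * (m u v)\<^sup>2 / 2)"
proof -
  have "m u v * u - \<eta> * (m u v)\<^sup>2 / 2 \<le> huber L \<eta> u - \<eta> / 2 * (clip L (u / \<eta>) - m u v)\<^sup>2"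
    using huber_ge[OF assms(1,2) abs_clip_le[OF assms(1)], of "((1 - t) * u + t * v) / \<eta>" u]
    by (simp add: m_def)
  then have "(1 - t) * (m u v * u - \<eta> * (m u v)\<^sup>2 / 2) \<le>
      (1 - t) * (huber L \<eta> u - \<eta> / 2 * (clip L (u / \<eta>) - m u v)\<^sup>2)"
    using assms by (intro mult_left_mono) auto
  moreover have "huber L \<eta> ((1 - t) * u + t * v) =
    (1 - t) * (m u v * u - \<eta> * (m u v)\<^sup>2 / 2) + t * (m u v * v - \<eta> * (m u v)\<^sup>2 / 2)"
  proof -
    have "c * ((1 - t) * u + t * v) - \<eta> * c\<^sup>2 / 2 =
        (1 - t) * (c * u - \<eta> * c\<^sup>2 / 2) + t * (c * v - \<eta> * c\<^sup>2 / 2)" for c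
      by (simp add: field_simps)
    then show ?thesis unfolding huber_def m_def .
  qed
  ultimately show ?thesis by linarith
qed

text \<open>Uniform convexity measured on the clips: \<open>huber_ge\<close> is used at both ends
  with the maximiser of the midpoint, and the two surpluses together dominate the squared distance
  of the end clips. The weights are written \<open>1 - 1 / 2\<close> and \<open>1 / 2\<close> to
  match a convexity hypothesis taken at \<open>t = 1 / 2\<close>.\<close>

lemma huber_midpoint_le:
  assumes "0 \<le> L" "0 < \<eta>"
  shows "2 * huber L \<eta> ((1 - 1 / 2) * u + 1 / 2 * v) + \<eta> / 4 * (clip L (u / \<eta>) - clip L (v / \<eta>))\<^sup>2
    \<le> huber L \<eta> u + huber L \<eta> v"
proof -
  define w where "w = (1 - 1 / 2) * u + 1 / 2 * v"
  define m where "m = clip L (w / \<eta>)"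
  define a where "a = clip L (u / \<eta>)"
  define b where "b = clip L (v / \<eta>)"
  have "\<bar>m\<bar> \<le> L" using abs_clip_le[OF assms(1)] by (simp add: m_def)
  from huber_ge[OF assms this, of u] huber_ge[OF assms this, of v]
  have "m * (u + v) - \<eta> * m\<^sup>2 + \<eta> / 2 * ((a - m)\<^sup>2 + (b - m)\<^sup>2) \<le> huber L \<eta> u + huber L \<eta> v"
    by (simp add: a_def b_def algebra_simps)
  moreover have "2 * huber L \<eta> w = m * (u + v) - \<eta> * m\<^sup>2"
    by (simp add: huber_def m_def[symmetric]) (simp add: w_def algebra_simps)
  moreover have "\<eta> / 4 * (a - b)\<^sup>2 \<le> \<eta> / 2 * ((a - m)\<^sup>2 + (b - m)\<^sup>2)"
  proof -
    have "(a - b)\<^sup>2 \<le> 2 * ((a - m)\<^sup>2 + (b - m)\<^sup>2)"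
      using zero_le_power2[of "(a - m) + (b - m)"] by (simp add: power2_eq_square algebra_simps)
    then have "\<eta> / 4 * (a - b)\<^sup>2 \<le> \<eta> / 4 * (2 * ((a - m)\<^sup>2 + (b - m)\<^sup>2))"
      using assms by (intro mult_left_mono) auto
    then show ?thesis by (simp add: algebra_simps)
  qed
  ultimately show ?thesis
    unfolding w_def[symmetric] a_def[symmetric] b_def[symmetric] by linarith
qed

lemma convergent_of_geometric_differences:
  fixes f :: "nat \<Rightarrow> real"
  assumes "\<And>k. \<bar>f k - f (Suc k)\<bar> \<le> B / 2 ^ k"
  shows "convergent f"
proof -
  have "summable (\<lambda>k. f (Suc k) - f k)"
  proof (rule summable_comparison_test')
    show "summable (\<lambda>k. B * (1 / 2) ^ k)"
      by (intro summable_mult summable_geometric) auto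
    show "norm (f (Suc k) - f k) \<le> B * (1 / 2) ^ k" if "0 \<le> k" for k
      using assms[of k] by (simp add: power_one_over abs_minus_commute)
  qed
  then have "convergent (\<lambda>n. \<Sum>k<n. f (Suc k) - f k)"
    by (simp add: summable_iff_convergent)
  then have "convergent (\<lambda>n. f n - f 0)"
    by (simp add: sum_lessThan_telescope)
  then show ?thesis
    by (rule convergent_diff_const_right_iff[THEN iffD1])
qed

lemma tendsto_zero_of_geometric_bound:
  fixes f :: "nat \<Rightarrow> real"
  assumes "\<And>k. \<bar>f k\<bar> \<le> B / 2 ^ k"
  shows "f \<longlonglongrightarrow> 0"
proof (rule Lim_null_comparison)
  show "\<forall>\<^sub>F k in sequentially. norm (f k) \<le> B * (1 / 2) ^ k"
    using assms by (simp add: power_one_over)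
  show "(\<lambda>k. B * (1 / 2) ^ k) \<longlonglongrightarrow> 0"
    by (intro tendsto_mult_right_zero LIMSEQ_realpow_zero) auto
qed

lemma (in finite_measure) integrable_huber:
  assumes u: "integrable M u" and L: "0 \<le> L" "0 < \<eta>"
  shows "integrable M (\<lambda>x. huber L \<eta> (u x))"
proof (rule Bochner_Integration.integrable_bound)
  show "integrable M (\<lambda>x. L * \<bar>u x\<bar> + \<eta> * L\<^sup>2 / 2)"
    using u by auto
  show "(\<lambda>x. huber L \<eta> (u x)) \<in> borel_measurable M"
    using u by measurable
  show "AE x in M. norm (huber L \<eta> (u x)) \<le> norm (L * \<bar>u x\<bar> + \<eta> * L\<^sup>2 / 2)"
  proof (intro AE_I2)
    fix x
    define c where "c = clip L (u x / \<eta>)"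
    have c: "\<bar>c\<bar> \<le> L" using abs_clip_le[OF L(1)] by (simp add: c_def)
    have "\<bar>c * u x\<bar> \<le> L * \<bar>u x\<bar>" using c by (simp add: abs_mult mult_right_mono)
    moreover have "\<bar>\<eta> * c\<^sup>2 / 2\<bar> \<le> \<eta> * L\<^sup>2 / 2"
      using power_mono[OF c, of 2] L by (simp add: abs_mult)
    ultimately show "norm (huber L \<eta> (u x)) \<le> norm (L * \<bar>u x\<bar> + \<eta> * L\<^sup>2 / 2)"
      unfolding huber_def c_def[symmetric] by simp
  qed
qed

lemma (in finite_measure) integral_abs_mult_le:
  assumes "integrable M u" "m \<in> borel_measurable M" "\<And>x. \<bar>m x\<bar> \<le> (L::real)"
  shows "integrable M (\<lambda>x. m x * u x)" "\<bar>\<integral>x. m x * u x \<partial>M\<bar> \<le> L * (\<integral>x. \<bar>u x\<bar> \<partial>M)"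
proof -
  have u: "integrable M (\<lambda>x. L * \<bar>u x\<bar>)" using assms(1) by auto
  have b: "norm (m x * u x) \<le> L * \<bar>u x\<bar>" for x
    using assms(3)[of x] by (simp add: abs_mult mult_right_mono)
  have "0 \<le> L" using assms(3)[of undefined] by linarith
  show "integrable M (\<lambda>x. m x * u x)"
    by (rule Bochner_Integration.integrable_bound[OF u])
      (use assms b \<open>0 \<le> L\<close> in \<open>auto simp: abs_mult\<close>)
  show "\<bar>\<integral>x. m x * u x \<partial>M\<bar> \<le> L * (\<integral>x. \<bar>u x\<bar> \<partial>M)"
  proof (rule order_trans[OF integral_abs_bound])
    have "(\<integral>x. \<bar>m x * u x\<bar> \<partial>M) \<le> (\<integral>x. L * \<bar>u x\<bar> \<partial>M)"
      using b \<open>integrable M (\<lambda>x. m x * u x)\<close> u by (intro integral_mono integrable_abs) auto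
    then show "(\<integral>x. \<bar>m x * u x\<bar> \<partial>M) \<le> L * (\<integral>x. \<bar>u x\<bar> \<partial>M)" by simp
  qed
qed

text \<open>Instead of weak-* compactness of the \<open>L\<^sup>\<infinity>\<close> ball, the dual problem is
  regularised by \<open>\<eta> \<psi>\<^sup>2 / 2\<close>. The clipped densities of a maximising sequence of the regularised
  primal problem are then Cauchy in \<open>L\<^sup>2\<close>, and their limit is the dual solution.\<close>

lemma (in finite_measure) ex_bounded_dual_function:
  fixes U :: "(('a \<Rightarrow> real) \<times> real) set"
  assumes ne: "U \<noteq> {}"
    and integrable: "\<And>u s. (u, s) \<in> U \<Longrightarrow> integrable M u"
    and convex: "\<And>u s v r t. (u, s) \<in> U \<Longrightarrow> (v, r) \<in> U \<Longrightarrow> 0 \<le> t \<Longrightarrow> t \<le> 1 \<Longrightarrow>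
      (\<lambda>x. (1 - t) * u x + t * v x, (1 - t) * s + t * r) \<in> U"
    and bound: "\<And>u s. (u, s) \<in> U \<Longrightarrow> s \<le> W + L * (\<integral>x. \<bar>u x\<bar> \<partial>M)"
    and L: "0 \<le> L" and \<kappa>: "0 < \<kappa>"
  shows "\<exists>\<psi>\<in>borel_measurable M. (\<forall>x. \<bar>\<psi> x\<bar> \<le> L) \<and>
    (\<forall>(u, s)\<in>U. s - (\<integral>x. \<psi> x * u x \<partial>M) \<le> W + \<kappa>)"
proof -
  define V where "V = L\<^sup>2 * measure M (space M)"
  have V: "0 \<le> V" by (simp add: V_def)
  \<comment> \<open>For a function bounded by \<open>L\<close> the quadratic penalty integrates to
    at most \<open>\<eta> * V / 2\<close>; this choice keeps that below \<open>\<kappa>\<close>, and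
    the \<open>+ 1\<close> covers \<open>V = 0\<close>.\<close>
  define \<eta> where "\<eta> = 2 * \<kappa> / (V + 1)"
  have \<eta>: "0 < \<eta>" using V \<kappa> by (simp add: \<eta>_def)
  have \<eta>V: "\<eta> * V / 2 \<le> \<kappa>" using V \<kappa> by (simp add: \<eta>_def field_simps)
  \<comment> \<open>The regularised primal value: the integral of the Huber function is the supremum
    of the integrals of \<open>m * u - \<eta> * m\<^sup>2 / 2\<close> over measurable
    \<open>m\<close> bounded by \<open>L\<close>.\<close>
  define G where "G = (\<lambda>(u, s). s - (\<integral>x. huber L \<eta> (u x) \<partial>M))"
  have G_le: "G (u, s) \<le> W + \<kappa>" if "(u, s) \<in> U" for u s
  proof -
    note i = integrable[OF that]
    have "(\<integral>x. L * \<bar>u x\<bar> - \<eta> * L\<^sup>2 / 2 \<partial>M) \<le> (\<integral>x. huber L \<eta> (u x) \<partial>M)"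
      using i L \<eta> by (intro integral_mono integrable_huber huber_ge_abs) auto
    then have "L * (\<integral>x. \<bar>u x\<bar> \<partial>M) - \<eta> * V / 2 \<le> (\<integral>x. huber L \<eta> (u x) \<partial>M)"
      using i by (simp add: V_def ac_simps)
    then show ?thesis
      using bound[OF that] \<eta>V by (simp add: G_def)
  qed
  define \<Gamma> where "\<Gamma> = Sup (G ` U)"
  have bdd: "bdd_above (G ` U)" using G_le by (force intro: bdd_aboveI2)
  have G_le_\<Gamma>: "G (u, s) \<le> \<Gamma>" if "(u, s) \<in> U" for u s
    unfolding \<Gamma>_def using that bdd by (intro cSup_upper) auto
  have \<Gamma>_le: "\<Gamma> \<le> W + \<kappa>"
    unfolding \<Gamma>_def using ne G_le by (intro cSup_least) auto
  \<comment> \<open>\<open>t k\<close> is both the step towards a competitor and the square root of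
    the optimality gap, so the gap \<open>(t k)\<^sup>2\<close> divided by the step still tends to
    \<open>0\<close>. The base \<open>8\<close> gives the rate required by the almost everywhere
    lemma, and \<open>t k \<le> 1 / 8\<close> keeps \<open>1 - t k\<close> above
    \<open>1 / 2\<close>.\<close>
  define t :: "nat \<Rightarrow> real" where "t k = 1 / 8 ^ Suc k" for k
  have t: "0 < t k" "t k \<le> 1 / 8" for k
  proof -
    have "(1::real) \<le> 8 ^ k" by simp
    then show "0 < t k" "t k \<le> 1 / 8" by (auto simp: t_def field_simps)
  qed
  have t_Suc: "t (Suc k) \<le> t k" for k by (simp add: t_def field_simps)
  have "\<exists>p. p \<in> U \<and> \<Gamma> - (t k)\<^sup>2 < G p" for k
  proof -
    have "\<Gamma> - (t k)\<^sup>2 < Sup (G ` U)" using t(1)[of k] by (simp add: \<Gamma>_def)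
    then obtain y where "y \<in> G ` U" "\<Gamma> - (t k)\<^sup>2 < y"
      using ne bdd by (subst (asm) less_cSup_iff) auto
    then show ?thesis by auto
  qed
  then obtain p where p: "\<And>k. p k \<in> U" "\<And>k. \<Gamma> - (t k)\<^sup>2 < G (p k)" by metis
  define u where "u k = fst (p k)" for k
  define s where "s k = snd (p k)" for k
  have us: "(u k, s k) \<in> U" "\<Gamma> - (t k)\<^sup>2 < G (u k, s k)" for k
    using p by (simp_all add: u_def s_def)
  have ui: "integrable M (u k)" for k using integrable us by blast
  have [measurable]: "u k \<in> borel_measurable M" for k using ui by auto
  define c where "c k x = clip L (u k x / \<eta>)" for k x
  have [measurable]: "c k \<in> borel_measurable M" for k unfolding c_def by measurable
  have c: "\<bar>c k x\<bar> \<le> L" for k x using abs_clip_le[OF L] by (simp add: c_def)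
  have sq: "integrable M (\<lambda>x. (f x - g x)\<^sup>2)"
    if [measurable]: "f \<in> borel_measurable M" "g \<in> borel_measurable M"
      and b: "\<And>x. \<bar>f x\<bar> \<le> L" "\<And>x. \<bar>g x\<bar> \<le> L" for f g :: "'a \<Rightarrow> real"
  proof (rule integrable_const_bound[where B = "(2 * L)\<^sup>2"])
    have "(\<bar>f x - g x\<bar>)\<^sup>2 \<le> (2 * L)\<^sup>2" for x
      using b[of x] by (intro power_mono) auto
    then show "AE x in M. norm ((f x - g x)\<^sup>2) \<le> (2 * L)\<^sup>2" by simp
  qed measurable
  have "AE x in M. \<exists>B. \<forall>k. \<bar>c k x - c (Suc k) x\<bar> \<le> B / 2 ^ k"
  proof (rule AE_geometric_bound_of_square_integrals)
    fix k
    \<comment> \<open>The midpoint of two near-maximisers lies in \<open>U\<close>, so its value is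
      at most \<open>\<Gamma>\<close>; the strong convexity surplus is therefore paid by the two
      gaps alone.\<close>
    let ?w = "\<lambda>x. (1 - 1 / 2) * u k x + 1 / 2 * u (Suc k) x"
    have w: "(?w, (1 - 1 / 2) * s k + 1 / 2 * s (Suc k)) \<in> U"
      by (rule convex) (use us in auto)
    have mid: "2 * huber L \<eta> (?w x) + \<eta> / 4 * (c k x - c (Suc k) x)\<^sup>2 \<le>
        huber L \<eta> (u k x) + huber L \<eta> (u (Suc k) x)" for x
      unfolding c_def by (rule huber_midpoint_le[OF L \<eta>])
    have i1: "integrable M (\<lambda>x. 2 * huber L \<eta> (?w x))"
      by (intro integrable_mult_right integrable_huber L \<eta> integrable[OF w])
    have i2: "integrable M (\<lambda>x. \<eta> / 4 * (c k x - c (Suc k) x)\<^sup>2)"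
      by (intro integrable_mult_right sq c) measurable
    note i3 = integrable_huber[OF ui L \<eta>]
    have "(\<integral>x. 2 * huber L \<eta> (?w x) + \<eta> / 4 * (c k x - c (Suc k) x)\<^sup>2 \<partial>M) \<le>
        (\<integral>x. huber L \<eta> (u k x) + huber L \<eta> (u (Suc k) x) \<partial>M)"
      by (rule integral_mono[OF Bochner_Integration.integrable_add[OF i1 i2]
            Bochner_Integration.integrable_add[OF i3 i3] mid])
    then have "2 * (\<integral>x. huber L \<eta> (?w x) \<partial>M) + \<eta> / 4 * (\<integral>x. (c k x - c (Suc k) x)\<^sup>2 \<partial>M) \<le>
        (\<integral>x. huber L \<eta> (u k x) \<partial>M) + (\<integral>x. huber L \<eta> (u (Suc k) x) \<partial>M)"
      unfolding Bochner_Integration.integral_add[OF i1 i2] Bochner_Integration.integral_add[OF i3 i3]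
        integral_mult_right_zero .
    then have "\<eta> / 4 * (\<integral>x. (c k x - c (Suc k) x)\<^sup>2 \<partial>M) \<le> (t k)\<^sup>2 + (t (Suc k))\<^sup>2"
      using G_le_\<Gamma>[OF w] us(2)[of k] us(2)[of "Suc k"] by (simp add: G_def)
    also have "\<dots> \<le> 2 * (t k)\<^sup>2"
      using power_mono[OF t_Suc, of k 2] t(1)[of "Suc k"] by simp
    also have "\<dots> \<le> 2 * (t k * 1)"
      unfolding power2_eq_square using t[of k] by (intro mult_left_mono) auto
    also have "\<dots> \<le> 2 / 8 ^ k" by (simp add: t_def field_simps)
    finally have "(\<integral>x. (c k x - c (Suc k) x)\<^sup>2 \<partial>M) \<le> (8 / \<eta>) / 8 ^ k"
      using \<eta> by (simp add: field_simps)
    then show "(\<integral>\<^sup>+x. ennreal ((c k x - c (Suc k) x)\<^sup>2) \<partial>M) \<le> ennreal ((8 / \<eta>) / 8 ^ k)"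
      by (subst nn_integral_eq_integral) (auto intro: sq c ennreal_leI)
  qed (use \<eta> in auto)
  then have conv: "AE x in M. convergent (\<lambda>k. c k x)"
    by eventually_elim (blast intro: convergent_of_geometric_differences)
  \<comment> \<open>\<open>lim\<close> is arbitrary where the sequence diverges. The outer
    \<open>clip\<close> makes the bound by \<open>L\<close> hold at every point and changes nothing
    where the limit exists.\<close>
  define \<psi> where "\<psi> x = clip L (lim (\<lambda>k. c k x))" for x
  have [measurable]: "\<psi> \<in> borel_measurable M"
    unfolding \<psi>_def
    by (rule measurable_compose[OF borel_measurable_lim_metric borel_measurable_clip]) measurable
  have \<psi>: "\<bar>\<psi> x\<bar> \<le> L" for x using abs_clip_le[OF L] by (simp add: \<psi>_def)
  have lim_\<psi>: "AE x in M. (\<lambda>k. c k x) \<longlonglongrightarrow> \<psi> x"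
    using conv
  proof eventually_elim
    case (elim x)
    then have l: "(\<lambda>k. c k x) \<longlonglongrightarrow> lim (\<lambda>k. c k x)" by (simp add: convergent_LIMSEQ_iff)
    have "c k x \<le> L" "- L \<le> c k x" for k using c[of k x] by (auto simp: abs_le_iff)
    then have "lim (\<lambda>k. c k x) \<le> L" "- L \<le> lim (\<lambda>k. c k x)"
      by (blast intro: LIMSEQ_le_const2[OF l] LIMSEQ_le_const[OF l])+
    then have "\<psi> x = lim (\<lambda>k. c k x)" by (auto simp: \<psi>_def clip_def)
    with l show ?case by simp
  qed
  have "r - (\<integral>x. \<psi> x * v x \<partial>M) \<le> W + \<kappa>" if vr: "(v, r) \<in> U" for v r
  proof -
    have vi: "integrable M v" using integrable[OF vr] .
    then have [measurable]: "v \<in> borel_measurable M" by auto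
    let ?w = "\<lambda>k x. (1 - t k) * u k x + t k * v x"
    \<comment> \<open>The optimal dual response at the point reached from \<open>u k\<close> by a
      step \<open>t k\<close> towards \<open>v\<close>.\<close>
    define m where "m k x = clip L (?w k x / \<eta>)" for k x
    have [measurable]: "m k \<in> borel_measurable M" for k unfolding m_def by measurable
    have m: "\<bar>m k x\<bar> \<le> L" for k x using abs_clip_le[OF L] by (simp add: m_def)
    have mv: "integrable M (\<lambda>x. m k x * v x)" "\<bar>\<integral>x. m k x * v x \<partial>M\<bar> \<le> L * (\<integral>x. \<bar>v x\<bar> \<partial>M)" for k
      using integral_abs_mult_le[OF vi \<open>m k \<in> borel_measurable M\<close> m] by auto
    define D where "D k = (\<integral>x. (c k x - m k x)\<^sup>2 \<partial>M)" for k
    have D: "0 \<le> D k" for k by (simp add: D_def)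
    \<comment> \<open>First-order optimality: the step can gain at most the gap
      \<open>(t k)\<^sup>2\<close>. Without the \<open>D\<close> term and divided by
      \<open>t k\<close>, this bounds the value of \<open>m k\<close> at \<open>(v, r)\<close> by
      \<open>\<Gamma> + t k\<close>. With the \<open>D\<close> term, it forces \<open>D k\<close> to
      be of order \<open>t k\<close>, so that \<open>m k\<close> has the same limit as
      \<open>c k\<close>.\<close>
    have key: "(1 - t k) * \<eta> / 2 * D k + t k * (r - (\<integral>x. m k x * v x \<partial>M)) \<le> t k * \<Gamma> + (t k)\<^sup>2" for k
    proof -
      have t1: "0 \<le> t k" "t k \<le> 1" using t[of k] by auto
      have w: "(?w k, (1 - t k) * s k + t k * r) \<in> U"
        by (rule convex[OF us(1) vr t1])
      have m2: "integrable M (\<lambda>x. (m k x)\<^sup>2)" using sq[of "m k" "\<lambda>_. 0"] m[of k] L by simp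
      have cv: "huber L \<eta> (?w k x) \<le> (1 - t k) * (huber L \<eta> (u k x) - \<eta> / 2 * (c k x - m k x)\<^sup>2) +
          t k * (m k x * v x - \<eta> * (m k x)\<^sup>2 / 2)" for x
        unfolding c_def m_def by (rule huber_convex_combination_le[OF L \<eta> t1])
      note i1 = integrable_huber[OF ui L \<eta>, of k]
      have i2: "integrable M (\<lambda>x. \<eta> / 2 * (c k x - m k x)\<^sup>2)"
        by (intro integrable_mult_right sq c m) measurable
      have i3: "integrable M (\<lambda>x. m k x * v x)" by (rule mv(1))
      have i4: "integrable M (\<lambda>x. \<eta> * (m k x)\<^sup>2 / 2)" using m2 by auto
      note i5 = integrable_mult_right[OF Bochner_Integration.integrable_diff[OF i1 i2], of "1 - t k"]
      note i6 = integrable_mult_right[OF Bochner_Integration.integrable_diff[OF i3 i4], of "t k"]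
      have "(\<integral>x. huber L \<eta> (?w k x) \<partial>M) \<le>
         (\<integral>x. (1 - t k) * (huber L \<eta> (u k x) - \<eta> / 2 * (c k x - m k x)\<^sup>2) +
            t k * (m k x * v x - \<eta> * (m k x)\<^sup>2 / 2) \<partial>M)"
        by (rule integral_mono[OF integrable_huber[OF integrable[OF w] L \<eta>]
              Bochner_Integration.integrable_add[OF i5 i6] cv])
      also have "\<dots> = (1 - t k) * ((\<integral>x. huber L \<eta> (u k x) \<partial>M) - \<eta> / 2 * D k) +
            t k * ((\<integral>x. m k x * v x \<partial>M) - \<eta> * (\<integral>x. (m k x)\<^sup>2 \<partial>M) / 2)"
        unfolding Bochner_Integration.integral_add[OF i5 i6] integral_mult_right_zero
          Bochner_Integration.integral_diff[OF i1 i2] Bochner_Integration.integral_diff[OF i3 i4]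
          integral_divide_zero D_def ..
      also have "\<dots> \<le> (1 - t k) * ((\<integral>x. huber L \<eta> (u k x) \<partial>M) - \<eta> / 2 * D k) +
            t k * (\<integral>x. m k x * v x \<partial>M)"
        using t1 \<eta> by (intro add_left_mono mult_left_mono) auto
      finally have "(1 - t k) * (G (u k, s k) + \<eta> / 2 * D k) + t k * (r - (\<integral>x. m k x * v x \<partial>M)) \<le>
          G (?w k, (1 - t k) * s k + t k * r)"
        by (simp add: G_def algebra_simps)
      also have "\<dots> \<le> \<Gamma>" by (rule G_le_\<Gamma>[OF w])
      finally have 1: "(1 - t k) * (G (u k, s k) + \<eta> / 2 * D k) + t k * (r - (\<integral>x. m k x * v x \<partial>M)) \<le> \<Gamma>" .
      have "(1 - t k) * (\<Gamma> - (t k)\<^sup>2) \<le> (1 - t k) * G (u k, s k)"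
        using us(2)[of k] t1 by (intro mult_left_mono) auto
      moreover have "\<Gamma> - t k * \<Gamma> - (t k)\<^sup>2 \<le> (1 - t k) * (\<Gamma> - (t k)\<^sup>2)"
        using t1 by (simp add: algebra_simps)
      ultimately show ?thesis using 1 by (simp add: algebra_simps)
    qed
    have upper: "r - (\<integral>x. m k x * v x \<partial>M) \<le> \<Gamma> + t k" for k
    proof -
      have "0 \<le> (1 - t k) * \<eta> / 2 * D k" using t[of k] \<eta> D by simp
      with key[of k] have "t k * (r - (\<integral>x. m k x * v x \<partial>M)) \<le> t k * \<Gamma> + (t k)\<^sup>2"
        by linarith
      then have "t k * (r - (\<integral>x. m k x * v x \<partial>M)) \<le> t k * (\<Gamma> + t k)"
        by (simp add: power2_eq_square distrib_left)
      then show ?thesis using t(1)[of k] by (rule mult_left_le_imp_le)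
    qed
    \<comment> \<open>Dominates, uniformly in \<open>k\<close>, what remains of \<open>key\<close>
      after division by \<open>t k\<close>.\<close>
    define E where "E = 1 + \<bar>\<Gamma>\<bar> + \<bar>r\<bar> + L * (\<integral>x. \<bar>v x\<bar> \<partial>M)"
    have E: "0 \<le> E" using L by (simp add: E_def)
    have "AE x in M. \<exists>B. \<forall>k. \<bar>c k x - m k x\<bar> \<le> B / 2 ^ k"
    proof (rule AE_geometric_bound_of_square_integrals)
      fix k
      have "\<eta> / 4 * D k \<le> (1 - t k) * \<eta> / 2 * D k"
        using t[of k] \<eta> by (intro mult_right_mono D) (simp add: field_simps)
      also have "\<dots> \<le> t k * \<Gamma> + (t k)\<^sup>2 - t k * (r - (\<integral>x. m k x * v x \<partial>M))"
        using key[of k] by linarith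
      also have "\<dots> = t k * (\<Gamma> - r + (\<integral>x. m k x * v x \<partial>M) + t k)"
        by (simp add: power2_eq_square algebra_simps)
      also have "\<dots> \<le> t k * E"
        using t[of k] mv(2)[of k] by (intro mult_left_mono) (auto simp: E_def)
      also have "\<dots> \<le> E / 8 ^ k" using E by (simp add: t_def field_simps)
      finally have "D k \<le> (4 * E / \<eta>) / 8 ^ k" using \<eta> by (simp add: field_simps)
      then show "(\<integral>\<^sup>+x. ennreal ((c k x - m k x)\<^sup>2) \<partial>M) \<le> ennreal ((4 * E / \<eta>) / 8 ^ k)"
        by (subst nn_integral_eq_integral) (auto simp: D_def intro!: sq c m ennreal_leI)
    qed (use \<eta> E in auto)
    with lim_\<psi> have "AE x in M. (\<lambda>k. m k x) \<longlonglongrightarrow> \<psi> x"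
    proof eventually_elim
      case (elim x)
      then have "(\<lambda>k. c k x - m k x) \<longlonglongrightarrow> 0" by (auto intro: tendsto_zero_of_geometric_bound)
      from tendsto_diff[OF elim(1) this] show ?case by simp
    qed
    then have "(\<lambda>k. \<integral>x. m k x * v x \<partial>M) \<longlonglongrightarrow> (\<integral>x. \<psi> x * v x \<partial>M)"
      using vi m
      by (intro integral_dominated_convergence[where w = "\<lambda>x. L * \<bar>v x\<bar>"])
        (auto simp: abs_mult mult_right_mono intro: tendsto_mult_right)
    then have lhs: "(\<lambda>k. r - (\<integral>x. m k x * v x \<partial>M)) \<longlonglongrightarrow> r - (\<integral>x. \<psi> x * v x \<partial>M)"
      by (intro tendsto_diff tendsto_const)
    have "t \<longlonglongrightarrow> 0"
    proof (rule tendsto_zero_of_geometric_bound)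
      fix k
      have "(2::real) ^ k \<le> 8 ^ k" by (rule power_mono) auto
      then have "(2::real) ^ k \<le> 8 ^ Suc k" by (rule order_trans) auto
      then show "\<bar>t k\<bar> \<le> 1 / 2 ^ k" unfolding t_def by (auto intro!: frac_le)
    qed
    then have "(\<lambda>k. \<Gamma> + t k) \<longlonglongrightarrow> \<Gamma> + 0" by (intro tendsto_add tendsto_const)
    then have "r - (\<integral>x. \<psi> x * v x \<partial>M) \<le> \<Gamma> + 0"
      using upper by (intro LIMSEQ_le[OF lhs]) blast+
    then show ?thesis using \<Gamma>_le by simp
  qed
  then have "\<forall>(v, r)\<in>U. r - (\<integral>x. \<psi> x * v x \<partial>M) \<le> W + \<kappa>"
    by blast
  with \<psi> \<open>\<psi> \<in> borel_measurable M\<close> show ?thesis by blast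
qed

section \<open>Total variation and relative deviations\<close>

text \<open>Variational form of a bound on the \<open>\<chi>\<^sup>2\<close>-divergence; it avoids densities of kernels.\<close>

lemma square_integral_le_of_relative_deviation:
  fixes R0 R1 :: "'b measure" and g :: "'b \<Rightarrow> real"
  assumes "prob_space R0" "prob_space R1" and sets: "sets R1 = sets R0"
    and g: "g \<in> borel_measurable R0" "\<And>x. x \<in> space R0 \<Longrightarrow> 0 \<le> g x" "\<And>x. x \<in> space R0 \<Longrightarrow> g x \<le> 1"
    and \<delta>: "0 \<le> \<delta>"
    and dev: "\<And>f. f \<in> borel_measurable R0 \<Longrightarrow> (\<And>x. x \<in> space R0 \<Longrightarrow> 0 \<le> f x) \<Longrightarrow>
      (\<And>x. x \<in> space R0 \<Longrightarrow> f x \<le> 1) \<Longrightarrow>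
      \<bar>(\<integral>x. f x \<partial>R1) - (\<integral>x. f x \<partial>R0)\<bar> \<le> \<delta> * (\<integral>x. f x \<partial>R0)"
  shows "(\<integral>x. g x \<partial>R1)\<^sup>2 \<le> (1 + \<delta>\<^sup>2) * (\<integral>x. (g x)\<^sup>2 \<partial>R0)"
proof -
  interpret R0: prob_space R0 by fact
  interpret R1: prob_space R1 by fact
  have sp: "space R1 = space R0" using sets by (rule sets_eq_imp_space_eq)
  have int0: "integrable R0 f" if "f \<in> borel_measurable R0" "\<And>x. x \<in> space R0 \<Longrightarrow> \<bar>f x\<bar> \<le> 1"
    for f :: "'b \<Rightarrow> real"
    using that by (intro R0.integrable_const_bound[where B = 1]) (auto intro: AE_I2)
  have int1: "integrable R1 f" if "f \<in> borel_measurable R0" "\<And>x. x \<in> space R0 \<Longrightarrow> \<bar>f x\<bar> \<le> 1"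
    for f :: "'b \<Rightarrow> real"
    using that by (intro R1.integrable_const_bound[where B = 1])
      (auto intro: AE_I2 simp: sp measurable_cong_sets[OF sets refl])
  note [measurable] = g(1)
  define m where "m = (\<integral>x. g x \<partial>R0)"
  have gi: "integrable R0 g" "integrable R1 g"
    using g by (auto intro!: int0 int1 simp: abs_le_iff intro: order_trans[of _ 0])
  have m: "0 \<le> m" "m \<le> 1"
  proof -
    show "0 \<le> m" unfolding m_def using g by (intro integral_nonneg_AE) (auto intro: AE_I2)
    have "m \<le> (\<integral>x. 1 \<partial>R0)" unfolding m_def using g by (intro integral_mono gi) auto
    then show "m \<le> 1" by (simp add: R0.prob_space)
  qed
  \<comment> \<open>\<open>dev\<close> speaks of nonnegative functions only, so \<open>g - m\<close>
    is split into its positive and negative parts. Under \<open>R0\<close> these have equal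
    integrals with sum \<open>s\<close>, the mean absolute deviation; hence the mean of
    \<open>g\<close> rises by at most \<open>\<delta> * s\<close>.\<close>
  define p where "p x = max 0 (g x - m)" for x
  define q where "q x = max 0 (m - g x)" for x
  define h where "h x = \<bar>g x - m\<bar>" for x
  have [measurable]: "p \<in> borel_measurable R0" "q \<in> borel_measurable R0" "h \<in> borel_measurable R0"
    unfolding p_def q_def h_def by measurable
  have b: "0 \<le> p x" "p x \<le> 1" "0 \<le> q x" "q x \<le> 1" "0 \<le> h x" "h x \<le> 1"
    if "x \<in> space R0" for x
    using g(2,3)[OF that] m by (auto simp: p_def q_def h_def)
  have pqi: "integrable R0 p" "integrable R0 q" "integrable R1 p" "integrable R1 q" "integrable R0 h"
    "integrable R0 (\<lambda>x. (h x)\<^sup>2)" "integrable R0 (\<lambda>x. (g x)\<^sup>2)"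
    using b g(2,3) by (auto intro!: int0 int1 simp: abs_le_iff power_le_one
        intro: order_trans[of _ 0])
  have "(\<integral>x. g x \<partial>R1) - m = (\<integral>x. g x - m \<partial>R1)"
    using gi by (simp add: R1.prob_space)
  also have "\<dots> = (\<integral>x. p x - q x \<partial>R1)"
    by (intro Bochner_Integration.integral_cong) (auto simp: p_def q_def)
  also have "\<dots> = (\<integral>x. p x \<partial>R1) - (\<integral>x. q x \<partial>R1)"
    using pqi by simp
  finally have 1: "(\<integral>x. g x \<partial>R1) - m = (\<integral>x. p x \<partial>R1) - (\<integral>x. q x \<partial>R1)" .
  have "(\<integral>x. p x \<partial>R0) - (\<integral>x. q x \<partial>R0) = (\<integral>x. p x - q x \<partial>R0)"
    using pqi by simp
  also have "\<dots> = (\<integral>x. g x - m \<partial>R0)"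
    by (intro Bochner_Integration.integral_cong) (auto simp: p_def q_def)
  also have "\<dots> = 0"
    using gi by (simp add: R0.prob_space m_def)
  finally have 2: "(\<integral>x. p x \<partial>R0) - (\<integral>x. q x \<partial>R0) = 0" .
  have "(\<integral>x. p x \<partial>R0) + (\<integral>x. q x \<partial>R0) = (\<integral>x. p x + q x \<partial>R0)"
    using pqi by simp
  also have "\<dots> = (\<integral>x. h x \<partial>R0)"
    by (intro Bochner_Integration.integral_cong) (auto simp: p_def q_def h_def)
  finally have 3: "(\<integral>x. p x \<partial>R0) + (\<integral>x. q x \<partial>R0) = (\<integral>x. h x \<partial>R0)" .
  define s where "s = (\<integral>x. h x \<partial>R0)"
  have "\<bar>(\<integral>x. p x \<partial>R1) - (\<integral>x. p x \<partial>R0)\<bar> \<le> \<delta> * (\<integral>x. p x \<partial>R0)"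
    "\<bar>(\<integral>x. q x \<partial>R1) - (\<integral>x. q x \<partial>R0)\<bar> \<le> \<delta> * (\<integral>x. q x \<partial>R0)"
    using b by (auto intro!: dev)
  with 1 2 have "(\<integral>x. g x \<partial>R1) - m \<le> \<delta> * (\<integral>x. p x \<partial>R0) + \<delta> * (\<integral>x. q x \<partial>R0)"
    by linarith
  also have "\<dots> = \<delta> * s" by (simp add: s_def 3[symmetric] distrib_left)
  finally have up: "(\<integral>x. g x \<partial>R1) \<le> m + \<delta> * s" by simp
  have var: "s\<^sup>2 \<le> (\<integral>x. (h x)\<^sup>2 \<partial>R0)"
  proof -
    have "0 \<le> (\<integral>x. (h x - s)\<^sup>2 \<partial>R0)" by simp
    also have "\<dots> = (\<integral>x. (h x)\<^sup>2 - 2 * s * h x + s\<^sup>2 \<partial>R0)"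
      by (simp add: power2_diff algebra_simps)
    also have "\<dots> = (\<integral>x. (h x)\<^sup>2 \<partial>R0) - 2 * s * s + s\<^sup>2"
      using pqi by (simp add: R0.prob_space s_def[symmetric])
    finally show ?thesis by (simp add: power2_eq_square)
  qed
  have "(\<integral>x. (h x)\<^sup>2 \<partial>R0) = (\<integral>x. (g x)\<^sup>2 - 2 * m * g x + m\<^sup>2 \<partial>R0)"
    by (intro Bochner_Integration.integral_cong) (auto simp: h_def power2_diff)
  also have "\<dots> = (\<integral>x. (g x)\<^sup>2 \<partial>R0) - 2 * m * m + m\<^sup>2"
    using pqi gi by (simp add: R0.prob_space m_def[symmetric])
  finally have vg: "(\<integral>x. (h x)\<^sup>2 \<partial>R0) + m\<^sup>2 = (\<integral>x. (g x)\<^sup>2 \<partial>R0)"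
    by (simp add: power2_eq_square)
  have "0 \<le> (\<integral>x. g x \<partial>R1)" using g by (intro integral_nonneg_AE) (auto intro!: AE_I2 simp: sp)
  with up have "(\<integral>x. g x \<partial>R1)\<^sup>2 \<le> (m + \<delta> * s)\<^sup>2" by (intro power_mono)
  \<comment> \<open>Cauchy-Schwarz for \<open>(1, \<delta>)\<close> and \<open>(m, s)\<close>. Since
    \<open>s\<^sup>2\<close> is at most the variance, \<open>m\<^sup>2 + s\<^sup>2\<close> is at
    most the second moment.\<close>
  also have "\<dots> \<le> (1 + \<delta>\<^sup>2) * (m\<^sup>2 + s\<^sup>2)"
    using zero_le_power2[of "\<delta> * m - s"] by (simp add: power2_eq_square algebra_simps)
  also have "\<dots> \<le> (1 + \<delta>\<^sup>2) * (\<integral>x. (g x)\<^sup>2 \<partial>R0)"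
    using var vg by (intro mult_left_mono) auto
  finally show ?thesis .
qed

lemma square_nn_integral_le_of_relative_deviation:
  fixes R0 R1 :: "'b measure" and g :: "'b \<Rightarrow> ennreal"
  assumes R: "prob_space R0" "prob_space R1" and sets: "sets R1 = sets R0"
    and g: "g \<in> borel_measurable R0" "\<And>x. x \<in> space R0 \<Longrightarrow> g x \<le> 1"
    and \<delta>: "0 \<le> \<delta>"
    and dev: "\<And>f. f \<in> borel_measurable R0 \<Longrightarrow> (\<And>x. x \<in> space R0 \<Longrightarrow> 0 \<le> f x) \<Longrightarrow>
      (\<And>x. x \<in> space R0 \<Longrightarrow> f x \<le> 1) \<Longrightarrow>
      \<bar>(\<integral>x. f x \<partial>R1) - (\<integral>x. f x \<partial>R0)\<bar> \<le> \<delta> * (\<integral>x. f x \<partial>R0)"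
  shows "(\<integral>\<^sup>+x. g x \<partial>R1)\<^sup>2 \<le> ennreal (1 + \<delta>\<^sup>2) * (\<integral>\<^sup>+x. (g x)\<^sup>2 \<partial>R0)"
proof -
  interpret R0: prob_space R0 by fact
  interpret R1: prob_space R1 by fact
  have sp: "space R1 = space R0" using sets by (rule sets_eq_imp_space_eq)
  note [measurable] = g(1)
  define r where "r x = enn2real (g x)" for x
  have [measurable]: "r \<in> borel_measurable R0" unfolding r_def by measurable
  then have [measurable]: "r \<in> borel_measurable R1" by (simp add: measurable_cong_sets[OF sets refl])
  have gr: "g x = ennreal (r x)" if "x \<in> space R0" for x
    unfolding r_def by (rule ennreal_enn2real[symmetric], rule le_less_trans[OF g(2)[OF that]]) simp
  have r: "0 \<le> r x" "r x \<le> 1" if "x \<in> space R0" for x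
  proof -
    show "0 \<le> r x" by (simp add: r_def)
    have "ennreal (r x) \<le> ennreal 1" using g(2)[OF that] unfolding gr[OF that] by simp
    then show "r x \<le> 1" by (subst (asm) ennreal_le_iff) simp_all
  qed
  have "(\<integral>\<^sup>+x. g x \<partial>R1) = (\<integral>\<^sup>+x. ennreal (r x) \<partial>R1)"
    by (intro nn_integral_cong) (simp add: gr sp)
  also have "\<dots> = ennreal (\<integral>x. r x \<partial>R1)"
    using r by (intro nn_integral_eq_integral R1.integrable_const_bound[where B = 1])
      (auto intro!: AE_I2 simp: sp)
  finally have 1: "(\<integral>\<^sup>+x. g x \<partial>R1) = ennreal (\<integral>x. r x \<partial>R1)" .
  have "(\<integral>\<^sup>+x. (g x)\<^sup>2 \<partial>R0) = (\<integral>\<^sup>+x. ennreal ((r x)\<^sup>2) \<partial>R0)"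
    by (intro nn_integral_cong) (simp add: gr r ennreal_power)
  also have "\<dots> = ennreal (\<integral>x. (r x)\<^sup>2 \<partial>R0)"
    using r by (intro nn_integral_eq_integral R0.integrable_const_bound[where B = 1])
      (auto intro!: AE_I2 simp: power_le_one)
  finally have 2: "(\<integral>\<^sup>+x. (g x)\<^sup>2 \<partial>R0) = ennreal (\<integral>x. (r x)\<^sup>2 \<partial>R0)" .
  have "(\<integral>x. r x \<partial>R1)\<^sup>2 \<le> (1 + \<delta>\<^sup>2) * (\<integral>x. (r x)\<^sup>2 \<partial>R0)"
    by (rule square_integral_le_of_relative_deviation[OF R sets _ r \<delta> dev]) auto
  moreover have "0 \<le> (\<integral>x. r x \<partial>R1)"
    using r by (intro integral_nonneg_AE) (auto intro!: AE_I2 simp: sp)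
  ultimately show ?thesis
    unfolding 1 2 by (simp add: ennreal_power ennreal_leI ennreal_mult[symmetric] del: ennreal_plus)
qed

section \<open>Densities with respect to a common finite measure, and total variation\<close>

lemma dominated_densities:
  fixes M :: "'a measure"
  assumes dom: "dominated M \<P>" and P: "\<And>P. P \<in> \<P> \<Longrightarrow> prob_space P \<and> sets P = sets M"
  shows "\<exists>\<nu>. finite_measure \<nu> \<and> sets \<nu> = sets M \<and>
    (\<forall>P\<in>\<P>. \<exists>p. integrable \<nu> p \<and> (\<forall>x. 0 \<le> p x) \<and> P = density \<nu> (\<lambda>x. ennreal (p x)))"
proof -
  obtain \<mu> where \<mu>: "sigma_finite_measure \<mu>" "sets \<mu> = sets M" "\<And>P. P \<in> \<P> \<Longrightarrow> absolutely_continuous \<mu> P"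
    using dom by (auto simp: dominated_def)
  interpret \<mu>: sigma_finite_measure \<mu> by fact
  \<comment> \<open>A strictly positive integrable weight turns the sigma-finite reference into a
    finite one with the same null sets. Finiteness is what the duality lemma asks for.\<close>
  obtain h where h: "h \<in> borel_measurable \<mu>" "integral\<^sup>N \<mu> h \<noteq> \<infinity>" "\<And>x. x \<in> space \<mu> \<Longrightarrow> 0 < h x"
    using \<mu>.Ex_finite_integrable_function by auto
  define \<nu> where "\<nu> = density \<mu> h"
  have s\<nu>: "sets \<nu> = sets M" by (simp add: \<nu>_def \<mu>)
  have "emeasure \<nu> (space \<nu>) = (\<integral>\<^sup>+x. h x * indicator (space \<mu>) x \<partial>\<mu>)"
    using h by (simp add: \<nu>_def emeasure_density)
  also have "\<dots> = integral\<^sup>N \<mu> h" by (intro nn_integral_cong) simp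
  finally interpret \<nu>: finite_measure \<nu> using h(2) by (intro finite_measureI) simp
  have "\<exists>p. integrable \<nu> p \<and> (\<forall>x. 0 \<le> p x) \<and> P = density \<nu> (\<lambda>x. ennreal (p x))" if PP: "P \<in> \<P>" for P
  proof -
    interpret P: prob_space P using P[OF PP] by simp
    have sP: "sets P = sets \<nu>" using P[OF PP] s\<nu> by simp
    have "null_sets \<nu> \<subseteq> null_sets \<mu>"
    proof
      fix A assume "A \<in> null_sets \<nu>"
      then have A: "A \<in> sets \<mu>" "AE x in \<mu>. x \<in> A \<longrightarrow> h x = 0"
        using h(1) by (simp_all add: \<nu>_def null_sets_density_iff)
      from A(2) AE_space have "AE x in \<mu>. x \<notin> A"
        by eventually_elim (use h(3) in force)
      with A(1) show "A \<in> null_sets \<mu>" by (simp add: AE_iff_null_sets)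
    qed
    then have ac: "absolutely_continuous \<nu> P"
      using \<mu>(3)[OF PP] by (auto simp: absolutely_continuous_def)
    obtain p where p: "p \<in> borel_measurable \<nu>" "AE x in \<nu>. RN_deriv \<nu> P x = ennreal (p x)" "\<And>x. 0 \<le> p x"
      using \<nu>.real_RN_deriv[OF P.finite_measure_axioms ac sP] by metis
    have "density \<nu> (\<lambda>x. ennreal (p x)) = density \<nu> (RN_deriv \<nu> P)"
      using p by (intro density_cong) auto
    also have "\<dots> = P" by (rule \<nu>.density_RN_deriv[OF ac sP])
    finally have d: "P = density \<nu> (\<lambda>x. ennreal (p x))" ..
    have "(\<integral>\<^sup>+x. ennreal (p x) \<partial>\<nu>) = (\<integral>\<^sup>+x. ennreal (p x) * indicator (space \<nu>) x \<partial>\<nu>)"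
      by (intro nn_integral_cong) simp
    also have "\<dots> = emeasure P (space \<nu>)"
      unfolding d using p(1) by (subst emeasure_density) auto
    also have "\<dots> = 1" using P.emeasure_space_1 sets_eq_imp_space_eq[OF sP] by simp
    finally have "integrable \<nu> p" using p by (intro integrableI_nonneg) auto
    with p d show ?thesis by blast
  qed
  with s\<nu> \<nu>.finite_measure_axioms show ?thesis by blast
qed

lemma measure_density_real:
  fixes p :: "'a \<Rightarrow> real"
  assumes p: "integrable \<nu> p" "\<And>x. 0 \<le> p x" and A: "A \<in> sets \<nu>"
  shows "measure (density \<nu> (\<lambda>x. ennreal (p x))) A = (\<integral>x. p x * indicator A x \<partial>\<nu>)"
proof -
  have "emeasure (density \<nu> (\<lambda>x. ennreal (p x))) A = (\<integral>\<^sup>+x. ennreal (p x * indicator A x) \<partial>\<nu>)"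
    using p A by (subst emeasure_density) (auto intro!: nn_integral_cong simp: indicator_def)
  also have "\<dots> = ennreal (\<integral>x. p x * indicator A x \<partial>\<nu>)"
    using p A by (intro nn_integral_eq_integral integrable_real_mult_indicator) auto
  finally show ?thesis
    by (simp add: measure_def p)
qed

lemma bdd_above_tv:
  assumes "prob_space P0" "prob_space P1"
  shows "bdd_above ((\<lambda>A. \<bar>measure P0 A - measure P1 A\<bar>) ` S)"
proof (rule bdd_aboveI2)
  fix A
  show "\<bar>measure P0 A - measure P1 A\<bar> \<le> 1"
    using prob_space.prob_le_1[OF assms(1), of A] prob_space.prob_le_1[OF assms(2), of A]
      measure_nonneg[of P0 A] measure_nonneg[of P1 A] by linarith
qed

lemma diff_le_tv_dist:
  assumes "prob_space P0" "prob_space P1" "A \<in> sets P0"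
  shows "\<bar>measure P0 A - measure P1 A\<bar> \<le> tv_dist P0 P1"
  unfolding tv_dist_def by (rule cSUP_upper[OF assms(3) bdd_above_tv[OF assms(1,2)]])

lemma tv_dist_commute: "sets P0 = sets P1 \<Longrightarrow> tv_dist P0 P1 = tv_dist P1 P0"
  by (simp add: tv_dist_def abs_minus_commute)

lemma tv_dist_self: "tv_dist P P = 0"
  by (auto simp: tv_dist_def intro: cSUP_const)

lemma tv_dist_nonneg:
  assumes "prob_space P0" "prob_space P1"
  shows "0 \<le> tv_dist P0 P1"
  using diff_le_tv_dist[OF assms, of "{}"] by simp

text \<open>Only the oscillation of \<open>F\<close> enters: the constant \<open>a\<close>
  integrates to the same value under both laws, and \<open>F - a\<close> gains most from
  \<open>p1 - p0\<close> when it equals \<open>b - a\<close> where \<open>p0 < p1\<close> and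
  \<open>0\<close> elsewhere.\<close>

lemma integral_diff_le_tv_dist:
  fixes F :: "'a \<Rightarrow> real"
  assumes \<nu>: "finite_measure \<nu>"
    and p0: "integrable \<nu> p0" "\<And>x. 0 \<le> p0 x" "P0 = density \<nu> (\<lambda>x. ennreal (p0 x))"
    and p1: "integrable \<nu> p1" "\<And>x. 0 \<le> p1 x" "P1 = density \<nu> (\<lambda>x. ennreal (p1 x))"
    and P: "prob_space P0" "prob_space P1"
    and F: "F \<in> borel_measurable \<nu>" "\<And>x. x \<in> space \<nu> \<Longrightarrow> a \<le> F x" "\<And>x. x \<in> space \<nu> \<Longrightarrow> F x \<le> b"
  shows "(\<integral>x. F x \<partial>P1) - (\<integral>x. F x \<partial>P0) \<le> (b - a) * tv_dist P0 P1"
proof -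
  interpret \<nu>: finite_measure \<nu> by fact
  interpret P0: prob_space P0 by fact
  interpret P1: prob_space P1 by fact
  note [measurable] = F(1) borel_measurable_integrable[OF p0(1)] borel_measurable_integrable[OF p1(1)]
  obtain x0 where "x0 \<in> space P0" using P0.not_empty by auto
  then have "a \<le> b" using F(2,3)[of x0] p0(3) by simp
  define A where "A = {x \<in> space \<nu>. p0 x < p1 x}"
  have A: "A \<in> sets \<nu>" unfolding A_def by measurable
  define B where "B = max \<bar>a\<bar> \<bar>b\<bar>"
  have FB: "\<bar>F x\<bar> \<le> B" if "x \<in> space \<nu>" for x using F(2,3)[OF that] by (auto simp: B_def)
  have Fi: "integrable \<nu> (\<lambda>x. p x * F x)" if p: "integrable \<nu> p" for p :: "'a \<Rightarrow> real"
  proof (rule Bochner_Integration.integrable_bound)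
    show "integrable \<nu> (\<lambda>x. B * p x)" using p by simp
    show "AE x in \<nu>. norm (p x * F x) \<le> norm (B * p x)"
      using FB by (intro AE_I2) (auto simp: abs_mult mult.commute[of B] intro!: mult_left_mono order_trans[OF FB])
  qed (use p in auto)
  have e0: "(\<integral>x. F x \<partial>P0) = (\<integral>x. p0 x * F x \<partial>\<nu>)"
    unfolding p0(3) using p0 by (subst integral_density) auto
  have e1: "(\<integral>x. F x \<partial>P1) = (\<integral>x. p1 x * F x \<partial>\<nu>)"
    unfolding p1(3) using p1 by (subst integral_density) auto
  have pA: "integrable \<nu> (\<lambda>x. p x * indicator A x)" if "integrable \<nu> p" for p :: "'a \<Rightarrow> real"
    using that A by (intro integrable_real_mult_indicator)
  have one: "(\<integral>x. p0 x \<partial>\<nu>) = 1" "(\<integral>x. p1 x \<partial>\<nu>) = 1"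
  proof -
    have "(\<integral>x. p0 x \<partial>\<nu>) = (\<integral>x. 1 \<partial>P0)" unfolding p0(3) using p0 by (subst integral_density) auto
    then show "(\<integral>x. p0 x \<partial>\<nu>) = 1" by (simp add: P0.prob_space)
    have "(\<integral>x. p1 x \<partial>\<nu>) = (\<integral>x. 1 \<partial>P1)" unfolding p1(3) using p1 by (subst integral_density) auto
    then show "(\<integral>x. p1 x \<partial>\<nu>) = 1" by (simp add: P1.prob_space)
  qed
  have "(\<integral>x. F x \<partial>P1) - (\<integral>x. F x \<partial>P0) = (\<integral>x. p1 x * F x - p0 x * F x \<partial>\<nu>)"
    unfolding e0 e1 using Fi[OF p0(1)] Fi[OF p1(1)] by simp
  also have "\<dots> \<le> (\<integral>x. a * (p1 x - p0 x) + (b - a) * (p1 x * indicator A x - p0 x * indicator A x) \<partial>\<nu>)"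
  proof (intro integral_mono)
    fix x assume x: "x \<in> space \<nu>"
    show "p1 x * F x - p0 x * F x \<le> a * (p1 x - p0 x) + (b - a) * (p1 x * indicator A x - p0 x * indicator A x)"
    proof (cases "p0 x < p1 x")
      case True
      then have "(F x - a) * (p1 x - p0 x) \<le> (b - a) * (p1 x - p0 x)"
        using F(3)[OF x] by (intro mult_right_mono) auto
      then show ?thesis using True x by (simp add: A_def algebra_simps)
    next
      case False
      then have "(F x - a) * (p1 x - p0 x) \<le> 0"
        using F(2)[OF x] by (intro mult_nonneg_nonpos) auto
      then show ?thesis using False x by (simp add: A_def algebra_simps)
    qed
  qed (use Fi p0 p1 pA in auto)
  also have "\<dots> = (b - a) * (measure P1 A - measure P0 A)"
    using p0 p1 pA[OF p0(1)] pA[OF p1(1)] one A by (simp add: measure_density_real)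
  also have "\<dots> \<le> (b - a) * tv_dist P0 P1"
    using diff_le_tv_dist[OF P, of A] A \<open>a \<le> b\<close> p0(3) by (intro mult_left_mono) auto
  finally show ?thesis .
qed

text \<open>With \<open>I\<close> the infimum of \<open>F\<close>, all values lie between
  \<open>I\<close> and \<open>r * I\<close>. The oscillation is thus at most
  \<open>(r - 1) * I\<close>, and \<open>I\<close> is at most the integral under \<open>P0\<close>,
  which makes an additive bound a relative one.\<close>

lemma relative_deviation_of_bounded_ratio:
  fixes F :: "'a \<Rightarrow> real"
  assumes \<nu>: "finite_measure \<nu>"
    and p0: "integrable \<nu> p0" "\<And>x. 0 \<le> p0 x" "P0 = density \<nu> (\<lambda>x. ennreal (p0 x))"
    and p1: "integrable \<nu> p1" "\<And>x. 0 \<le> p1 x" "P1 = density \<nu> (\<lambda>x. ennreal (p1 x))"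
    and P: "prob_space P0" "prob_space P1"
    and F: "F \<in> borel_measurable \<nu>" "\<And>x. x \<in> space \<nu> \<Longrightarrow> 0 \<le> F x"
      "\<And>x x'. x \<in> space \<nu> \<Longrightarrow> x' \<in> space \<nu> \<Longrightarrow> F x \<le> r * F x'"
    and r: "1 \<le> r"
  shows "\<bar>(\<integral>x. F x \<partial>P1) - (\<integral>x. F x \<partial>P0)\<bar> \<le> (r - 1) * tv_dist P0 P1 * (\<integral>x. F x \<partial>P0)"
proof -
  interpret P0: prob_space P0 by fact
  have sp: "space P0 = space \<nu>" "sets P0 = sets \<nu>" "sets P1 = sets \<nu>" using p0(3) p1(3) by auto
  obtain x0 where x0: "x0 \<in> space \<nu>" using P0.not_empty sp by auto
  define I where "I = (INF x\<in>space \<nu>. F x)"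
  have bdd: "bdd_below (F ` space \<nu>)" using F(2) by (intro bdd_belowI2)
  have I_le: "I \<le> F x" if "x \<in> space \<nu>" for x
    unfolding I_def by (rule cINF_lower[OF bdd that])
  have le_I: "F x \<le> r * I" if x: "x \<in> space \<nu>" for x
  proof -
    have "F x / r \<le> I" unfolding I_def
      using x0 F(3)[OF x] r by (intro cINF_greatest) (auto simp: field_simps)
    then show ?thesis using r by (simp add: field_simps)
  qed
  have tv: "0 \<le> tv_dist P0 P1" by (rule tv_dist_nonneg[OF P])
  have "\<bar>F x\<bar> \<le> r * I" if "x \<in> space \<nu>" for x using F(2)[OF that] le_I[OF that] by simp
  then have Fi: "integrable P0 F"
    using F(1) sp by (intro P0.integrable_const_bound[where B = "r * I"]) (auto intro!: AE_I2 cong: measurable_cong_sets)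
  have "(\<integral>x. I \<partial>P0) \<le> (\<integral>x. F x \<partial>P0)"
    using I_le Fi by (intro integral_mono) (auto simp: sp)
  then have "I \<le> (\<integral>x. F x \<partial>P0)" by (simp add: P0.prob_space)
  then have "(r * I - I) * tv_dist P0 P1 \<le> (r - 1) * tv_dist P0 P1 * (\<integral>x. F x \<partial>P0)"
    using mult_left_mono[of I "\<integral>x. F x \<partial>P0" "(r - 1) * tv_dist P0 P1"] mult_nonneg_nonneg[of "r - 1", OF _ tv] r
    by (simp add: algebra_simps)
  moreover have "(\<integral>x. F x \<partial>P1) - (\<integral>x. F x \<partial>P0) \<le> (r * I - I) * tv_dist P0 P1"
    by (rule integral_diff_le_tv_dist[OF \<nu> p0 p1 P F(1) I_le le_I])
  moreover have "(\<integral>x. F x \<partial>P0) - (\<integral>x. F x \<partial>P1) \<le> (r * I - I) * tv_dist P0 P1"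
    using integral_diff_le_tv_dist[OF \<nu> p1 p0 P(2,1) F(1) I_le le_I] tv_dist_commute[of P0 P1] sp by simp
  ultimately show ?thesis by linarith
qed

section \<open>Sequential channels\<close>

lemma nested_integral_cong:
  "(\<And>j. i \<le> j \<Longrightarrow> j < i + m \<Longrightarrow> x j = x' j) \<Longrightarrow>
    nested_integral Qs x A m i z = nested_integral Qs x' A m i z"
proof (induction m arbitrary: i z)
  case (Suc m)
  have "nested_integral Qs x A m (Suc i) w = nested_integral Qs x' A m (Suc i) w" for w
    by (rule Suc.IH) (use Suc.prems in auto)
  then show ?case using Suc.prems[of i] by simp
qed simp

lemma measurable_update_output:
  assumes "f \<in> N \<rightarrow>\<^sub>M outputs q i" "g \<in> N \<rightarrow>\<^sub>M euclid q"
  shows "(\<lambda>w. (f w)(i := g w)) \<in> N \<rightarrow>\<^sub>M outputs q (Suc i)"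
  using assms by (intro measurable_fun_upd[where J = "{..<i}"]) (auto simp: lessThan_Suc)

lemma update_output_in_space:
  "z \<in> space (outputs q i) \<Longrightarrow> y \<in> space (euclid q) \<Longrightarrow> z(i := y) \<in> space (outputs q (Suc i))"
  by (auto simp: space_PiM PiE_def extensional_def Pi_iff less_Suc_eq)

lemma kernel_at:
  assumes "K \<in> N \<rightarrow>\<^sub>M prob_algebra L" "x \<in> space N"
  shows "prob_space (K x)" "sets (K x) = sets L" "space (K x) = space L"
proof -
  have "K x \<in> space (prob_algebra L)" using assms by (rule measurable_space)
  then show "prob_space (K x)" "sets (K x) = sets L" by (auto simp: space_prob_algebra)
  then show "space (K x) = space L" by (intro sets_eq_imp_space_eq)
qed

text \<open>\<open>J\<close> is only required to contain \<open>{i..<n}\<close>, so that it can stay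
  fixed while the induction moves to later stages. Measurability is joint in inputs and outputs
  because the inputs are later averaged by Fubini.\<close>

lemma measurable_nested_integral:
  assumes Qs: "\<And>i. i < n \<Longrightarrow> Qs i \<in> M \<Otimes>\<^sub>M outputs q i \<rightarrow>\<^sub>M prob_algebra (euclid q)"
    and A: "A \<in> sets (outputs q n)"
  shows "i + m = n \<Longrightarrow> {i..<n} \<subseteq> J \<Longrightarrow>
    (\<lambda>(x, z). nested_integral Qs x A m i z) \<in> borel_measurable (PiM J (\<lambda>_. M) \<Otimes>\<^sub>M outputs q i)"
proof (induction m arbitrary: i)
  case 0
  then show ?case using A by (simp add: case_prod_beta)
next
  case (Suc m)
  let ?X = "PiM J (\<lambda>_. M) \<Otimes>\<^sub>M outputs q i"
  have i: "i < n" "i \<in> J" using Suc.prems by auto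
  have "(\<lambda>w. (fst (fst w), (snd (fst w))(i := snd w))) \<in>
      ?X \<Otimes>\<^sub>M euclid q \<rightarrow>\<^sub>M PiM J (\<lambda>_. M) \<Otimes>\<^sub>M outputs q (Suc i)"
    by (intro measurable_Pair measurable_update_output) measurable
  from measurable_compose[OF this Suc.IH[of "Suc i"]]
  have inner: "(\<lambda>(p, y). nested_integral Qs (fst p) A m (Suc i) ((snd p)(i := y)))
      \<in> borel_measurable (?X \<Otimes>\<^sub>M euclid q)"
    using Suc.prems by (simp add: case_prod_beta subset_iff)
  have "(\<lambda>p. (fst p i, snd p)) \<in> ?X \<rightarrow>\<^sub>M M \<Otimes>\<^sub>M outputs q i"
    using i by measurable
  from measurable_compose[OF this measurable_prob_algebraD[OF Qs[OF i(1)]]]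
  have L: "(\<lambda>p. Qs i (fst p i, snd p)) \<in> ?X \<rightarrow>\<^sub>M subprob_algebra (euclid q)" .
  from nn_integral_measurable_subprob_algebra2[OF inner L] show ?case
    by (simp add: case_prod_beta)
qed

lemma nested_integral_le_1:
  assumes Qs: "\<And>i. i < n \<Longrightarrow> Qs i \<in> M \<Otimes>\<^sub>M outputs q i \<rightarrow>\<^sub>M prob_algebra (euclid q)"
  shows "i + m = n \<Longrightarrow> (\<And>j. i \<le> j \<Longrightarrow> j < n \<Longrightarrow> x j \<in> space M) \<Longrightarrow> z \<in> space (outputs q i) \<Longrightarrow>
    nested_integral Qs x A m i z \<le> 1"
proof (induction m arbitrary: i z)
  case 0
  then show ?case by (simp add: indicator_def)
next
  case (Suc m)
  have "i < n" "(x i, z) \<in> space (M \<Otimes>\<^sub>M outputs q i)"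
    using Suc.prems by (auto simp: space_pair_measure)
  note K = kernel_at[OF Qs[OF this(1)] this(2)]
  have "nested_integral Qs x A (Suc m) i z \<le> (\<integral>\<^sup>+y. 1 \<partial>Qs i (x i, z))"
    unfolding nested_integral.simps
    by (intro nn_integral_mono Suc.IH update_output_in_space) (use Suc.prems K in auto)
  then show ?case using prob_space.emeasure_space_1[OF K(1)] by simp
qed

text \<open>The value function of a backward recursion: for \<open>i + m = n\<close>, the
  probability, given the past outputs \<open>z\<close>, that the output ends in \<open>A\<close>
  when the remaining inputs are drawn independently from \<open>P\<close>.\<close>

definition averaged_integral where
  "averaged_integral Qs P A m i z = (\<integral>\<^sup>+x. nested_integral Qs x A m i z \<partial>PiM {i..<i + m} (\<lambda>_. P))"

context
  fixes P :: "'a measure" and q n :: nat and A and Qs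
  assumes P: "prob_space P"
    and Qs: "\<And>i. i < n \<Longrightarrow> Qs i \<in> P \<Otimes>\<^sub>M outputs q i \<rightarrow>\<^sub>M prob_algebra (euclid q)"
    and A: "A \<in> sets (outputs q n)"
begin

lemma measurable_averaged_integral:
  assumes "i + m = n"
  shows "averaged_integral Qs P A m i \<in> borel_measurable (outputs q i)"
proof -
  interpret PX: prob_space "PiM {i..<i + m} (\<lambda>_. P)" by (intro prob_space_PiM P)
  have "(\<lambda>(x, z). nested_integral Qs x A m i z) \<in>
      borel_measurable (PiM {i..<i + m} (\<lambda>_. P) \<Otimes>\<^sub>M outputs q i)"
    using assms by (intro measurable_nested_integral[where M = P and n = n] Qs A) auto
  from measurable_pair_swap[OF this] show ?thesis
    unfolding averaged_integral_def
    by (intro PX.borel_measurable_nn_integral) (simp add: case_prod_beta)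
qed

lemma averaged_integral_le_1:
  assumes "i + m = n" "z \<in> space (outputs q i)"
  shows "averaged_integral Qs P A m i z \<le> 1"
proof -
  interpret PX: prob_space "PiM {i..<i + m} (\<lambda>_. P)" by (intro prob_space_PiM P)
  have "averaged_integral Qs P A m i z \<le> (\<integral>\<^sup>+x. 1 \<partial>PiM {i..<i + m} (\<lambda>_. P))"
    unfolding averaged_integral_def
    by (intro nn_integral_mono nested_integral_le_1[where M = P and n = n and q = q] Qs)
      (use assms in \<open>auto simp: space_PiM PiE_iff\<close>)
  then show ?thesis using PX.emeasure_space_1 by simp
qed

text \<open>Given the past, the next output has the law of \<open>x i\<close> under \<open>P\<close>
  pushed through the kernel. The later inputs are independent of that output, so Fubini moves their
  average inside the integral over it; \<open>nested_integral_cong\<close> removes the input already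
  used.\<close>

lemma averaged_integral_Suc:
  assumes i: "i + Suc m = n" and z: "z \<in> space (outputs q i)"
  shows "averaged_integral Qs P A (Suc m) i z =
    (\<integral>\<^sup>+y. averaged_integral Qs P A m (Suc i) (z(i := y)) \<partial>(P \<bind> (\<lambda>x. Qs i (x, z))))"
proof -
  interpret P: prob_space P by (rule P)
  interpret product_sigma_finite "\<lambda>_. P" ..
  let ?I = "{Suc i..<Suc i + m}"
  interpret PI: prob_space "PiM ?I (\<lambda>_. P)" by (intro prob_space_PiM P)
  have ins: "insert i ?I = {i..<i + Suc m}" by auto
  have "i < n" using i by simp
  note Qi = Qs[OF this]
  have Kz: "(\<lambda>x. Qs i (x, z)) \<in> P \<rightarrow>\<^sub>M prob_algebra (euclid q)"
    using measurable_compose[OF measurable_Pair2'[OF z] Qi] by simp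
  have f: "(\<lambda>x. nested_integral Qs x A (Suc m) i z) \<in> borel_measurable (PiM (insert i ?I) (\<lambda>_. P))"
    using measurable_compose[OF measurable_Pair2'[OF z]
        measurable_nested_integral[OF Qs A i, where J = "insert i ?I"]] i
    by (simp only: case_prod_conv ins)
  have "averaged_integral Qs P A (Suc m) i z =
      (\<integral>\<^sup>+w. \<integral>\<^sup>+x. nested_integral Qs (x(i := w)) A (Suc m) i z \<partial>PiM ?I (\<lambda>_. P) \<partial>P)"
    unfolding averaged_integral_def ins[symmetric] by (rule product_nn_integral_insert_rev[OF _ _ f]) auto
  also have "\<dots> = (\<integral>\<^sup>+w. \<integral>\<^sup>+y. averaged_integral Qs P A m (Suc i) (z(i := y)) \<partial>Qs i (w, z) \<partial>P)"
  proof (rule nn_integral_cong)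
    fix w assume w: "w \<in> space P"
    note K = kernel_at[OF Kz w]
    interpret K: prob_space "Qs i (w, z)" by (rule K(1))
    interpret KP: pair_sigma_finite "Qs i (w, z)" "PiM ?I (\<lambda>_. P)" ..
    have "(\<lambda>p. (snd p, z(i := fst p))) \<in>
        Qs i (w, z) \<Otimes>\<^sub>M PiM ?I (\<lambda>_. P) \<rightarrow>\<^sub>M PiM ?I (\<lambda>_. P) \<Otimes>\<^sub>M outputs q (Suc i)"
      using z K by (intro measurable_Pair measurable_update_output)
        (auto simp: measurable_cong_sets[OF refl K(2)[symmetric]])
    from measurable_compose[OF this measurable_nested_integral[OF Qs A, where J = "?I" and m = m]]
    have meas: "(\<lambda>(y, x). nested_integral Qs x A m (Suc i) (z(i := y))) \<in>
        borel_measurable (Qs i (w, z) \<Otimes>\<^sub>M PiM ?I (\<lambda>_. P))"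
      using i by (simp add: case_prod_beta)
    have "nested_integral Qs (x(i := w)) A m (Suc i) u = nested_integral Qs x A m (Suc i) u" for x u
      by (rule nested_integral_cong) auto
    then have "(\<integral>\<^sup>+x. nested_integral Qs (x(i := w)) A (Suc m) i z \<partial>PiM ?I (\<lambda>_. P)) =
        (\<integral>\<^sup>+x. \<integral>\<^sup>+y. nested_integral Qs x A m (Suc i) (z(i := y)) \<partial>Qs i (w, z) \<partial>PiM ?I (\<lambda>_. P))"
      by simp
    also have "\<dots> = (\<integral>\<^sup>+y. \<integral>\<^sup>+x. nested_integral Qs x A m (Suc i) (z(i := y)) \<partial>PiM ?I (\<lambda>_. P) \<partial>Qs i (w, z))"
      by (rule KP.Fubini'[OF meas])
    finally show "(\<integral>\<^sup>+x. nested_integral Qs (x(i := w)) A (Suc m) i z \<partial>PiM ?I (\<lambda>_. P)) =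
        (\<integral>\<^sup>+y. averaged_integral Qs P A m (Suc i) (z(i := y)) \<partial>Qs i (w, z))"
      by (simp add: averaged_integral_def)
  qed
  also have "\<dots> = (\<integral>\<^sup>+y. averaged_integral Qs P A m (Suc i) (z(i := y)) \<partial>(P \<bind> (\<lambda>x. Qs i (x, z))))"
  proof (rule nn_integral_bind[symmetric, OF _ measurable_prob_algebraD[OF Kz]])
    have "(\<lambda>y. z(i := y)) \<in> euclid q \<rightarrow>\<^sub>M outputs q (Suc i)"
      using z by (intro measurable_update_output) auto
    from measurable_compose[OF this measurable_averaged_integral] i
    show "(\<lambda>y. averaged_integral Qs P A m (Suc i) (z(i := y))) \<in> borel_measurable (euclid q)"
      by simp
  qed
  finally show ?thesis .
qed

end

text \<open>At the last stage both sides are the same indicator, which equals its square; this is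
  why a square under \<open>P1\<close> is compared with a first power under \<open>P0\<close>. Each
  earlier stage moves the square inside the integral and changes the law of the next output from
  \<open>P1\<close> to \<open>P0\<close> at the cost of one factor
  \<open>1 + \<delta>\<^sup>2\<close>, after which the induction hypothesis applies
  pointwise.\<close>

lemma averaged_integral_square_le:
  fixes P0 P1 :: "'a measure"
  assumes P: "prob_space P0" "prob_space P1" and sets: "sets P0 = sets M" "sets P1 = sets M"
    and Qs: "\<And>i. i < n \<Longrightarrow> Qs i \<in> M \<Otimes>\<^sub>M outputs q i \<rightarrow>\<^sub>M prob_algebra (euclid q)"
    and A: "A \<in> sets (outputs q n)" and \<delta>: "0 \<le> \<delta>"
    and dev: "\<And>i z f. i < n \<Longrightarrow> z \<in> space (outputs q i) \<Longrightarrow> f \<in> borel_measurable (euclid q) \<Longrightarrow>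
      (\<And>y. y \<in> space (euclid q) \<Longrightarrow> 0 \<le> f y) \<Longrightarrow> (\<And>y. y \<in> space (euclid q) \<Longrightarrow> f y \<le> 1) \<Longrightarrow>
      \<bar>(\<integral>y. f y \<partial>(P1 \<bind> (\<lambda>x. Qs i (x, z)))) - (\<integral>y. f y \<partial>(P0 \<bind> (\<lambda>x. Qs i (x, z))))\<bar>
        \<le> \<delta> * (\<integral>y. f y \<partial>(P0 \<bind> (\<lambda>x. Qs i (x, z))))"
  shows "i + m = n \<Longrightarrow> z \<in> space (outputs q i) \<Longrightarrow>
    (averaged_integral Qs P1 A m i z)\<^sup>2 \<le> ennreal ((1 + \<delta>\<^sup>2) ^ m) * averaged_integral Qs P0 A m i z"
proof (induction m arbitrary: i z)
  case 0
  then show ?case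
    using prob_space.emeasure_space_1[OF prob_space_PiM[of "{} :: nat set" "\<lambda>_. P0"]]
      prob_space.emeasure_space_1[OF prob_space_PiM[of "{} :: nat set" "\<lambda>_. P1"]]
    by (simp add: averaged_integral_def indicator_def)
next
  case (Suc m)
  have QsP: "Qs i \<in> P' \<Otimes>\<^sub>M outputs q i \<rightarrow>\<^sub>M prob_algebra (euclid q)"
    if "i < n" "sets P' = sets M" for P' i
    using Qs[OF that(1)] by (simp add: measurable_cong_sets[OF sets_pair_measure_cong[OF that(2) refl] refl])
  note Q0 = QsP[OF _ sets(1)] and Q1 = QsP[OF _ sets(2)]
  have i: "i < n" using Suc.prems by simp
  have Kz: "(\<lambda>x. Qs i (x, z)) \<in> M \<rightarrow>\<^sub>M prob_algebra (euclid q)"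
    using measurable_compose[OF measurable_Pair2'[OF Suc.prems(2)] Qs[OF i]] by simp
  let ?R0 = "P0 \<bind> (\<lambda>x. Qs i (x, z))" and ?R1 = "P1 \<bind> (\<lambda>x. Qs i (x, z))"
  have bind: "prob_space (P' \<bind> (\<lambda>x. Qs i (x, z)))" "sets (P' \<bind> (\<lambda>x. Qs i (x, z))) = sets (euclid q)"
    if "prob_space P'" "sets P' = sets M" for P'
  proof -
    have P': "P' \<in> space (prob_algebra M)" using that by (simp add: space_prob_algebra)
    show "sets (P' \<bind> (\<lambda>x. Qs i (x, z))) = sets (euclid q)" by (rule sets_bind'[OF P' Kz])
    show "prob_space (P' \<bind> (\<lambda>x. Qs i (x, z)))"
      by (rule prob_space.prob_space_bind[OF that(1), where S = "euclid q"])
        (use kernel_at[OF Kz] sets_eq_imp_space_eq[OF that(2)] measurable_prob_algebraD[OF Kz] in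
          \<open>auto intro!: AE_I2 simp: measurable_cong_sets[OF that(2) refl]\<close>)
  qed
  note R0 = bind[OF P(1) sets(1)] and R1 = bind[OF P(2) sets(2)]
  have sp: "space ?R0 = space (euclid q)" by (rule sets_eq_imp_space_eq[OF R0(2)])
  have "(\<lambda>y. z(i := y)) \<in> euclid q \<rightarrow>\<^sub>M outputs q (Suc i)"
    using Suc.prems by (intro measurable_update_output) auto
  note upd = measurable_compose[OF this measurable_averaged_integral]
  have g: "(\<lambda>y. averaged_integral Qs P1 A m (Suc i) (z(i := y))) \<in> borel_measurable (euclid q)"
    using Suc.prems by (intro upd[OF P(2) Q1 A]) auto
  have h: "(\<lambda>y. averaged_integral Qs P0 A m (Suc i) (z(i := y))) \<in> borel_measurable (euclid q)"
    using Suc.prems by (intro upd[OF P(1) Q0 A]) auto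
  have Si: "Suc i + m = n" using Suc.prems by simp
  have "(averaged_integral Qs P1 A (Suc m) i z)\<^sup>2 =
      (\<integral>\<^sup>+y. averaged_integral Qs P1 A m (Suc i) (z(i := y)) \<partial>?R1)\<^sup>2"
    by (subst averaged_integral_Suc[OF P(2) Q1 A Suc.prems]) auto
  also have "\<dots> \<le> ennreal (1 + \<delta>\<^sup>2) * (\<integral>\<^sup>+y. (averaged_integral Qs P1 A m (Suc i) (z(i := y)))\<^sup>2 \<partial>?R0)"
  proof (rule square_nn_integral_le_of_relative_deviation[OF R0(1) R1(1) _ _ _ \<delta>])
    show "averaged_integral Qs P1 A m (Suc i) (z(i := y)) \<le> 1" if "y \<in> space ?R0" for y
      using that Suc.prems sp by (intro averaged_integral_le_1[OF P(2) Q1 A Si] update_output_in_space) auto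
  qed (use R0 R1 g sp dev[OF i Suc.prems(2)] in \<open>auto simp: measurable_cong_sets[OF R0(2) refl]\<close>)
  also have "\<dots> \<le> ennreal (1 + \<delta>\<^sup>2) *
      (\<integral>\<^sup>+y. ennreal ((1 + \<delta>\<^sup>2) ^ m) * averaged_integral Qs P0 A m (Suc i) (z(i := y)) \<partial>?R0)"
    using sp Suc.prems by (intro mult_left_mono nn_integral_mono Suc.IH Si update_output_in_space) auto
  also have "\<dots> = ennreal (1 + \<delta>\<^sup>2) * (ennreal ((1 + \<delta>\<^sup>2) ^ m) * averaged_integral Qs P0 A (Suc m) i z)"
    using h by (subst nn_integral_cmult, simp add: measurable_cong_sets[OF R0(2) refl],
        subst averaged_integral_Suc[OF P(1) Q0 A Suc.prems]) auto
  also have "\<dots> = ennreal ((1 + \<delta>\<^sup>2) ^ Suc m) * averaged_integral Qs P0 A (Suc m) i z"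
    by (simp add: ennreal_mult[symmetric] mult.assoc[symmetric] del: ennreal_plus)
  finally show ?case .
qed

section \<open>The lower bound\<close>

lemma integral_bind_unit_interval:
  fixes f :: "'b \<Rightarrow> real"
  assumes P: "prob_space P" and K: "K \<in> P \<rightarrow>\<^sub>M prob_algebra L"
    and f: "f \<in> borel_measurable L" "\<And>y. y \<in> space L \<Longrightarrow> 0 \<le> f y" "\<And>y. y \<in> space L \<Longrightarrow> f y \<le> 1"
  shows "(\<integral>y. f y \<partial>(P \<bind> K)) = (\<integral>x. \<integral>y. f y \<partial>K x \<partial>P)"
    and "(\<lambda>x. \<integral>y. f y \<partial>K x) \<in> borel_measurable P"
    and "\<And>x. x \<in> space P \<Longrightarrow> 0 \<le> (\<integral>y. f y \<partial>K x)"
    and "\<And>x. x \<in> space P \<Longrightarrow> (\<integral>\<^sup>+y. ennreal (f y) \<partial>K x) = ennreal (\<integral>y. f y \<partial>K x)"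
proof -
  interpret P: prob_space P by (rule P)
  note Ks = measurable_prob_algebraD[OF K]
  show meas: "(\<lambda>x. \<integral>y. f y \<partial>K x) \<in> borel_measurable P"
    using measurable_compose[OF Ks integral_measurable_subprob_algebra[OF f(1)]] .
  have nn: "(\<integral>\<^sup>+y. ennreal (f y) \<partial>R) = ennreal (\<integral>y. f y \<partial>R)" "0 \<le> (\<integral>y. f y \<partial>R)" "(\<integral>y. f y \<partial>R) \<le> 1"
    if "prob_space R" "sets R = sets L" for R
  proof -
    interpret R: prob_space R by fact
    have sp: "space R = space L" using that(2) by (rule sets_eq_imp_space_eq)
    have fi: "integrable R f"
      using f that(2) by (intro R.integrable_const_bound[where B = 1])
        (auto intro!: AE_I2 simp: sp measurable_cong_sets[OF that(2) refl])
    show "(\<integral>\<^sup>+y. ennreal (f y) \<partial>R) = ennreal (\<integral>y. f y \<partial>R)"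
      using f fi by (intro nn_integral_eq_integral) (auto intro!: AE_I2 simp: sp)
    show "0 \<le> (\<integral>y. f y \<partial>R)" using f by (intro integral_nonneg_AE) (auto intro!: AE_I2 simp: sp)
    have "(\<integral>y. f y \<partial>R) \<le> (\<integral>y. 1 \<partial>R)" using f fi by (intro integral_mono) (auto simp: sp)
    then show "(\<integral>y. f y \<partial>R) \<le> 1" by (simp add: R.prob_space)
  qed
  note nnK = nn[OF kernel_at(1,2)[OF K]]
  show "0 \<le> (\<integral>y. f y \<partial>K x)" if "x \<in> space P" for x by (rule nnK(2)[OF that that])
  show nnK1: "(\<integral>\<^sup>+y. ennreal (f y) \<partial>K x) = ennreal (\<integral>y. f y \<partial>K x)" if "x \<in> space P" for x
    by (rule nnK(1)[OF that that])
  have PP: "P \<in> space (prob_algebra P)" using P by (simp add: space_prob_algebra)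
  have sB: "sets (P \<bind> K) = sets L" by (rule sets_bind'[OF PP K])
  have pB: "prob_space (P \<bind> K)"
    by (rule P.prob_space_bind[where S = L]) (use kernel_at[OF K] Ks in \<open>auto intro!: AE_I2\<close>)
  have "ennreal (\<integral>y. f y \<partial>(P \<bind> K)) = (\<integral>\<^sup>+y. ennreal (f y) \<partial>(P \<bind> K))"
    by (rule nn(1)[OF pB sB, symmetric])
  also have "\<dots> = (\<integral>\<^sup>+x. \<integral>\<^sup>+y. ennreal (f y) \<partial>K x \<partial>P)"
    using f(1) by (intro nn_integral_bind[OF _ Ks]) auto
  also have "\<dots> = (\<integral>\<^sup>+x. ennreal (\<integral>y. f y \<partial>K x) \<partial>P)"
    by (intro nn_integral_cong nnK1)
  also have "\<dots> = ennreal (\<integral>x. \<integral>y. f y \<partial>K x \<partial>P)"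
    using meas nnK by (intro nn_integral_eq_integral P.integrable_const_bound[where B = 1]) (auto intro!: AE_I2)
  finally show "(\<integral>y. f y \<partial>(P \<bind> K)) = (\<integral>x. \<integral>y. f y \<partial>K x \<partial>P)"
    using nn(2)[OF pB sB] nnK(2) by (subst (asm) ennreal_inj) (auto intro!: integral_nonneg_AE AE_I2)
qed

lemma nn_integral_le_of_emeasure_le:
  assumes sets: "sets R' = sets R" and le: "\<And>A. A \<in> sets R \<Longrightarrow> emeasure R A \<le> c * emeasure R' A"
    and f: "f \<in> borel_measurable R"
  shows "(\<integral>\<^sup>+x. f x \<partial>R) \<le> c * (\<integral>\<^sup>+x. f x \<partial>R')"
proof -
  have "R \<le> scale_measure c R'"
    using sets le by (subst le_measure) auto
  then have "(\<integral>\<^sup>+x. f x \<partial>R) \<le> (\<integral>\<^sup>+x. f x \<partial>scale_measure c R')"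
    using sets by (intro nn_integral_mono_measure) auto
  also have "\<dots> = c * (\<integral>\<^sup>+x. f x \<partial>R')"
    using f by (intro nn_integral_scale_measure) (simp add: measurable_cong_sets[OF sets refl])
  finally show ?thesis .
qed

definition density_family :: "'a measure \<Rightarrow> 'a measure set \<Rightarrow> 'a measure \<Rightarrow> bool" where
  "density_family M \<P> \<nu> \<longleftrightarrow> finite_measure \<nu> \<and> sets \<nu> = sets M \<and>
    (\<forall>P\<in>\<P>. prob_space P \<and> sets P = sets M \<and>
      (\<exists>p. integrable \<nu> p \<and> (\<forall>x. 0 \<le> p x) \<and> P = density \<nu> (\<lambda>x. ennreal (p x))))"

text \<open>Privacy passes from events to integrals of nonnegative functions: as a function of the
  input, the conditional mean of \<open>f\<close> varies by a factor of at most
  \<open>exp \<alpha>\<close>, so the bounded-ratio estimate applies with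
  \<open>r = exp \<alpha>\<close>.\<close>

lemma private_kernel_relative_deviation:
  fixes M :: "'a measure"
  assumes \<nu>: "density_family M \<P> \<nu>" and P: "P0 \<in> \<P>" "P1 \<in> \<P>"
    and K: "K \<in> M \<rightarrow>\<^sub>M prob_algebra L" and \<alpha>: "0 \<le> \<alpha>"
    and priv: "\<And>A x x'. A \<in> sets L \<Longrightarrow> x \<in> space M \<Longrightarrow> x' \<in> space M \<Longrightarrow>
      emeasure (K x) A \<le> ennreal (exp \<alpha>) * emeasure (K x') A"
    and f: "f \<in> borel_measurable L" "\<And>y. y \<in> space L \<Longrightarrow> 0 \<le> f y" "\<And>y. y \<in> space L \<Longrightarrow> f y \<le> 1"
  shows "\<bar>(\<integral>y. f y \<partial>(P1 \<bind> K)) - (\<integral>y. f y \<partial>(P0 \<bind> K))\<bar>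
    \<le> (exp \<alpha> - 1) * tv_dist P0 P1 * (\<integral>y. f y \<partial>(P0 \<bind> K))"
proof -
  have fin: "finite_measure \<nu>" and s\<nu>: "sets \<nu> = sets M" using \<nu> by (auto simp: density_family_def)
  have prob: "prob_space P0" "prob_space P1" and sP: "sets P0 = sets M" "sets P1 = sets M"
    using \<nu> P by (auto simp: density_family_def)
  obtain p0 where p0: "integrable \<nu> p0" "\<And>x. 0 \<le> p0 x" "P0 = density \<nu> (\<lambda>x. ennreal (p0 x))"
    using \<nu> P(1) unfolding density_family_def by metis
  obtain p1 where p1: "integrable \<nu> p1" "\<And>x. 0 \<le> p1 x" "P1 = density \<nu> (\<lambda>x. ennreal (p1 x))"
    using \<nu> P(2) unfolding density_family_def by metis
  have K0: "K \<in> P0 \<rightarrow>\<^sub>M prob_algebra L" and K1: "K \<in> P1 \<rightarrow>\<^sub>M prob_algebra L"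
    using K by (simp_all add: measurable_cong_sets[OF sP(1) refl] measurable_cong_sets[OF sP(2) refl])
  note b0 = integral_bind_unit_interval[OF prob(1) K0 f] and b1 = integral_bind_unit_interval[OF prob(2) K1 f]
  have sp: "space P0 = space M" "space \<nu> = space M" using sP s\<nu> sets_eq_imp_space_eq by blast+
  have "\<bar>(\<integral>x. \<integral>y. f y \<partial>K x \<partial>P1) - (\<integral>x. \<integral>y. f y \<partial>K x \<partial>P0)\<bar>
    \<le> (exp \<alpha> - 1) * tv_dist P0 P1 * (\<integral>x. \<integral>y. f y \<partial>K x \<partial>P0)"
  proof (rule relative_deviation_of_bounded_ratio[OF fin p0 p1 prob])
    show "(\<lambda>x. \<integral>y. f y \<partial>K x) \<in> borel_measurable \<nu>"
      using b0(2) by (simp add: measurable_cong_sets[OF sP(1) refl] measurable_cong_sets[OF s\<nu> refl])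
    show "0 \<le> (\<integral>y. f y \<partial>K x)" if "x \<in> space \<nu>" for x using b0(3) that sp by simp
    show "(\<integral>y. f y \<partial>K x) \<le> exp \<alpha> * (\<integral>y. f y \<partial>K x')" if "x \<in> space \<nu>" "x' \<in> space \<nu>" for x x'
    proof -
      have x: "x \<in> space M" "x' \<in> space M" using that sp by auto
      note Kx = kernel_at[OF K x(1)] and Kx' = kernel_at[OF K x(2)]
      have "(\<integral>\<^sup>+y. ennreal (f y) \<partial>K x) \<le> ennreal (exp \<alpha>) * (\<integral>\<^sup>+y. ennreal (f y) \<partial>K x')"
        using f Kx Kx' priv[OF _ x]
        by (intro nn_integral_le_of_emeasure_le) (auto simp: measurable_cong_sets[OF Kx(2) refl])
      then have "ennreal (\<integral>y. f y \<partial>K x) \<le> ennreal (exp \<alpha> * (\<integral>y. f y \<partial>K x'))"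
        using b0(3,4) x sp by (simp add: ennreal_mult)
      then show ?thesis using b0(3) x sp by (subst (asm) ennreal_le_iff) auto
    qed
  qed (use \<alpha> in auto)
  then show ?thesis by (simp only: b0(1) b1(1))
qed

lemma private_channel_square_le:
  fixes M :: "'a measure"
  assumes \<nu>: "density_family M \<P> \<nu>" and P: "P0 \<in> \<P>" "P1 \<in> \<P>" and \<alpha>: "0 \<le> \<alpha>"
    and Q: "Q \<in> private_channels M q n \<alpha>" and A: "A \<in> sets (outputs q n)"
  defines "\<delta> \<equiv> (exp \<alpha> - 1) * tv_dist P0 P1"
  shows "(emeasure (PiM {..<n} (\<lambda>_. P1) \<bind> Q) A)\<^sup>2 \<le>
    ennreal ((1 + \<delta>\<^sup>2) ^ n) * emeasure (PiM {..<n} (\<lambda>_. P0) \<bind> Q) A"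
proof -
  have Qm: "Q \<in> PiM {..<n} (\<lambda>_. M) \<rightarrow>\<^sub>M prob_algebra (outputs q n)"
    using Q by (simp add: private_channels_def channels_def)
  obtain Qs where Qs: "\<And>i. i < n \<Longrightarrow> Qs i \<in> M \<Otimes>\<^sub>M outputs q i \<rightarrow>\<^sub>M prob_algebra (euclid q)"
    and nest: "\<And>A x. A \<in> sets (outputs q n) \<Longrightarrow> x \<in> space (PiM {..<n} (\<lambda>_. M)) \<Longrightarrow>
      emeasure (Q x) A = nested_integral Qs x A n 0 (\<lambda>_. undefined)"
    and priv: "\<And>i A x x' z. i < n \<Longrightarrow> A \<in> sets (euclid q) \<Longrightarrow> x \<in> space M \<Longrightarrow> x' \<in> space M \<Longrightarrow>
      z \<in> space (outputs q i) \<Longrightarrow> emeasure (Qs i (x, z)) A \<le> ennreal (exp \<alpha>) * emeasure (Qs i (x', z)) A"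
    using Q unfolding private_channels_def sequentially_interactive_def by blast
  have prob: "prob_space P'" and sP: "sets P' = sets M" if "P' \<in> \<P>" for P'
    using \<nu> that by (auto simp: density_family_def)
  have bind: "emeasure (PiM {..<n} (\<lambda>_. P') \<bind> Q) A = averaged_integral Qs P' A n 0 (\<lambda>_. undefined)"
    if P': "P' \<in> \<P>" for P'
  proof -
    have s: "sets (PiM {..<n} (\<lambda>_. P')) = sets (PiM {..<n} (\<lambda>_. M))"
      using sP[OF P'] by (intro sets_PiM_cong) auto
    have "PiM {..<n} (\<lambda>_. P') \<in> space (prob_algebra (PiM {..<n} (\<lambda>_. M)))"
      using s prob[OF P'] by (simp add: space_prob_algebra prob_space_PiM)
    from emeasure_bind_prob_algebra[OF this Qm A]
    have "emeasure (PiM {..<n} (\<lambda>_. P') \<bind> Q) A = (\<integral>\<^sup>+x. emeasure (Q x) A \<partial>PiM {..<n} (\<lambda>_. P'))" .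
    also have "\<dots> = (\<integral>\<^sup>+x. nested_integral Qs x A n 0 (\<lambda>_. undefined) \<partial>PiM {..<n} (\<lambda>_. P'))"
      using sets_eq_imp_space_eq[OF s] by (intro nn_integral_cong nest[OF A]) auto
    finally show ?thesis by (simp add: averaged_integral_def lessThan_atLeast0)
  qed
  have \<delta>: "0 \<le> \<delta>" using \<alpha> tv_dist_nonneg[OF prob prob, OF P] by (simp add: \<delta>_def)
  have "(averaged_integral Qs P1 A n 0 (\<lambda>_. undefined))\<^sup>2 \<le>
      ennreal ((1 + \<delta>\<^sup>2) ^ n) * averaged_integral Qs P0 A n 0 (\<lambda>_. undefined)"
  proof (rule averaged_integral_square_le[OF prob[OF P(1)] prob[OF P(2)] sP[OF P(1)] sP[OF P(2)] Qs A \<delta>])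
    fix i z and f :: "(nat \<Rightarrow> real) \<Rightarrow> real"
    assume i: "i < n" and z: "z \<in> space (outputs q i)"
      and f: "f \<in> borel_measurable (euclid q)" "\<And>y. y \<in> space (euclid q) \<Longrightarrow> 0 \<le> f y"
        "\<And>y. y \<in> space (euclid q) \<Longrightarrow> f y \<le> 1"
    have Kz: "(\<lambda>x. Qs i (x, z)) \<in> M \<rightarrow>\<^sub>M prob_algebra (euclid q)"
      using measurable_compose[OF measurable_Pair2'[OF z] Qs[OF i]] by simp
    show "\<bar>(\<integral>y. f y \<partial>(P1 \<bind> (\<lambda>x. Qs i (x, z)))) - (\<integral>y. f y \<partial>(P0 \<bind> (\<lambda>x. Qs i (x, z))))\<bar>
        \<le> \<delta> * (\<integral>y. f y \<partial>(P0 \<bind> (\<lambda>x. Qs i (x, z))))"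
      unfolding \<delta>_def
      by (rule private_kernel_relative_deviation[OF \<nu> P Kz \<alpha> _ f]) (use priv[OF i _ _ _ z] in auto)
  qed (auto simp: space_PiM)
  with bind P show ?thesis by simp
qed

text \<open>Le Cam's two-point argument, with the \<open>\<chi>\<^sup>2\<close>-type comparison in place of a total variation bound:
  the comparison constant may be large, so no rescaling of the pair is needed.\<close>

lemma two_point_lower_bound:
  fixes l :: "real \<Rightarrow> real" and R :: "'a measure \<Rightarrow> 'b measure"
  assumes P: "P0 \<in> \<P>" "P1 \<in> \<P>"
    and R: "prob_space (R P1)" "sets (R P1) = sets N" "sets (R P0) = sets N"
    and sq: "\<And>A. A \<in> sets N \<Longrightarrow> (emeasure (R P1) A)\<^sup>2 \<le> ennreal B * emeasure (R P0) A"
    and B: "1 \<le> B" and T: "T \<in> borel_measurable N"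
    and l: "\<And>t. 0 \<le> t \<Longrightarrow> 0 \<le> l t" "mono_on {0..} l"
  shows "ennreal (l (\<bar>\<theta> P0 - \<theta> P1\<bar> / 2) / (4 * B)) \<le>
    (SUP P\<in>\<P>. \<integral>\<^sup>+z. ennreal (l \<bar>T z - \<theta> P\<bar>) \<partial>R P)"
proof -
  interpret R1: prob_space "R P1" by (rule R(1))
  define \<Delta> where "\<Delta> = \<bar>\<theta> P0 - \<theta> P1\<bar> / 2"
  have \<Delta>: "0 \<le> \<Delta>" by (simp add: \<Delta>_def)
  define A where "A = {z \<in> space N. \<Delta> \<le> \<bar>T z - \<theta> P0\<bar>}"
  have A: "A \<in> sets N" unfolding A_def using T by measurable
  have lower: "ennreal (l \<Delta>) * emeasure (R P) C \<le> (SUP P\<in>\<P>. \<integral>\<^sup>+z. ennreal (l \<bar>T z - \<theta> P\<bar>) \<partial>R P)"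
    if "P \<in> \<P>" "C \<in> sets N" "sets (R P) = sets N" "\<And>z. z \<in> C \<Longrightarrow> \<Delta> \<le> \<bar>T z - \<theta> P\<bar>" for P C
  proof -
    have "ennreal (l \<Delta>) * emeasure (R P) C = (\<integral>\<^sup>+z. ennreal (l \<Delta>) * indicator C z \<partial>R P)"
      using that by (subst nn_integral_cmult_indicator) auto
    also have "\<dots> \<le> (\<integral>\<^sup>+z. ennreal (l \<bar>T z - \<theta> P\<bar>) \<partial>R P)"
      using that(4) \<Delta> by (intro nn_integral_mono) (auto simp: indicator_def intro!: ennreal_leI mono_onD[OF l(2)])
    also have "\<dots> \<le> (SUP P\<in>\<P>. \<integral>\<^sup>+z. ennreal (l \<bar>T z - \<theta> P\<bar>) \<partial>R P)"
      using that(1) by (rule SUP_upper)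
    finally show ?thesis .
  qed
  have sp: "space (R P1) = space N" using R(2) by (rule sets_eq_imp_space_eq)
  show ?thesis
  \<comment> \<open>If \<open>A\<close> has probability at least \<open>1 / 2\<close> under
    \<open>P1\<close>, then \<open>sq\<close> forces at least \<open>1 / (4 * B)\<close> under
    \<open>P0\<close>, where the estimator errs on \<open>A\<close>. Otherwise it errs under
    \<open>P1\<close> on the complement of \<open>A\<close>, whose probability exceeds
    \<open>1 / 2\<close> and hence \<open>1 / (4 * B)\<close>.\<close>
  proof (cases "measure (R P1) A \<ge> 1 / 2")
    case True
    have "ennreal (1 / 4) \<le> (emeasure (R P1) A)\<^sup>2"
    proof -
      have "1 / 4 \<le> (measure (R P1) A)\<^sup>2"
        using power_mono[OF True, of 2] by (simp add: power2_eq_square)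
      then show ?thesis
        unfolding R1.emeasure_eq_measure by (subst ennreal_power) (auto intro: ennreal_leI)
    qed
    also have "\<dots> \<le> ennreal B * emeasure (R P0) A" by (rule sq[OF A])
    finally have "ennreal (1 / B) * ennreal (1 / 4) \<le> ennreal (1 / B) * (ennreal B * emeasure (R P0) A)"
      by (rule mult_left_mono) auto
    also have "\<dots> = emeasure (R P0) A"
      using B by (simp add: mult.assoc[symmetric] ennreal_mult[symmetric])
    finally have *: "ennreal (1 / (4 * B)) \<le> emeasure (R P0) A"
      using B by (simp add: ennreal_mult[symmetric] mult.commute del: ennreal_divide_numeral)
    have "ennreal (l \<Delta> / (4 * B)) = ennreal (l \<Delta>) * ennreal (1 / (4 * B))"
      using l(1)[OF \<Delta>] B by (subst ennreal_mult[symmetric]) auto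
    also have "\<dots> \<le> ennreal (l \<Delta>) * emeasure (R P0) A" by (intro mult_left_mono *) auto
    also have "\<dots> \<le> (SUP P\<in>\<P>. \<integral>\<^sup>+z. ennreal (l \<bar>T z - \<theta> P\<bar>) \<partial>R P)"
      by (rule lower[OF P(1) A R(3)]) (auto simp: A_def)
    finally show ?thesis by (simp add: \<Delta>_def)
  next
    case False
    have C: "space N - A \<in> sets N" using A by auto
    have "1 / (4 * B) \<le> 1 / 2" using B by (simp add: field_simps)
    moreover have "measure (R P1) (space N - A) = 1 - measure (R P1) A"
      using R1.prob_compl[of A] A R(2) sp by simp
    ultimately have "1 / (4 * B) \<le> measure (R P1) (space N - A)"
      using False by linarith
    then have *: "ennreal (1 / (4 * B)) \<le> emeasure (R P1) (space N - A)"
      by (simp add: R1.emeasure_eq_measure ennreal_leI)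
    have "ennreal (l \<Delta> / (4 * B)) = ennreal (l \<Delta>) * ennreal (1 / (4 * B))"
      using l(1)[OF \<Delta>] B by (subst ennreal_mult[symmetric]) auto
    also have "\<dots> \<le> ennreal (l \<Delta>) * emeasure (R P1) (space N - A)" by (intro mult_left_mono *) auto
    also have "\<dots> \<le> (SUP P\<in>\<P>. \<integral>\<^sup>+z. ennreal (l \<bar>T z - \<theta> P\<bar>) \<partial>R P)"
    proof (rule lower[OF P(2) C R(2)])
      fix z assume "z \<in> space N - A"
      then have "\<bar>T z - \<theta> P0\<bar> < \<Delta>" by (auto simp: A_def)
      moreover have "\<bar>\<theta> P0 - \<theta> P1\<bar> \<le> \<bar>T z - \<theta> P0\<bar> + \<bar>T z - \<theta> P1\<bar>" by linarith
      ultimately show "\<Delta> \<le> \<bar>T z - \<theta> P1\<bar>" by (simp add: \<Delta>_def)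
    qed
    finally show ?thesis by (simp add: \<Delta>_def)
  qed
qed

section \<open>The modulus of continuity and the lower bound on the risk\<close>

lemma modulus_tv_upper:
  assumes bdd: "bdd_above ((\<lambda>P. \<bar>\<theta> P\<bar>) ` \<P>)"
    and "P0 \<in> \<P>" "P1 \<in> \<P>" "tv_dist P0 P1 \<le> \<epsilon>"
  shows "\<bar>\<theta> P0 - \<theta> P1\<bar> \<le> modulus_tv \<P> \<theta> \<epsilon>"
proof -
  obtain b where b: "\<And>P. P \<in> \<P> \<Longrightarrow> \<bar>\<theta> P\<bar> \<le> b" using bdd by (auto simp: bdd_above_def)
  have "bdd_above {\<bar>\<theta> P0 - \<theta> P1\<bar> | P0 P1. P0 \<in> \<P> \<and> P1 \<in> \<P> \<and> tv_dist P0 P1 \<le> \<epsilon>}"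
  proof (rule bdd_aboveI[where M = "2 * b"])
    fix x assume "x \<in> {\<bar>\<theta> P0 - \<theta> P1\<bar> | P0 P1. P0 \<in> \<P> \<and> P1 \<in> \<P> \<and> tv_dist P0 P1 \<le> \<epsilon>}"
    then obtain P P' where "P \<in> \<P>" "P' \<in> \<P>" "x = \<bar>\<theta> P - \<theta> P'\<bar>" by auto
    then show "x \<le> 2 * b" using b[of P] b[of P'] by linarith
  qed
  then show ?thesis unfolding modulus_tv_def using assms by (intro cSup_upper) auto
qed

lemma modulus_tv_nonneg:
  assumes "bdd_above ((\<lambda>P. \<bar>\<theta> P\<bar>) ` \<P>)" "\<P> \<noteq> {}" "0 \<le> \<epsilon>"
  shows "0 \<le> modulus_tv \<P> \<theta> \<epsilon>"
proof -
  obtain P where "P \<in> \<P>" using assms by auto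
  then show ?thesis using modulus_tv_upper[OF assms(1), of P P] assms(3) by (simp add: tv_dist_self)
qed

lemma private_minimax_lower_bound:
  fixes M :: "'a measure" and l :: "real \<Rightarrow> real"
  assumes \<nu>: "density_family M \<P> \<nu>" and ne: "\<P> \<noteq> {}"
    and bdd: "bdd_above ((\<lambda>P. \<bar>\<theta> P\<bar>) ` \<P>)"
    and l: "\<And>t. 0 \<le> t \<Longrightarrow> 0 \<le> l t" "mono_on {0..} l" "l 0 = 0"
    and a: "1 < a" "\<And>t. 0 \<le> t \<Longrightarrow> l (3 / 2 * t) \<le> a * l t"
    and \<alpha>: "0 < \<alpha>" and n: "1 \<le> n"
  shows "ennreal (l (modulus_tv \<P> \<theta> (real n powr (- 1 / 2))) / (4 * exp ((exp \<alpha> - 1)\<^sup>2) * a\<^sup>2)) \<le>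
    private_minimax_risk M n \<alpha> \<P> \<theta> l"
proof -
  define \<epsilon> where "\<epsilon> = real n powr (- 1 / 2)"
  have \<epsilon>: "0 < \<epsilon>" "\<epsilon>\<^sup>2 = 1 / n"
  proof -
    show "0 < \<epsilon>" using n by (simp add: \<epsilon>_def)
    have "\<epsilon>\<^sup>2 = real n powr (- 1 / 2 + - 1 / 2)" unfolding \<epsilon>_def power2_eq_square by (rule powr_add[symmetric])
    then show "\<epsilon>\<^sup>2 = 1 / n" using n by (simp add: powr_minus_divide)
  qed
  define \<omega> where "\<omega> = modulus_tv \<P> \<theta> \<epsilon>"
  \<comment> \<open>Bounds \<open>exp (n * \<delta>\<^sup>2)\<close> for
    \<open>\<delta> \<le> (exp \<alpha> - 1) * \<epsilon>\<close>, because
    \<open>n * \<epsilon>\<^sup>2 = 1\<close>.\<close>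
  define B where "B = exp ((exp \<alpha> - 1)\<^sup>2)"
  have B: "1 \<le> B" by (simp add: B_def)
  show ?thesis
  proof (cases "\<omega> \<le> 0")
    case True
    then have "\<omega> = 0" using modulus_tv_nonneg[OF bdd ne, of \<epsilon>] \<epsilon> by (simp add: \<omega>_def)
    then show ?thesis using l(3) by (simp add: \<omega>_def \<epsilon>_def)
  next
    case False
    \<comment> \<open>The supremum need not be attained. With a pair at distance above
      \<open>8 / 9 * \<omega>\<close>, half the distance exceeds \<open>4 / 9 * \<omega>\<close>,
      and since \<open>4 / 9\<close> is the inverse square of \<open>3 / 2\<close>, two uses of the
      growth condition lead back to \<open>l \<omega>\<close> at the cost of
      \<open>a\<^sup>2\<close>.\<close>
    then have less: "8 / 9 * \<omega> < modulus_tv \<P> \<theta> \<epsilon>" by (simp add: \<omega>_def)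
    have ne': "{\<bar>\<theta> P0 - \<theta> P1\<bar> | P0 P1. P0 \<in> \<P> \<and> P1 \<in> \<P> \<and> tv_dist P0 P1 \<le> \<epsilon>} \<noteq> {}"
    proof -
      obtain P where "P \<in> \<P>" using ne by auto
      moreover have "tv_dist P P \<le> \<epsilon>" using \<epsilon> by (simp add: tv_dist_self)
      ultimately show ?thesis by blast
    qed
    obtain x where "8 / 9 * \<omega> < x"
      "x \<in> {\<bar>\<theta> P0 - \<theta> P1\<bar> | P0 P1. P0 \<in> \<P> \<and> P1 \<in> \<P> \<and> tv_dist P0 P1 \<le> \<epsilon>}"
      using less_cSupD[OF ne' less[unfolded modulus_tv_def]] by blast
    then obtain P0 P1 where P: "P0 \<in> \<P>" "P1 \<in> \<P>" "tv_dist P0 P1 \<le> \<epsilon>" "8 / 9 * \<omega> < \<bar>\<theta> P0 - \<theta> P1\<bar>"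
      by blast
    define \<Delta> where "\<Delta> = \<bar>\<theta> P0 - \<theta> P1\<bar> / 2"
    have "l \<omega> = l (3 / 2 * (3 / 2 * (4 / 9 * \<omega>)))" by simp
    also have "\<dots> \<le> a * l (3 / 2 * (4 / 9 * \<omega>))" using False by (intro a) auto
    also have "\<dots> \<le> a * (a * l (4 / 9 * \<omega>))" using False a by (intro mult_left_mono a(2)) auto
    also have "\<dots> \<le> a * (a * l \<Delta>)"
      using P(4) a False by (intro mult_left_mono mono_onD[OF l(2)]) (auto simp: \<Delta>_def)
    finally have "l \<omega> / (4 * B * a\<^sup>2) \<le> l \<Delta> / (4 * B)"
      using B a by (simp add: field_simps power2_eq_square)
    then have "ennreal (l \<omega> / (4 * B * a\<^sup>2)) \<le> ennreal (l \<Delta> / (4 * B))" by (rule ennreal_leI)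
    also have "\<dots> \<le> private_minimax_risk M n \<alpha> \<P> \<theta> l"
      unfolding private_minimax_risk_def channel_risk_def
    proof (intro INF_greatest)
      fix q Q and T :: "(nat \<Rightarrow> nat \<Rightarrow> real) \<Rightarrow> real"
      assume Q: "Q \<in> private_channels M q n \<alpha>" and T: "T \<in> borel_measurable (outputs q n)"
      have Qm: "Q \<in> PiM {..<n} (\<lambda>_. M) \<rightarrow>\<^sub>M prob_algebra (outputs q n)"
        using Q by (simp add: private_channels_def channels_def)
      have R: "prob_space (PiM {..<n} (\<lambda>_. P) \<bind> Q)" "sets (PiM {..<n} (\<lambda>_. P) \<bind> Q) = sets (outputs q n)"
        if PP: "P \<in> \<P>" for P
      proof -
        have P': "prob_space P" "sets P = sets M" using \<nu> PP by (auto simp: density_family_def)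
        have "sets (PiM {..<n} (\<lambda>_. P)) = sets (PiM {..<n} (\<lambda>_. M))"
          using P' by (intro sets_PiM_cong) auto
        then have "PiM {..<n} (\<lambda>_. P) \<in> space (prob_algebra (PiM {..<n} (\<lambda>_. M)))"
          using P' by (simp add: space_prob_algebra prob_space_PiM)
        \<comment> \<open>The rule for binding a family of measures is applied to a constant family,
          which makes it a statement about one measure.\<close>
        then have "PiM {..<n} (\<lambda>_. P) \<bind> Q \<in> space (prob_algebra (outputs q n))"
          using measurable_space[OF measurable_bind_prob_space[OF measurable_const Qm, of _ "count_space UNIV"], of _ undefined]
          by simp
        then show "prob_space (PiM {..<n} (\<lambda>_. P) \<bind> Q)" "sets (PiM {..<n} (\<lambda>_. P) \<bind> Q) = sets (outputs q n)"
          by (auto simp: space_prob_algebra)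
      qed
      show "ennreal (l \<Delta> / (4 * B)) \<le> (SUP P\<in>\<P>. \<integral>\<^sup>+z. ennreal (l \<bar>T z - \<theta> P\<bar>) \<partial>(PiM {..<n} (\<lambda>_. P) \<bind> Q))"
        unfolding \<Delta>_def
      proof (rule two_point_lower_bound[OF P(1,2) R(1)[OF P(2)] R(2)[OF P(2)] R(2)[OF P(1)] _ B T l(1,2)])
        fix A assume A: "A \<in> sets (outputs q n)"
        define \<delta> where "\<delta> = (exp \<alpha> - 1) * tv_dist P0 P1"
        have tv: "0 \<le> tv_dist P0 P1" using \<nu> P by (intro tv_dist_nonneg) (auto simp: density_family_def)
        have "\<delta>\<^sup>2 = (exp \<alpha> - 1)\<^sup>2 * (tv_dist P0 P1)\<^sup>2" by (simp add: \<delta>_def power_mult_distrib)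
        also have "\<dots> \<le> (exp \<alpha> - 1)\<^sup>2 * \<epsilon>\<^sup>2" using P(3) tv by (intro mult_left_mono power_mono) auto
        finally have d: "real n * \<delta>\<^sup>2 \<le> (exp \<alpha> - 1)\<^sup>2" using n by (simp add: \<epsilon>(2) field_simps)
        have "(1 + \<delta>\<^sup>2) ^ n \<le> exp (\<delta>\<^sup>2) ^ n" by (intro power_mono exp_ge_add_one_self) auto
        also have "\<dots> = exp (real n * \<delta>\<^sup>2)" by (rule exp_of_nat_mult[symmetric])
        also have "\<dots> \<le> B" using d by (simp add: B_def)
        finally have K: "(1 + \<delta>\<^sup>2) ^ n \<le> B" .
        have "(emeasure (PiM {..<n} (\<lambda>_. P1) \<bind> Q) A)\<^sup>2 \<le>
            ennreal ((1 + \<delta>\<^sup>2) ^ n) * emeasure (PiM {..<n} (\<lambda>_. P0) \<bind> Q) A"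
          unfolding \<delta>_def using \<alpha> by (intro private_channel_square_le[OF \<nu> P(1,2) _ Q A]) auto
        also have "\<dots> \<le> ennreal B * emeasure (PiM {..<n} (\<lambda>_. P0) \<bind> Q) A"
          by (intro mult_right_mono ennreal_leI K) auto
        finally show "(emeasure (PiM {..<n} (\<lambda>_. P1) \<bind> Q) A)\<^sup>2 \<le>
            ennreal B * emeasure (PiM {..<n} (\<lambda>_. P0) \<bind> Q) A" .
      qed
    qed
    finally show ?thesis by (simp add: \<omega>_def \<epsilon>_def B_def)
  qed
qed

section \<open>Product channels\<close>

text \<open>A factor \<open>a\<close> per dilation by \<open>3 / 2\<close> means polynomial growth
  in \<open>u\<close>, here weakened to an exponential. The rate in \<open>u\<close> is
  \<open>1\<close> whatever \<open>a\<close> is, so exponential moments at one scale serve every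
  loss; \<open>a\<close> enters through \<open>C\<close> alone.\<close>

lemma loss_growth_exp:
  fixes l :: "real \<Rightarrow> real"
  assumes l: "\<And>t. 0 \<le> t \<Longrightarrow> 0 \<le> l t" "mono_on {0..} l"
    and a: "1 < a" "\<And>t. 0 \<le> t \<Longrightarrow> l (3 / 2 * t) \<le> a * l t"
  obtains C where "0 < C" "\<And>w u. 0 \<le> w \<Longrightarrow> 0 \<le> u \<Longrightarrow> l (w * u) \<le> C * exp u * l w"
proof -
  obtain N0 :: nat where N0: "a < (3 / 2) ^ N0" using real_arch_pow[of "3 / 2" a] by auto
  define N where "N = Suc N0"
  have "(3 / 2 :: real) ^ N0 \<le> (3 / 2) ^ N" unfolding N_def by (rule power_increasing) auto
  then have N: "a \<le> (3 / 2) ^ N" "0 < N" using N0 by (linarith, simp add: N_def)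
  \<comment> \<open>For \<open>u > 1\<close> and \<open>k\<close> least with
    \<open>u \<le> (3 / 2) ^ k\<close>, the bounds \<open>(3 / 2) ^ (k - 1) \<le> u\<close> and
    \<open>a \<le> (3 / 2) ^ N\<close> give \<open>a ^ k \<le> a * u ^ N\<close>. The factor
    \<open>N ^ N\<close> comes from \<open>y \<le> exp y\<close> at
    \<open>y = u / N\<close>.\<close>
  define C where "C = a * real N ^ N"
  have C: "1 \<le> C" using a N by (auto simp: C_def intro: mult_ge1_I)
  have iter: "l ((3 / 2) ^ k * w) \<le> a ^ k * l w" if "0 \<le> w" for w k
  proof (induction k)
    case (Suc k)
    have "l ((3 / 2) ^ Suc k * w) = l (3 / 2 * ((3 / 2) ^ k * w))" by (simp add: mult.assoc)
    also have "\<dots> \<le> a * l ((3 / 2) ^ k * w)" using that by (intro a) auto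
    also have "\<dots> \<le> a * (a ^ k * l w)" using Suc a by (intro mult_left_mono) auto
    finally show ?case by (simp add: mult.assoc)
  qed simp
  have "l (w * u) \<le> C * exp u * l w" if w: "0 \<le> w" and u: "0 \<le> u" for w u
  proof (cases "u \<le> 1")
    case True
    have "l (w * u) \<le> l w" using True w u by (intro mono_onD[OF l(2)]) (auto intro: mult_left_le)
    also have "\<dots> \<le> C * exp u * l w"
    proof -
      have "1 * 1 \<le> C * exp u" using C u by (intro mult_mono) auto
      then show ?thesis using l(1)[OF w] mult_right_mono[of 1 "C * exp u" "l w"] by simp
    qed
    finally show ?thesis .
  next
    case False
    define k where "k = (LEAST k. u \<le> (3 / 2 :: real) ^ k)"
    have ex: "\<exists>k. u \<le> (3 / 2 :: real) ^ k" using real_arch_pow[of "3 / 2" u] by (auto intro: less_imp_le)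
    have k: "u \<le> (3 / 2) ^ k" unfolding k_def by (rule LeastI_ex[OF ex])
    then have "k \<noteq> 0" using False by (intro notI) simp
    then obtain j where j: "k = Suc j" using not0_implies_Suc by blast
    have "\<not> u \<le> (3 / 2) ^ j" using not_less_Least[of j "\<lambda>k. u \<le> (3 / 2 :: real) ^ k"] j by (simp add: k_def)
    then have uj: "(3 / 2) ^ j \<le> u" by simp
    have "a ^ k \<le> a * ((3 / 2) ^ N) ^ j" using a N j by (auto intro!: mult_left_mono power_mono)
    also have "((3 / 2 :: real) ^ N) ^ j = ((3 / 2) ^ j) ^ N" by (simp only: power_mult[symmetric] mult.commute)
    also have "a * ((3 / 2) ^ j) ^ N \<le> a * u ^ N" using a uj by (intro mult_left_mono power_mono) auto
    also have "u ^ N \<le> real N ^ N * exp u"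
    proof -
      have "(u / N) ^ N \<le> exp (u / N) ^ N"
      proof (rule power_mono)
        show "u / N \<le> exp (u / N)" using exp_ge_add_one_self[of "u / N"] by linarith
      qed (use u in simp)
      also have "\<dots> = exp u" using N by (simp add: exp_of_nat_mult[symmetric])
      finally show ?thesis using N by (simp add: power_divide field_simps)
    qed
    finally have ak: "a ^ k \<le> C * exp u" using a by (simp add: C_def mult.assoc)
    have "l (w * u) \<le> l ((3 / 2) ^ k * w)"
      using k w u by (intro mono_onD[OF l(2)]) (auto simp: mult.commute[of w] intro: mult_right_mono)
    also have "\<dots> \<le> a ^ k * l w" by (rule iter[OF w])
    also have "\<dots> \<le> C * exp u * l w" using ak l(1)[OF w] by (rule mult_right_mono)
    finally show ?thesis .
  qed
  with C that show ?thesis by (meson less_le_trans zero_less_one)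
qed

text \<open>Hoeffding's lemma for \<open>w\<close> times a random sign of mean
  \<open>2 * p - 1\<close>: the range has length \<open>2 * \<bar>w\<bar>\<close>, and
  \<open>(2 * \<bar>w\<bar>)\<^sup>2 / 8 = w\<^sup>2 / 2\<close>.\<close>

lemma bernoulli_mgf_le:
  fixes p w :: real
  assumes p: "0 \<le> p" "p \<le> 1"
  shows "p * exp (w * (1 - (2 * p - 1))) + (1 - p) * exp (w * (- 1 - (2 * p - 1))) \<le> exp (w\<^sup>2 / 2)"
proof -
  define f where "f b = (if b then w else - w)" for b
  interpret interval_bounded_random_variable "measure_pmf (bernoulli_pmf p)" f "- \<bar>w\<bar>" "\<bar>w\<bar>"
    by unfold_locales (auto simp: f_def intro!: AE_I2)
  have E: "measure_pmf.expectation (bernoulli_pmf p) f = w * (2 * p - 1)"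
    using p by (simp add: f_def algebra_simps)
  have "(\<integral>\<^sup>+b. ennreal (exp (1 * (f b - measure_pmf.expectation (bernoulli_pmf p) f))) \<partial>bernoulli_pmf p)
      \<le> ennreal (exp (1\<^sup>2 * (\<bar>w\<bar> - - \<bar>w\<bar>)\<^sup>2 / 8))"
    by (rule Hoeffdings_lemma_nn_integral) auto
  also have "(1::real)\<^sup>2 * (\<bar>w\<bar> - - \<bar>w\<bar>)\<^sup>2 / 8 = w\<^sup>2 / 2" by (simp add: power2_eq_square)
  also have "(\<integral>\<^sup>+b. ennreal (exp (1 * (f b - measure_pmf.expectation (bernoulli_pmf p) f))) \<partial>bernoulli_pmf p)
      = ennreal (exp (w - w * (2 * p - 1))) * ennreal p + ennreal (exp (- w - w * (2 * p - 1))) * ennreal (1 - p)"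
    unfolding E using p by (subst nn_integral_bernoulli_pmf) (auto simp: f_def)
  also have "\<dots> = ennreal (p * exp (w * (1 - (2 * p - 1))) + (1 - p) * exp (w * (- 1 - (2 * p - 1))))"
  proof -
    have "w * (1 - (2 * p - 1)) = w - w * (2 * p - 1)" "w * (- 1 - (2 * p - 1)) = - w - w * (2 * p - 1)"
      by (simp_all add: algebra_simps)
    then show ?thesis using p by (subst ennreal_plus) (auto simp: ennreal_mult mult.commute)
  qed
  finally show ?thesis by (subst (asm) ennreal_le_iff) auto
qed

text \<open>For kernels that ignore the past, the nested integral is Fubini for the product measure,
  one coordinate peeled off per stage; \<open>merge\<close> glues the fixed past \<open>z\<close> to
  the coordinates still being integrated. \<open>R\<close> is a probability measure beyond
  \<open>n\<close> as well, since the product locale quantifies over all indices.\<close>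

lemma nested_integral_product:
  fixes R :: "nat \<Rightarrow> (nat \<Rightarrow> real) measure"
  assumes R: "\<And>j. prob_space (R j)" "\<And>j. j < n \<Longrightarrow> sets (R j) = sets (euclid q)"
    and Qs: "\<And>i z. i < n \<Longrightarrow> Qs i (x i, z) = R i" and A: "A \<in> sets (outputs q n)"
  shows "i + m = n \<Longrightarrow> z \<in> space (outputs q i) \<Longrightarrow> nested_integral Qs x A m i z =
    (\<integral>\<^sup>+w. indicator A (merge {..<i} {i..<n} (z, w)) \<partial>PiM {i..<n} R)"
proof (induction m arbitrary: i z)
  case 0
  interpret product_sigma_finite R
    by (intro product_sigma_finite.intro prob_space_imp_sigma_finite R)
  have "merge {..<n} {} (z, (\<lambda>k. undefined)) = z"
    using 0 by (auto simp: merge_def space_PiM PiE_def extensional_def fun_eq_iff)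
  then show ?case using 0 by (simp add: PiM_empty nn_integral_count_space_finite)
next
  case (Suc m)
  interpret product_sigma_finite R
    by (intro product_sigma_finite.intro prob_space_imp_sigma_finite R)
  have i: "i < n" using Suc.prems by simp
  have ins: "{i..<n} = insert i {Suc i..<n}" using i by auto
  have s: "sets (PiM {i..<n} R) = sets (PiM {i..<n} (\<lambda>_. euclid q))"
    using R by (intro sets_PiM_cong) auto
  have "(\<lambda>w. merge {..<i} {i..<n} (z, w)) \<in> PiM {i..<n} (\<lambda>_. euclid q) \<rightarrow>\<^sub>M outputs q n"
  proof -
    have "{..<i} \<union> {i..<n} = {..<n}" using i by auto
    with measurable_compose[OF measurable_Pair1'[OF Suc.prems(2)] measurable_merge, of "{i..<n}"]
    show ?thesis by simp
  qed
  then have "(\<lambda>w. merge {..<i} {i..<n} (z, w)) \<in> PiM {i..<n} R \<rightarrow>\<^sub>M outputs q n"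
    by (simp add: measurable_cong_sets[OF s refl])
  from measurable_compose[OF this borel_measurable_indicator[OF A]]
  have f: "(\<lambda>w. indicator A (merge {..<i} {i..<n} (z, w)) :: ennreal) \<in> borel_measurable (PiM (insert i {Suc i..<n}) R)"
    unfolding ins[symmetric] .
  have spR: "space (R i) = space (euclid q)" using R(2)[OF i] by (rule sets_eq_imp_space_eq)
  have "(\<integral>\<^sup>+w. indicator A (merge {..<i} {i..<n} (z, w)) \<partial>PiM {i..<n} R) =
      (\<integral>\<^sup>+y. \<integral>\<^sup>+w. indicator A (merge {..<i} {i..<n} (z, w(i := y))) \<partial>PiM {Suc i..<n} R \<partial>R i)"
    by (rule product_nn_integral_insert_rev[OF _ _ f, unfolded ins[symmetric]]) auto
  also have "\<dots> = (\<integral>\<^sup>+y. \<integral>\<^sup>+w. indicator A (merge {..<Suc i} {Suc i..<n} (z(i := y), w)) \<partial>PiM {Suc i..<n} R \<partial>R i)"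
  proof (intro nn_integral_cong)
    fix y w
    have "merge {..<i} {i..<n} (z, w(i := y)) = merge {..<Suc i} {Suc i..<n} (z(i := y), w)"
      using i by (auto simp: merge_def fun_eq_iff)
    then show "indicator A (merge {..<i} {i..<n} (z, w(i := y))) =
        (indicator A (merge {..<Suc i} {Suc i..<n} (z(i := y), w)) :: ennreal)" by simp
  qed
  also have "\<dots> = (\<integral>\<^sup>+y. nested_integral Qs x A m (Suc i) (z(i := y)) \<partial>R i)"
    using Suc.prems spR by (intro nn_integral_cong Suc.IH[symmetric] update_output_in_space) auto
  finally show ?case using Qs[OF i] by simp
qed

text \<open>At \<open>j \<ge> n\<close> the inputs are \<open>undefined\<close> and
  \<open>K (x j)\<close> may fail to be a probability measure, while the product locale asks for all
  indices. A point mass is put there, which the finite product does not see.\<close>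

lemma PiM_as_total_prob_family:
  assumes "\<And>j. j < n \<Longrightarrow> prob_space (R j)"
  obtains R' where "\<And>j. prob_space (R' j)" "\<And>j. j < n \<Longrightarrow> R' j = R j"
    "PiM {..<n} R = PiM {..<n} R'"
proof
  let ?R' = "\<lambda>j. if j < n then R j else return (count_space UNIV) undefined"
  show "prob_space (?R' j)" for j using assms by (auto intro: prob_space_return)
  show "?R' j = R j" if "j < n" for j using that by simp
  show "PiM {..<n} R = PiM {..<n} ?R'" by (intro PiM_cong) auto
qed

lemma product_channel_private:
  fixes M :: "'a measure"
  assumes K: "K \<in> M \<rightarrow>\<^sub>M prob_algebra (euclid q)"
    and priv: "\<And>A x x'. A \<in> sets (euclid q) \<Longrightarrow> x \<in> space M \<Longrightarrow> x' \<in> space M \<Longrightarrow>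
      emeasure (K x) A \<le> ennreal (exp \<alpha>) * emeasure (K x') A"
  shows "(\<lambda>x. PiM {..<n} (\<lambda>i. K (x i))) \<in> private_channels M q n \<alpha>"
proof -
  let ?Q = "\<lambda>x. PiM {..<n} (\<lambda>i. K (x i))"
  have xs: "x i \<in> space M" if "x \<in> space (PiM {..<n} (\<lambda>_. M))" "i < n" for x and i :: nat
    using that by (auto simp: space_PiM)
  have "?Q \<in> PiM {..<n} (\<lambda>_. M) \<rightarrow>\<^sub>M prob_algebra (outputs q n)"
  \<comment> \<open>On rectangles the product law is a finite product of kernel values, visibly
    measurable in the inputs; rectangles are stable under intersection and generate the output
    sigma-algebra.\<close>
  proof (rule measurable_prob_algebra_generated[OF sets_PiM Int_stable_prod_algebra prod_algebra_sets_into_space])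
    fix x assume x: "x \<in> space (PiM {..<n} (\<lambda>_. M))"
    note Kx = kernel_at[OF K xs[OF x]]
    show "prob_space (?Q x)" using Kx by (intro prob_space_PiM) auto
    show "sets (?Q x) = sets (outputs q n)" using Kx by (intro sets_PiM_cong) auto
  next
    fix A assume "A \<in> prod_algebra {..<n} (\<lambda>_. euclid q)"
    then obtain X where X: "\<And>i. i < n \<Longrightarrow> X i \<in> sets (euclid q)" "A = (\<Pi>\<^sub>E i\<in>{..<n}. X i)"
      by (auto simp: prod_algebra_eq_finite)
    have "(\<lambda>x. \<Prod>i<n. emeasure (K (x i)) (X i)) \<in> borel_measurable (PiM {..<n} (\<lambda>_. M))"
    proof (intro borel_measurable_prod_ennreal)
      fix i assume "i \<in> {..<n}"
      then show "(\<lambda>x. emeasure (K (x i)) (X i)) \<in> borel_measurable (PiM {..<n} (\<lambda>_. M))"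
        using X by (intro measurable_compose[OF measurable_component_singleton]
            measurable_compose[OF measurable_prob_algebraD[OF K] measurable_emeasure_subprob_algebra]) auto
    qed
    also have "?this \<longleftrightarrow> (\<lambda>x. emeasure (?Q x) A) \<in> borel_measurable (PiM {..<n} (\<lambda>_. M))"
    proof (rule measurable_cong)
      fix x assume x: "x \<in> space (PiM {..<n} (\<lambda>_. M))"
      note Kx = kernel_at[OF K xs[OF x]]
      obtain R where R: "\<And>j. prob_space (R j)" "\<And>j. j < n \<Longrightarrow> R j = K (x j)" "?Q x = PiM {..<n} R"
        using PiM_as_total_prob_family[of n "\<lambda>j. K (x j)"] Kx(1) by metis
      interpret product_sigma_finite R
        by (intro product_sigma_finite.intro prob_space_imp_sigma_finite R)
      show "(\<Prod>i<n. emeasure (K (x i)) (X i)) = emeasure (?Q x) A"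
        unfolding R(3) X(2) using R(2) X(1) Kx by (subst emeasure_PiM) auto
    qed
    finally show "(\<lambda>x. emeasure (?Q x) A) \<in> borel_measurable (PiM {..<n} (\<lambda>_. M))" .
  qed
  moreover have "sequentially_interactive M q n \<alpha> ?Q"
    unfolding sequentially_interactive_def
  proof (intro exI[of _ "\<lambda>_ p. K (fst p)"] conjI allI impI ballI)
    show "(\<lambda>p. K (fst p)) \<in> M \<Otimes>\<^sub>M outputs q i \<rightarrow>\<^sub>M prob_algebra (euclid q)" for i
      by (rule measurable_compose[OF measurable_fst K])
    show "emeasure (K (fst (x, z))) A \<le> ennreal (exp \<alpha>) * emeasure (K (fst (x', z))) A"
      if "A \<in> sets (euclid q)" "x \<in> space M" "x' \<in> space M" for A x x' and z :: "nat \<Rightarrow> nat \<Rightarrow> real"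
      using priv that by simp
    fix A x assume A: "A \<in> sets (outputs q n)" and x: "x \<in> space (PiM {..<n} (\<lambda>_. M))"
    note Kx = kernel_at[OF K xs[OF x]]
    obtain R where R: "\<And>j. prob_space (R j)" "\<And>j. j < n \<Longrightarrow> R j = K (x j)" "?Q x = PiM {..<n} R"
      using PiM_as_total_prob_family[of n "\<lambda>j. K (x j)"] Kx(1) by metis
    have sR: "sets (PiM {..<n} R) = sets (outputs q n)"
      using R(2) Kx by (intro sets_PiM_cong) auto
    have "nested_integral (\<lambda>_ p. K (fst p)) x A n 0 (\<lambda>_. undefined) =
        (\<integral>\<^sup>+w. indicator A (merge {..<0} {0..<n} (\<lambda>_. undefined, w)) \<partial>PiM {0..<n} R)"
      using R Kx A by (intro nested_integral_product[where q = q]) (auto simp: space_PiM)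
    also have "\<dots> = (\<integral>\<^sup>+w. indicator A w \<partial>PiM {..<n} R)"
      unfolding lessThan_atLeast0[symmetric]
      by (intro nn_integral_cong arg_cong[where f = "indicator A"])
        (auto simp: merge_def space_PiM PiE_def extensional_def fun_eq_iff)
    also have "\<dots> = emeasure (?Q x) A" using A sR R(3) by simp
    finally show "emeasure (?Q x) A = nested_integral (\<lambda>_ p. K (fst p)) x A n 0 (\<lambda>_. undefined)" ..
  qed
  ultimately show ?thesis by (simp add: private_channels_def channels_def)
qed

text \<open>Once the inputs are integrated out, the outputs are independent with a common law. With
  an exponential \<open>g\<close> this is the moment generating function of the sum of the
  reports.\<close>

lemma nn_integral_product_channel:
  fixes g :: "(nat \<Rightarrow> real) \<Rightarrow> ennreal"
  assumes P: "prob_space P" and K: "K \<in> P \<rightarrow>\<^sub>M prob_algebra (euclid q)"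
    and Q: "(\<lambda>x. PiM {..<n} (\<lambda>i. K (x i))) \<in> PiM {..<n} (\<lambda>_. P) \<rightarrow>\<^sub>M prob_algebra (outputs q n)"
    and g: "g \<in> borel_measurable (euclid q)"
  shows "(\<integral>\<^sup>+z. (\<Prod>i<n. g (z i)) \<partial>(PiM {..<n} (\<lambda>_. P) \<bind> (\<lambda>x. PiM {..<n} (\<lambda>i. K (x i))))) =
    (\<integral>\<^sup>+x. \<integral>\<^sup>+y. g y \<partial>K x \<partial>P) ^ n"
proof -
  interpret P: prob_space P by (rule P)
  interpret PP: product_sigma_finite "\<lambda>_. P" ..
  have "(\<lambda>z. \<Prod>i<n. g (z i)) \<in> borel_measurable (outputs q n)"
    using g by (intro borel_measurable_prod_ennreal measurable_compose[OF measurable_component_singleton]) auto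
  then have "(\<integral>\<^sup>+z. (\<Prod>i<n. g (z i)) \<partial>(PiM {..<n} (\<lambda>_. P) \<bind> (\<lambda>x. PiM {..<n} (\<lambda>i. K (x i))))) =
      (\<integral>\<^sup>+x. \<integral>\<^sup>+z. (\<Prod>i<n. g (z i)) \<partial>PiM {..<n} (\<lambda>i. K (x i)) \<partial>PiM {..<n} (\<lambda>_. P))"
    by (rule nn_integral_bind[OF _ measurable_prob_algebraD[OF Q]])
  also have "\<dots> = (\<integral>\<^sup>+x. (\<Prod>i<n. \<integral>\<^sup>+y. g y \<partial>K (x i)) \<partial>PiM {..<n} (\<lambda>_. P))"
  proof (rule nn_integral_cong)
    fix x assume "x \<in> space (PiM {..<n} (\<lambda>_. P))"
    then have "x j \<in> space P" if "j < n" for j using that by (auto simp: space_PiM)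
    note Kx = kernel_at[OF K this]
    obtain R where R: "\<And>j. prob_space (R j)" "\<And>j. j < n \<Longrightarrow> R j = K (x j)"
        "PiM {..<n} (\<lambda>i. K (x i)) = PiM {..<n} R"
      using PiM_as_total_prob_family[of n "\<lambda>j. K (x j)"] Kx(1) by metis
    interpret product_sigma_finite R
      by (intro product_sigma_finite.intro prob_space_imp_sigma_finite R)
    show "(\<integral>\<^sup>+z. (\<Prod>i<n. g (z i)) \<partial>PiM {..<n} (\<lambda>i. K (x i))) = (\<Prod>i<n. \<integral>\<^sup>+y. g y \<partial>K (x i))"
      unfolding R(3) using R(2) Kx g
      by (subst product_nn_integral_prod) (auto simp: measurable_cong_sets[OF Kx(2) refl])
  qed
  also have "\<dots> = (\<Prod>i<n. \<integral>\<^sup>+x. \<integral>\<^sup>+y. g y \<partial>K x \<partial>P)"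
    using measurable_compose[OF measurable_prob_algebraD[OF K] nn_integral_measurable_subprob_algebra[OF g]]
    by (intro PP.product_nn_integral_prod) auto
  finally show ?thesis by simp
qed

section \<open>Randomized response and the upper bound\<close>

text \<open>Points of \<open>euclid 1\<close> are extensional functions on \<open>{..<1}\<close>, so
  a real report has to be wrapped in a restricted lambda.\<close>

definition randomized_response :: "real \<Rightarrow> real \<Rightarrow> (nat \<Rightarrow> real) measure" where
  "randomized_response v p =
    distr (measure_pmf (bernoulli_pmf p)) (euclid 1) (\<lambda>b. \<lambda>j\<in>{..<1}. if b then v else - v)"

lemma randomized_response_point: "(\<lambda>j\<in>{..<1::nat}. v) \<in> space (euclid 1)"
  by (auto simp: euclid_def space_PiM)

lemma sets_randomized_response: "sets (randomized_response v p) = sets (euclid 1)"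
  by (simp add: randomized_response_def)

lemma prob_space_randomized_response: "prob_space (randomized_response v p)"
  unfolding randomized_response_def
  by (intro prob_space.prob_space_distr prob_space_measure_pmf)
    (auto simp: randomized_response_point simp del: One_nat_def)

lemma nn_integral_randomized_response:
  assumes "0 \<le> p" "p \<le> 1" and f: "f \<in> borel_measurable (euclid 1)"
  shows "(\<integral>\<^sup>+y. f y \<partial>randomized_response v p) =
    f (\<lambda>j\<in>{..<1}. v) * ennreal p + f (\<lambda>j\<in>{..<1}. - v) * ennreal (1 - p)"
  unfolding randomized_response_def using assms
  by (subst nn_integral_distr) (auto simp: randomized_response_point simp del: One_nat_def)

lemma emeasure_randomized_response:
  assumes "0 \<le> p" "p \<le> 1" and A: "A \<in> sets (euclid 1)"
  shows "emeasure (randomized_response v p) A =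
    indicator A (\<lambda>j\<in>{..<1}. v) * ennreal p + indicator A (\<lambda>j\<in>{..<1}. - v) * ennreal (1 - p)"
  using nn_integral_randomized_response[OF assms(1,2) borel_measurable_indicator[OF A], of v] A
  by (simp add: sets_randomized_response)

lemma measurable_randomized_response:
  assumes \<pi>: "\<pi> \<in> borel_measurable M" "\<And>x. x \<in> space M \<Longrightarrow> 0 \<le> \<pi> x \<and> \<pi> x \<le> 1"
  shows "(\<lambda>x. randomized_response v (\<pi> x)) \<in> M \<rightarrow>\<^sub>M prob_algebra (euclid 1)"
proof (intro measurable_prob_algebraI measurable_subprob_algebra)
  fix A assume A: "A \<in> sets (euclid 1)"
  have "(\<lambda>x. indicator A (\<lambda>j\<in>{..<1}. v) * ennreal (\<pi> x) +
      indicator A (\<lambda>j\<in>{..<1}. - v) * ennreal (1 - \<pi> x)) \<in> borel_measurable M"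
    using \<pi>(1) by measurable
  then show "(\<lambda>x. emeasure (randomized_response v (\<pi> x)) A) \<in> borel_measurable M"
    by (rule measurable_cong[THEN iffD1, rotated]) (use \<pi>(2) A in \<open>auto simp: emeasure_randomized_response\<close>)
qed (auto intro: prob_space_randomized_response prob_space_imp_subprob_space simp: sets_randomized_response)

text \<open>The admissible interval is symmetric about \<open>1 / 2\<close>, so it contains
  \<open>1 - p\<close> along with \<open>p\<close>, and its endpoints have ratio
  \<open>exp \<alpha>\<close>. Each of the two atoms thus satisfies the privacy bound, and with them
  every event.\<close>

lemma randomized_response_private:
  assumes \<alpha>: "0 < \<alpha>" and A: "A \<in> sets (euclid 1)"
    and p: "1 / (exp \<alpha> + 1) \<le> p" "p \<le> exp \<alpha> / (exp \<alpha> + 1)"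
    and p': "1 / (exp \<alpha> + 1) \<le> p'" "p' \<le> exp \<alpha> / (exp \<alpha> + 1)"
  shows "emeasure (randomized_response v p) A \<le> ennreal (exp \<alpha>) * emeasure (randomized_response v p') A"
proof -
  define e where "e = exp \<alpha>"
  have e: "1 < e" using \<alpha> by (simp add: e_def)
  have one: "1 / (e + 1) = 1 - e / (e + 1)" using e by (simp add: field_simps)
  have unit: "0 \<le> p \<and> p \<le> 1" if "1 / (e + 1) \<le> p" "p \<le> e / (e + 1)" for p
  proof -
    have "0 \<le> 1 / (e + 1)" "e / (e + 1) \<le> 1" using e by auto
    then show ?thesis using that by linarith
  qed
  have ratio: "p \<le> e * p'" if "p \<le> e / (e + 1)" "1 / (e + 1) \<le> p'" for p p'
  proof -
    have "e / (e + 1) \<le> e * p'" using mult_left_mono[OF that(2), of e] e by simp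
    then show ?thesis using that(1) by linarith
  qed
  have "p \<le> e * p'" "1 - p \<le> e * (1 - p')"
    using p p' one by (auto intro!: ratio simp: e_def[symmetric])
  then have "ennreal p \<le> ennreal e * ennreal p'" "ennreal (1 - p) \<le> ennreal e * ennreal (1 - p')"
    using e by (auto simp: ennreal_mult'[symmetric] intro!: ennreal_leI)
  then have "indicator A (\<lambda>j\<in>{..<1}. v) * ennreal p + indicator A (\<lambda>j\<in>{..<1}. - v) * ennreal (1 - p) \<le>
      indicator A (\<lambda>j\<in>{..<1}. v) * (ennreal e * ennreal p') +
      indicator A (\<lambda>j\<in>{..<1}. - v) * (ennreal e * ennreal (1 - p'))"
    by (intro add_mono mult_left_mono) auto
  also have "\<dots> = ennreal e * (indicator A (\<lambda>j\<in>{..<1}. v) * ennreal p' + indicator A (\<lambda>j\<in>{..<1}. - v) * ennreal (1 - p'))"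
    by (simp add: distrib_left mult_ac)
  finally show ?thesis
    using unit[OF p[folded e_def]] unit[OF p'[folded e_def]] A
    by (simp add: emeasure_randomized_response e_def)
qed

text \<open>The inner integral is affine in \<open>\<pi> x\<close>, so averaging over
  \<open>x\<close> replaces the input-dependent coin by a single coin with the mean probability
  \<open>p\<close>. How \<open>\<pi>\<close> varies has no effect on the bound.\<close>

lemma randomized_response_mgf_le:
  fixes P :: "'a measure"
  assumes P: "prob_space P" and \<pi>: "\<pi> \<in> borel_measurable P" "\<And>x. x \<in> space P \<Longrightarrow> 0 \<le> \<pi> x \<and> \<pi> x \<le> 1"
  defines "p \<equiv> \<integral>x. \<pi> x \<partial>P"
  shows "(\<integral>\<^sup>+x. \<integral>\<^sup>+y. ennreal (exp (s * (y 0 - v * (2 * p - 1)))) \<partial>randomized_response v (\<pi> x) \<partial>P)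
    \<le> ennreal (exp ((s * v)\<^sup>2 / 2))"
proof -
  interpret P: prob_space P by (rule P)
  define A where "A = exp (s * (v - v * (2 * p - 1)))"
  define B where "B = exp (s * (- v - v * (2 * p - 1)))"
  have AB: "0 < A" "0 < B" by (auto simp: A_def B_def)
  have \<pi>i: "integrable P \<pi>"
    using \<pi> by (intro P.integrable_const_bound[where B = 1]) (auto intro!: AE_I2)
  have p: "0 \<le> p" "p \<le> 1"
  proof -
    show "0 \<le> p" unfolding p_def using \<pi> by (intro integral_nonneg_AE) (auto intro!: AE_I2)
    have "p \<le> (\<integral>x. 1 \<partial>P)" unfolding p_def using \<pi> \<pi>i by (intro integral_mono) auto
    then show "p \<le> 1" by (simp add: P.prob_space)
  qed
  have f: "(\<lambda>y. ennreal (exp (s * (y 0 - v * (2 * p - 1))))) \<in> borel_measurable (euclid 1)"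
    unfolding euclid_def by measurable
  have "(\<integral>\<^sup>+x. \<integral>\<^sup>+y. ennreal (exp (s * (y 0 - v * (2 * p - 1)))) \<partial>randomized_response v (\<pi> x) \<partial>P) =
      (\<integral>\<^sup>+x. ennreal (A * \<pi> x + B * (1 - \<pi> x)) \<partial>P)"
    using \<pi>(2) AB
    by (intro nn_integral_cong)
      (auto simp: nn_integral_randomized_response[OF _ _ f] A_def[symmetric] B_def[symmetric] ennreal_mult)
  also have "\<dots> = ennreal (\<integral>x. A * \<pi> x + B * (1 - \<pi> x) \<partial>P)"
    using \<pi>i \<pi>(2) AB by (intro nn_integral_eq_integral) (auto intro!: AE_I2 add_nonneg_nonneg mult_nonneg_nonneg)
  also have "(\<integral>x. A * \<pi> x + B * (1 - \<pi> x) \<partial>P) = A * p + B * (1 - p)"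
    using \<pi>i by (simp add: P.prob_space p_def)
  also have "\<dots> = p * exp ((s * v) * (1 - (2 * p - 1))) + (1 - p) * exp ((s * v) * (- 1 - (2 * p - 1)))"
    by (simp add: A_def B_def algebra_simps)
  also have "\<dots> \<le> exp ((s * v)\<^sup>2 / 2)" by (rule bernoulli_mgf_le[OF p])
  finally show ?thesis by (simp add: ennreal_leI)
qed

lemma randomized_response_channel:
  fixes M :: "'a measure"
  assumes \<alpha>: "0 < \<alpha>" and \<pi>: "\<pi> \<in> borel_measurable M"
    "\<And>x. x \<in> space M \<Longrightarrow> 1 / (exp \<alpha> + 1) \<le> \<pi> x \<and> \<pi> x \<le> exp \<alpha> / (exp \<alpha> + 1)"
  shows "(\<lambda>x. PiM {..<n} (\<lambda>i. randomized_response v (\<pi> (x i)))) \<in> private_channels M 1 n \<alpha>"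
    and "\<And>x. x \<in> space M \<Longrightarrow> 0 \<le> \<pi> x \<and> \<pi> x \<le> 1"
proof -
  show u: "0 \<le> \<pi> x \<and> \<pi> x \<le> 1" if "x \<in> space M" for x
  proof -
    have "0 \<le> 1 / (exp \<alpha> + 1)" "exp \<alpha> / (exp \<alpha> + 1) \<le> 1"
      using exp_gt_zero[of \<alpha>] by (auto simp: divide_le_eq add_pos_pos)
    then show ?thesis using \<pi>(2)[OF that] by linarith
  qed
  show "(\<lambda>x. PiM {..<n} (\<lambda>i. randomized_response v (\<pi> (x i)))) \<in> private_channels M 1 n \<alpha>"
    using \<pi> by (intro product_channel_private measurable_randomized_response u randomized_response_private \<alpha>) auto
qed

text \<open>The estimator adds \<open>c\<close> to the average of the reports. In units of
  \<open>\<omega>\<close> its bias is at most \<open>2\<close>, hence the factor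
  \<open>exp 2\<close>. The exponents \<open>s = 1 / (n * \<omega>)\<close> and \<open>- s\<close>
  give \<open>n * (s * v)\<^sup>2 \<le> D\<close>, hence \<open>exp (D / 2)\<close>. Finally
  \<open>exp \<bar>d\<bar> \<le> exp d + exp (- d)\<close> turns the two-sided error into two
  exponential moments, hence the factor \<open>2\<close>.\<close>

lemma randomized_response_risk_le:
  fixes M :: "'a measure" and l :: "real \<Rightarrow> real"
  assumes P: "\<And>P. P \<in> \<P> \<Longrightarrow> prob_space P \<and> sets P = sets M"
    and l: "\<And>t. 0 \<le> t \<Longrightarrow> 0 \<le> l t"
    and C: "0 < C" "\<And>w u. 0 \<le> w \<Longrightarrow> 0 \<le> u \<Longrightarrow> l (w * u) \<le> C * exp u * l w"
    and \<alpha>: "0 < \<alpha>" and \<pi>: "\<pi> \<in> borel_measurable M"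
    "\<And>x. x \<in> space M \<Longrightarrow> 1 / (exp \<alpha> + 1) \<le> \<pi> x \<and> \<pi> x \<le> exp \<alpha> / (exp \<alpha> + 1)"
    and \<omega>: "0 < \<omega>" and n: "1 \<le> n"
    and bias: "\<And>P. P \<in> \<P> \<Longrightarrow> \<bar>c + v * (2 * (\<integral>x. \<pi> x \<partial>P) - 1) - \<theta> P\<bar> \<le> 2 * \<omega>"
    and v: "v\<^sup>2 \<le> real n * \<omega>\<^sup>2 * D"
  shows "private_minimax_risk M n \<alpha> \<P> \<theta> l \<le> ennreal (2 * C * exp 2 * exp (D / 2) * l \<omega>)"
proof -
  let ?K = "\<lambda>x. randomized_response v (\<pi> x)"
  let ?Q = "\<lambda>x. PiM {..<n} (\<lambda>i. ?K (x i))"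
  define T where "T z = c + (\<Sum>i<n. z i 0) / real n" for z :: "nat \<Rightarrow> nat \<Rightarrow> real"
  note unit = randomized_response_channel(2)[OF \<alpha> \<pi>]
  note Q = randomized_response_channel(1)[OF \<alpha> \<pi>, of n v]
  have K: "?K \<in> M \<rightarrow>\<^sub>M prob_algebra (euclid 1)"
    by (rule measurable_randomized_response[OF \<pi>(1) unit])
  have comp: "(\<lambda>z. z i 0) \<in> borel_measurable (outputs 1 n)" if "i < n" for i
  proof -
    have "(\<lambda>y. y 0) \<in> borel_measurable (euclid 1)" unfolding euclid_def by measurable
    then show ?thesis using that by (intro measurable_compose[OF measurable_component_singleton]) auto
  qed
  have T: "T \<in> borel_measurable (outputs 1 n)"
    unfolding T_def using comp by (intro borel_measurable_add borel_measurable_divide borel_measurable_sum) auto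
  have "(\<integral>\<^sup>+z. ennreal (l \<bar>T z - \<theta> P\<bar>) \<partial>(PiM {..<n} (\<lambda>_. P) \<bind> ?Q)) \<le>
      ennreal (2 * C * exp 2 * exp (D / 2) * l \<omega>)" if PP: "P \<in> \<P>" for P
  proof -
    have prob: "prob_space P" and sP: "sets P = sets M" using P[OF PP] by auto
    have KP: "?K \<in> P \<rightarrow>\<^sub>M prob_algebra (euclid 1)" using K by (simp add: measurable_cong_sets[OF sP refl])
    have sPn: "sets (PiM {..<n} (\<lambda>_. P)) = sets (PiM {..<n} (\<lambda>_. M))" using sP by (intro sets_PiM_cong) auto
    have QP: "?Q \<in> PiM {..<n} (\<lambda>_. P) \<rightarrow>\<^sub>M prob_algebra (outputs 1 n)"
      using Q by (simp add: private_channels_def channels_def measurable_cong_sets[OF sPn refl])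
    let ?R = "PiM {..<n} (\<lambda>_. P) \<bind> ?Q"
    have sR: "sets ?R = sets (outputs 1 n)"
      using sPn prob by (intro sets_bind'[OF _ QP]) (simp add: space_prob_algebra prob_space_PiM)
    define m where "m = v * (2 * (\<integral>x. \<pi> x \<partial>P) - 1)"
    have mgf: "(\<integral>\<^sup>+z. (\<Prod>i<n. ennreal (exp (s * (z i 0 - m)))) \<partial>?R) \<le> ennreal (exp (D / 2))"
      if s: "s = 1 / (n * \<omega>) \<or> s = - (1 / (n * \<omega>))" for s
    proof -
      have "(\<lambda>y. ennreal (exp (s * (y 0 - m)))) \<in> borel_measurable (euclid 1)"
        unfolding euclid_def by measurable
      from nn_integral_product_channel[OF prob KP QP this]
      have "(\<integral>\<^sup>+z. (\<Prod>i<n. ennreal (exp (s * (z i 0 - m)))) \<partial>?R) =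
          (\<integral>\<^sup>+x. \<integral>\<^sup>+y. ennreal (exp (s * (y 0 - m))) \<partial>?K x \<partial>P) ^ n" .
      also have "\<dots> \<le> ennreal (exp ((s * v)\<^sup>2 / 2)) ^ n"
        unfolding m_def using \<pi>(1) unit sets_eq_imp_space_eq[OF sP]
        by (intro power_mono randomized_response_mgf_le[OF prob]) (auto simp: measurable_cong_sets[OF sP refl])
      also have "\<dots> = ennreal (exp (n * ((s * v)\<^sup>2 / 2)))"
        by (subst ennreal_power) (simp_all only: exp_ge_zero exp_of_nat_mult)
      also have "\<dots> \<le> ennreal (exp (D / 2))"
      proof -
        have "s\<^sup>2 = 1 / (n * \<omega>)\<^sup>2" using s by (auto simp: power_divide)
        then have "n * (s * v)\<^sup>2 = n * v\<^sup>2 / (n * \<omega>)\<^sup>2" by (simp add: power_mult_distrib)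
        also have "\<dots> \<le> n * (real n * \<omega>\<^sup>2 * D) / (n * \<omega>)\<^sup>2"
          using v by (intro divide_right_mono mult_left_mono) auto
        also have "\<dots> = D" using n \<omega> by (simp add: power2_eq_square)
        finally show ?thesis by (simp add: ennreal_leI)
      qed
      finally show ?thesis .
    qed
    let ?s = "1 / (n * \<omega>)"
    let ?E = "\<lambda>s z. \<Prod>i<n. ennreal (exp (s * (z i 0 - m)))"
    have Em: "?E s \<in> borel_measurable ?R" for s
    proof -
      have "?E s \<in> borel_measurable (outputs 1 n)"
        using comp by (intro borel_measurable_prod_ennreal measurable_compose[OF _ measurable_ennreal]
            measurable_compose[OF _ borel_measurable_exp] borel_measurable_times borel_measurable_diff) auto
      then show ?thesis by (simp add: measurable_cong_sets[OF sR refl])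
    qed
    have pointwise: "ennreal (l \<bar>T z - \<theta> P\<bar>) \<le> ennreal (C * exp 2 * l \<omega>) * (?E ?s z + ?E (- ?s) z)" for z
    proof -
      define d where "d = (T z - c - m) / \<omega>"
      have Ez: "?E s z = ennreal (exp (s * (\<Sum>i<n. z i 0 - m)))" for s
        by (simp add: prod_ennreal exp_sum sum_distrib_left)
      have sum: "(\<Sum>i<n. z i 0 - m) = n * (T z - c - m)"
        using n by (simp add: T_def sum_subtractf field_simps)
      have E1: "?E ?s z = ennreal (exp d)" "?E (- ?s) z = ennreal (exp (- d))"
        unfolding Ez sum d_def using n \<omega> by (simp_all add: field_simps)
      define u where "u = \<bar>T z - \<theta> P\<bar> / \<omega>"
      have "\<bar>T z - \<theta> P\<bar> \<le> \<bar>T z - c - m\<bar> + 2 * \<omega>"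
        using bias[OF PP] by (simp add: m_def)
      then have u: "u \<le> 2 + \<bar>d\<bar>" using \<omega> by (simp add: u_def d_def field_simps)
      have "l \<bar>T z - \<theta> P\<bar> = l (\<omega> * u)" using \<omega> by (simp add: u_def)
      also have "\<dots> \<le> C * exp u * l \<omega>" using \<omega> by (intro C(2)) (auto simp: u_def)
      also have "\<dots> \<le> C * (exp 2 * (exp d + exp (- d))) * l \<omega>"
      proof (intro mult_right_mono mult_left_mono)
        have "exp u \<le> exp 2 * exp \<bar>d\<bar>" using u by (simp add: exp_add[symmetric])
        also have "\<dots> \<le> exp 2 * (exp d + exp (- d))" by (intro mult_left_mono) (auto simp: abs_if)
        finally show "exp u \<le> exp 2 * (exp d + exp (- d))" .
      qed (use C l \<omega> in auto)
      also have "\<dots> = C * exp 2 * l \<omega> * (exp d + exp (- d))" by simp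
      finally have "ennreal (l \<bar>T z - \<theta> P\<bar>) \<le> ennreal (C * exp 2 * l \<omega> * (exp d + exp (- d)))"
        by (rule ennreal_leI)
      also have "\<dots> = ennreal (C * exp 2 * l \<omega>) * (ennreal (exp d) + ennreal (exp (- d)))"
        using C l \<omega> by (subst ennreal_mult) auto
      finally show ?thesis unfolding E1 .
    qed
    have "(\<integral>\<^sup>+z. ennreal (l \<bar>T z - \<theta> P\<bar>) \<partial>?R) \<le>
        (\<integral>\<^sup>+z. ennreal (C * exp 2 * l \<omega>) * (?E ?s z + ?E (- ?s) z) \<partial>?R)"
      by (intro nn_integral_mono pointwise)
    also have "\<dots> = ennreal (C * exp 2 * l \<omega>) * ((\<integral>\<^sup>+z. ?E ?s z \<partial>?R) + (\<integral>\<^sup>+z. ?E (- ?s) z \<partial>?R))"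
      by (subst nn_integral_cmult[OF borel_measurable_add[OF Em Em]], subst nn_integral_add[OF Em Em], rule refl)
    also have "\<dots> \<le> ennreal (C * exp 2 * l \<omega>) * (ennreal (exp (D / 2)) + ennreal (exp (D / 2)))"
      by (intro mult_left_mono add_mono mgf) auto
    also have "\<dots> = ennreal (2 * C * exp 2 * exp (D / 2) * l \<omega>)"
      using C l \<omega> by (simp add: ennreal_plus[symmetric] ennreal_mult[symmetric] mult_ac del: ennreal_plus)
    finally show ?thesis .
  qed
  then have "(SUP P\<in>\<P>. \<integral>\<^sup>+z. ennreal (l \<bar>T z - \<theta> P\<bar>) \<partial>(PiM {..<n} (\<lambda>_. P) \<bind> ?Q)) \<le>
      ennreal (2 * C * exp 2 * exp (D / 2) * l \<omega>)"
    by (rule SUP_least)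
  then have "channel_risk 1 n ?Q \<P> \<theta> l \<le> ennreal (2 * C * exp 2 * exp (D / 2) * l \<omega>)"
    unfolding channel_risk_def by (rule INF_lower2[OF T])
  then show ?thesis
    unfolding private_minimax_risk_def by (intro INF_lower2[of 1] INF_lower2[OF Q]) auto
qed

text \<open>Serves the case of a vanishing modulus, where errors cannot be measured in units of
  \<open>\<omega>\<close>. The constant estimator has zero loss under every channel; a fair coin is
  exhibited so that the infimum runs over a nonempty set of channels.\<close>

lemma private_minimax_risk_constant:
  fixes M :: "'a measure"
  assumes \<alpha>: "0 < \<alpha>" and const: "\<And>P. P \<in> \<P> \<Longrightarrow> \<theta> P = c" and l: "l 0 = 0"
  shows "private_minimax_risk M n \<alpha> \<P> \<theta> l = 0"
proof -
  let ?Q = "\<lambda>x. PiM {..<n} (\<lambda>i. randomized_response 1 (1 / 2))"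
  have "1 / (exp \<alpha> + 1) \<le> 1 / 2 \<and> 1 / 2 \<le> exp \<alpha> / (exp \<alpha> + 1)"
  proof -
    define e where "e = exp \<alpha>"
    have "1 < e" using \<alpha> by (simp add: e_def)
    then have "1 / (e + 1) \<le> 1 / 2 \<and> 1 / 2 \<le> e / (e + 1)" by (simp add: field_simps)
    then show ?thesis by (simp only: e_def)
  qed
  then have Q: "?Q \<in> private_channels M 1 n \<alpha>"
    using randomized_response_channel(1)[OF \<alpha>, of "\<lambda>_. 1 / 2" M n 1] by simp
  have T: "(\<lambda>_. c) \<in> borel_measurable (outputs 1 n)" by simp
  have "(SUP P\<in>\<P>. \<integral>\<^sup>+z. ennreal (l \<bar>c - \<theta> P\<bar>) \<partial>(PiM {..<n} (\<lambda>_. P) \<bind> ?Q)) \<le> 0"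
    using const l by (intro SUP_least) simp
  then have "channel_risk 1 n ?Q \<P> \<theta> l \<le> 0"
    unfolding channel_risk_def by (rule INF_lower2[OF T])
  then have "private_minimax_risk M n \<alpha> \<P> \<theta> l \<le> 0"
    unfolding private_minimax_risk_def by (intro INF_lower2[of 1] INF_lower2[OF Q]) auto
  then show ?thesis by simp
qed

section \<open>From the modulus to a nearly unbiased statistic\<close>

lemma measure_mixture:
  assumes "prob_space P0" "prob_space P1" "sets P1 = sets P0" "A \<in> sets P0" "0 \<le> w" "w \<le> 1"
  shows "measure (mixture w P0 P1) A = w * measure P0 A + (1 - w) * measure P1 A"
proof -
  interpret P0: prob_space P0 by fact
  interpret P1: prob_space P1 by fact
  have "emeasure (mixture w P0 P1) A = ennreal (w * measure P0 A + (1 - w) * measure P1 A)"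
    using assms by (simp add: emeasure_mixture P0.emeasure_eq_measure P1.emeasure_eq_measure ennreal_mult)
  then show ?thesis using assms by (intro measure_eq_emeasure_eq_ennreal) auto
qed

text \<open>For a pair at distance \<open>t > \<epsilon>\<close>, the mixture with weight
  \<open>\<epsilon> / t\<close> on \<open>P0\<close> is within \<open>\<epsilon>\<close> of
  \<open>P1\<close>, while \<open>\<theta>\<close> changes by exactly that fraction of
  \<open>\<theta> P0 - \<theta> P1\<close>. Hence the full difference is at most
  \<open>\<omega> * t / \<epsilon>\<close>; the additive \<open>\<omega>\<close> takes care of
  \<open>t \<le> \<epsilon>\<close>.\<close>

lemma modulus_tv_linear_growth:
  fixes M :: "'a measure"
  assumes P: "\<And>P. P \<in> \<P> \<Longrightarrow> prob_space P \<and> sets P = sets M"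
    and cvx: "convex_measures \<P>" and lin: "linear_functional \<P> \<theta>"
    and bdd: "bdd_above ((\<lambda>P. \<bar>\<theta> P\<bar>) ` \<P>)"
    and \<epsilon>: "0 < \<epsilon>" and PP: "P0 \<in> \<P>" "P1 \<in> \<P>"
  shows "\<bar>\<theta> P0 - \<theta> P1\<bar> \<le> modulus_tv \<P> \<theta> \<epsilon> + modulus_tv \<P> \<theta> \<epsilon> / \<epsilon> * tv_dist P0 P1"
proof -
  define \<omega> where "\<omega> = modulus_tv \<P> \<theta> \<epsilon>"
  define t where "t = tv_dist P0 P1"
  have \<omega>: "0 \<le> \<omega>" unfolding \<omega>_def by (rule modulus_tv_nonneg[OF bdd]) (use PP \<epsilon> in auto)
  have prob: "prob_space P0" "prob_space P1" and s: "sets P0 = sets M" "sets P1 = sets M"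
    using P PP by auto
  have t: "0 \<le> t" unfolding t_def by (rule tv_dist_nonneg[OF prob])
  show ?thesis
  proof (cases "t \<le> \<epsilon>")
    case True
    then have "\<bar>\<theta> P0 - \<theta> P1\<bar> \<le> \<omega>"
      unfolding \<omega>_def t_def by (intro modulus_tv_upper[OF bdd PP])
    moreover have "0 \<le> \<omega> / \<epsilon> * t" using \<omega> \<epsilon> t by simp
    ultimately show ?thesis by (simp add: \<omega>_def t_def)
  next
    case False
    define w where "w = \<epsilon> / t"
    have w: "0 < w" "w \<le> 1" "w * t = \<epsilon>" using False \<epsilon> by (auto simp: w_def)
    let ?m = "mixture w P0 P1"
    have m: "?m \<in> \<P>" using cvx PP w by (auto simp: convex_measures_def)
    have "tv_dist ?m P1 \<le> \<epsilon>"
      unfolding tv_dist_def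
    proof (rule cSUP_least)
      fix A assume "A \<in> sets ?m"
      then have A: "A \<in> sets P0" by (simp add: sets_mixture)
      have "measure ?m A = w * measure P0 A + (1 - w) * measure P1 A"
        using A s w by (intro measure_mixture prob) auto
      then have "measure ?m A - measure P1 A = w * (measure P0 A - measure P1 A)"
        by (simp add: algebra_simps)
      then have "\<bar>measure ?m A - measure P1 A\<bar> = w * \<bar>measure P0 A - measure P1 A\<bar>"
        using w by (simp add: abs_mult)
      also have "\<dots> \<le> w * t"
        unfolding t_def using w by (intro mult_left_mono diff_le_tv_dist[OF prob A]) auto
      finally show "\<bar>measure ?m A - measure P1 A\<bar> \<le> \<epsilon>" using w by simp
    qed auto
    then have "\<bar>\<theta> ?m - \<theta> P1\<bar> \<le> \<omega>"
      unfolding \<omega>_def by (rule modulus_tv_upper[OF bdd m PP(2)])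
    moreover have "\<theta> ?m - \<theta> P1 = w * (\<theta> P0 - \<theta> P1)"
      using lin PP w by (simp add: linear_functional_def algebra_simps)
    ultimately have "w * \<bar>\<theta> P0 - \<theta> P1\<bar> \<le> \<omega>" using w by (simp add: abs_mult)
    then have "\<bar>\<theta> P0 - \<theta> P1\<bar> \<le> \<omega> / w" using w by (simp add: field_simps)
    also have "\<dots> = \<omega> / \<epsilon> * t" by (simp add: w_def)
    finally show ?thesis using \<omega> by (simp add: \<omega>_def t_def)
  qed
qed

lemma mixture_density:
  fixes p0 p1 :: "'a \<Rightarrow> real"
  assumes p: "p0 \<in> borel_measurable \<nu>" "p1 \<in> borel_measurable \<nu>" "\<And>x. 0 \<le> p0 x" "\<And>x. 0 \<le> p1 x"
    and w: "0 \<le> w" "w \<le> 1"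
  shows "mixture w (density \<nu> (\<lambda>x. ennreal (p0 x))) (density \<nu> (\<lambda>x. ennreal (p1 x))) =
    density \<nu> (\<lambda>x. ennreal (w * p0 x + (1 - w) * p1 x))"
proof (rule measure_eqI)
  fix A assume "A \<in> sets (mixture w (density \<nu> (\<lambda>x. ennreal (p0 x))) (density \<nu> (\<lambda>x. ennreal (p1 x))))"
  then have A: "A \<in> sets \<nu>" by (simp add: sets_mixture)
  have "emeasure (density \<nu> (\<lambda>x. ennreal (w * p0 x + (1 - w) * p1 x))) A =
      (\<integral>\<^sup>+x. ennreal w * (ennreal (p0 x) * indicator A x) + ennreal (1 - w) * (ennreal (p1 x) * indicator A x) \<partial>\<nu>)"
    using p w A by (subst emeasure_density)
      (auto intro!: nn_integral_cong simp: ennreal_mult indicator_def)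
  also have "\<dots> = ennreal w * (\<integral>\<^sup>+x. ennreal (p0 x) * indicator A x \<partial>\<nu>) +
      ennreal (1 - w) * (\<integral>\<^sup>+x. ennreal (p1 x) * indicator A x \<partial>\<nu>)"
    using p A by (subst nn_integral_add) (auto simp: nn_integral_cmult)
  also have "\<dots> = emeasure (mixture w (density \<nu> (\<lambda>x. ennreal (p0 x))) (density \<nu> (\<lambda>x. ennreal (p1 x)))) A"
    using p A by (simp add: emeasure_mixture emeasure_density)
  finally show "emeasure (mixture w (density \<nu> (\<lambda>x. ennreal (p0 x))) (density \<nu> (\<lambda>x. ennreal (p1 x)))) A =
      emeasure (density \<nu> (\<lambda>x. ennreal (w * p0 x + (1 - w) * p1 x))) A" ..
qed (simp add: sets_mixture)

lemma tv_dist_le_integral_abs_diff: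
  fixes p0 p1 :: "'a \<Rightarrow> real"
  assumes p0: "integrable \<nu> p0" "\<And>x. 0 \<le> p0 x" and p1: "integrable \<nu> p1" "\<And>x. 0 \<le> p1 x"
  shows "tv_dist (density \<nu> (\<lambda>x. ennreal (p0 x))) (density \<nu> (\<lambda>x. ennreal (p1 x)))
    \<le> (\<integral>x. \<bar>p0 x - p1 x\<bar> \<partial>\<nu>)"
  unfolding tv_dist_def
proof (rule cSUP_least)
  fix A assume "A \<in> sets (density \<nu> (\<lambda>x. ennreal (p0 x)))"
  then have A: "A \<in> sets \<nu>" by simp
  have i: "integrable \<nu> (\<lambda>x. p0 x * indicator A x)" "integrable \<nu> (\<lambda>x. p1 x * indicator A x)"
    using p0 p1 A by (auto intro: integrable_real_mult_indicator)
  have "\<bar>measure (density \<nu> (\<lambda>x. ennreal (p0 x))) A - measure (density \<nu> (\<lambda>x. ennreal (p1 x))) A\<bar> =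
      \<bar>\<integral>x. p0 x * indicator A x - p1 x * indicator A x \<partial>\<nu>\<bar>"
    using i by (simp add: measure_density_real[OF p0 A] measure_density_real[OF p1 A])
  also have "\<dots> \<le> (\<integral>x. \<bar>p0 x * indicator A x - p1 x * indicator A x\<bar> \<partial>\<nu>)"
    by (rule integral_abs_bound)
  also have "\<dots> \<le> (\<integral>x. \<bar>p0 x - p1 x\<bar> \<partial>\<nu>)"
    using i p0 p1 by (intro integral_mono integrable_abs Bochner_Integration.integrable_diff)
      (auto simp: indicator_def)
  finally show "\<bar>measure (density \<nu> (\<lambda>x. ennreal (p0 x))) A - measure (density \<nu> (\<lambda>x. ennreal (p1 x))) A\<bar>
      \<le> (\<integral>x. \<bar>p0 x - p1 x\<bar> \<partial>\<nu>)" .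
qed auto

text \<open>Duality is applied to differences of densities paired with differences of
  \<open>\<theta>\<close>. The linear growth of \<open>\<theta>\<close> in total variation, weakened
  to the integral of the absolute density difference, is the hypothesis with slope
  \<open>L = \<omega> / \<epsilon>\<close>, and that slope becomes the bound on
  \<open>\<psi>\<close>.\<close>

lemma ex_nearly_unbiased_function:
  fixes M :: "'a measure"
  assumes \<nu>: "density_family M \<P> \<nu>" and ne: "\<P> \<noteq> {}"
    and cvx: "convex_measures \<P>" and lin: "linear_functional \<P> \<theta>"
    and bdd: "bdd_above ((\<lambda>P. \<bar>\<theta> P\<bar>) ` \<P>)"
    and \<epsilon>: "0 < \<epsilon>" and \<omega>: "0 < modulus_tv \<P> \<theta> \<epsilon>"
  shows "\<exists>\<psi>\<in>borel_measurable M. \<exists>c. (\<forall>x. \<bar>\<psi> x\<bar> \<le> modulus_tv \<P> \<theta> \<epsilon> / \<epsilon>) \<and>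
    (\<forall>P\<in>\<P>. \<bar>c + (\<integral>x. \<psi> x \<partial>P) - \<theta> P\<bar> \<le> 2 * modulus_tv \<P> \<theta> \<epsilon>)"
proof -
  define \<omega> where "\<omega> = modulus_tv \<P> \<theta> \<epsilon>"
  define L where "L = \<omega> / \<epsilon>"
  have L: "0 \<le> L" using \<epsilon> assms(7) by (simp add: L_def \<omega>_def)
  have fin: "finite_measure \<nu>" and s\<nu>: "sets \<nu> = sets M" using \<nu> by (auto simp: density_family_def)
  interpret finite_measure \<nu> by (rule fin)
  have prob: "prob_space P \<and> sets P = sets M" if "P \<in> \<P>" for P using \<nu> that by (auto simp: density_family_def)
  have dens: "\<exists>p. integrable \<nu> p \<and> (\<forall>x. 0 \<le> p x) \<and> P = density \<nu> (\<lambda>x. ennreal (p x))" if "P \<in> \<P>" for P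
    using \<nu> that by (auto simp: density_family_def)
  let ?d = "\<lambda>p. density \<nu> (\<lambda>x. ennreal (p x))"
  define G where "G = {p. integrable \<nu> p \<and> (\<forall>x. 0 \<le> p x) \<and> ?d p \<in> \<P>}"
  have G_cvx: "(\<lambda>x. w * p x + (1 - w) * p' x) \<in> G"
      "\<theta> (?d (\<lambda>x. w * p x + (1 - w) * p' x)) = w * \<theta> (?d p) + (1 - w) * \<theta> (?d p')"
    if "p \<in> G" "p' \<in> G" "0 \<le> w" "w \<le> 1" for p p' w
  proof -
    have mix: "mixture w (?d p) (?d p') = ?d (\<lambda>x. w * p x + (1 - w) * p' x)"
      using that by (intro mixture_density) (auto simp: G_def)
    have "mixture w (?d p) (?d p') \<in> \<P>"
      using that cvx by (auto simp: G_def convex_measures_def)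
    then show "(\<lambda>x. w * p x + (1 - w) * p' x) \<in> G"
      using that unfolding mix by (auto simp: G_def)
    have "\<theta> (mixture w (?d p) (?d p')) = w * \<theta> (?d p) + (1 - w) * \<theta> (?d p')"
      using that lin by (auto simp: G_def linear_functional_def)
    then show "\<theta> (?d (\<lambda>x. w * p x + (1 - w) * p' x)) = w * \<theta> (?d p) + (1 - w) * \<theta> (?d p')"
      unfolding mix .
  qed
  \<comment> \<open>Indexing by densities lets convex combinations be formed pointwise, and
    linearity of \<open>\<theta>\<close> makes \<open>U\<close> convex. Both orders of a pair occur
    in \<open>U\<close>, which later makes the bound two-sided.\<close>
  define U where "U = (\<lambda>(p, p'). (\<lambda>x. p x - p' x, \<theta> (?d p) - \<theta> (?d p'))) ` (G \<times> G)"
  obtain P where P: "P \<in> \<P>" using ne by auto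
  obtain pP where pP: "integrable \<nu> pP" "\<And>x. 0 \<le> pP x" "P = ?d pP" using dens[OF P] by auto
  then have pPG: "pP \<in> G" using P by (simp add: G_def)
  \<comment> \<open>The slack of the duality lemma is taken equal to \<open>\<omega>\<close>; this
    is why the final bias is \<open>2 * \<omega>\<close>.\<close>
  have "\<exists>\<psi>\<in>borel_measurable \<nu>. (\<forall>x. \<bar>\<psi> x\<bar> \<le> L) \<and> (\<forall>(u, s)\<in>U. s - (\<integral>x. \<psi> x * u x \<partial>\<nu>) \<le> \<omega> + \<omega>)"
  proof (rule ex_bounded_dual_function[OF _ _ _ _ L])
    show "U \<noteq> {}" using pPG by (auto simp: U_def)
    show "0 < \<omega>" using assms(7) by (simp add: \<omega>_def)
    show "integrable \<nu> u" if "(u, s) \<in> U" for u s using that by (auto simp: U_def G_def)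
    show "s \<le> \<omega> + L * (\<integral>x. \<bar>u x\<bar> \<partial>\<nu>)" if "(u, s) \<in> U" for u s
    proof -
      obtain p p' where p: "p \<in> G" "p' \<in> G" "u = (\<lambda>x. p x - p' x)" "s = \<theta> (?d p) - \<theta> (?d p')"
        using \<open>(u, s) \<in> U\<close> by (auto simp: U_def)
      have "s \<le> \<omega> + \<omega> / \<epsilon> * tv_dist (?d p) (?d p')"
        unfolding p(4) \<omega>_def using p
        by (intro order_trans[OF abs_ge_self modulus_tv_linear_growth[OF prob cvx lin bdd \<epsilon>]]) (auto simp: G_def)
      also have "\<dots> \<le> \<omega> + L * (\<integral>x. \<bar>u x\<bar> \<partial>\<nu>)"
        unfolding L_def[symmetric] p(3) using p L
        by (intro add_left_mono mult_left_mono tv_dist_le_integral_abs_diff) (auto simp: G_def)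
      finally show ?thesis .
    qed
    show "(\<lambda>x. (1 - t) * u x + t * v x, (1 - t) * s + t * r) \<in> U"
      if U: "(u, s) \<in> U" "(v, r) \<in> U" and t: "0 \<le> t" "t \<le> 1" for u s v r t
    proof -
      obtain p p' where p: "p \<in> G" "p' \<in> G" "u = (\<lambda>x. p x - p' x)" "s = \<theta> (?d p) - \<theta> (?d p')"
        using U(1) by (auto simp: U_def)
      obtain q q' where q: "q \<in> G" "q' \<in> G" "v = (\<lambda>x. q x - q' x)" "r = \<theta> (?d q) - \<theta> (?d q')"
        using U(2) by (auto simp: U_def)
      let ?a = "\<lambda>x. t * q x + (1 - t) * p x" and ?b = "\<lambda>x. t * q' x + (1 - t) * p' x"
      have "(?a, ?b) \<in> G \<times> G" using G_cvx(1) p q t by auto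
      then have "(\<lambda>x. ?a x - ?b x, \<theta> (?d ?a) - \<theta> (?d ?b)) \<in> U" unfolding U_def by (rule rev_image_eqI) simp
      also have "(\<lambda>x. ?a x - ?b x, \<theta> (?d ?a) - \<theta> (?d ?b)) =
          (\<lambda>x. (1 - t) * u x + t * v x, (1 - t) * s + t * r)"
        unfolding G_cvx(2)[OF q(1) p(1) t] G_cvx(2)[OF q(2) p(2) t] p(3,4) q(3,4)
        by (simp add: fun_eq_iff algebra_simps)
      finally show ?thesis .
    qed
  qed
  then obtain \<psi> where \<psi>: "\<psi> \<in> borel_measurable \<nu>" "\<And>x. \<bar>\<psi> x\<bar> \<le> L"
    "\<And>u s. (u, s) \<in> U \<Longrightarrow> s - (\<integral>x. \<psi> x * u x \<partial>\<nu>) \<le> \<omega> + \<omega>" by blast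
  define E where "E P = (\<integral>x. \<psi> x \<partial>P)" for P
  have diff: "(\<theta> P0 - E P0) - (\<theta> P1 - E P1) \<le> 2 * \<omega>" if PP: "P0 \<in> \<P>" "P1 \<in> \<P>" for P0 P1
  proof -
    obtain p0 where p0: "integrable \<nu> p0" "\<And>x. 0 \<le> p0 x" "P0 = ?d p0" using dens[OF PP(1)] by auto
    obtain p1 where p1: "integrable \<nu> p1" "\<And>x. 0 \<le> p1 x" "P1 = ?d p1" using dens[OF PP(2)] by auto
    have "(\<lambda>x. p0 x - p1 x, \<theta> P0 - \<theta> P1) \<in> U"
      unfolding U_def using p0 p1 PP by (intro rev_image_eqI[of "(p0, p1)"]) (auto simp: G_def)
    from \<psi>(3)[OF this] have 1: "\<theta> P0 - \<theta> P1 - (\<integral>x. \<psi> x * (p0 x - p1 x) \<partial>\<nu>) \<le> \<omega> + \<omega>" .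
    have i: "integrable \<nu> (\<lambda>x. \<psi> x * p0 x)" "integrable \<nu> (\<lambda>x. \<psi> x * p1 x)"
      by (rule integral_abs_mult_le(1)[OF _ \<psi>(1,2)], fact)+
    have "E P0 = (\<integral>x. \<psi> x * p0 x \<partial>\<nu>)" "E P1 = (\<integral>x. \<psi> x * p1 x \<partial>\<nu>)"
      unfolding E_def p0(3) p1(3) using p0 p1 \<psi>(1) by (subst integral_density; auto simp: mult.commute)+
    then have "(\<integral>x. \<psi> x * (p0 x - p1 x) \<partial>\<nu>) = E P0 - E P1"
      using i by (simp add: right_diff_distrib)
    with 1 show ?thesis by simp
  qed
  \<comment> \<open>Duality controls only the oscillation of \<open>\<theta> - E\<close> over
    \<open>\<P>\<close>, so this difference is matched at one arbitrary \<open>P\<close>.\<close>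
  define c where "c = \<theta> P - E P"
  have "\<bar>c + E P' - \<theta> P'\<bar> \<le> 2 * \<omega>" if "P' \<in> \<P>" for P'
    using diff[OF P that] diff[OF that P] by (simp add: c_def abs_le_iff)
  moreover have "\<psi> \<in> borel_measurable M" using \<psi>(1) by (simp add: measurable_cong_sets[OF s\<nu> refl])
  ultimately show ?thesis
    using \<psi>(2) unfolding L_def \<omega>_def E_def by blast
qed

theorem mainTheorem1:
  fixes M :: "'a measure" and \<P> :: "'a measure set" and \<theta> :: "'a measure \<Rightarrow> real"
    and l :: "real \<Rightarrow> real" and a \<alpha> :: real
  assumes "\<P> \<noteq> {}"
    and "\<And>P. P \<in> \<P> \<Longrightarrow> prob_space P \<and> sets P = sets M"
    and "convex_measures \<P>"
    and "dominated M \<P>"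
    and "linear_functional \<P> \<theta>"
    and "bdd_above ((\<lambda>P. \<bar>\<theta> P\<bar>) ` \<P>)"
    and "\<And>t. 0 \<le> t \<Longrightarrow> 0 \<le> l t"
    and "mono_on {0..} l"
    and "l 0 = 0"
    and "1 < a"
    and "\<And>t. 0 \<le> t \<Longrightarrow> l (3/2 * t) \<le> a * l t"
    and "0 < \<alpha>"
  shows "\<exists>c0 c1 :: real. \<exists>n0 :: nat. 0 < c0 \<and> c0 < c1 \<and>
    (\<forall>n\<ge>n0.
       ennreal (c0 * l (modulus_tv \<P> \<theta> (real n powr (-1/2)))) \<le> private_minimax_risk M n \<alpha> \<P> \<theta> l \<and>
       private_minimax_risk M n \<alpha> \<P> \<theta> l \<le> ennreal (c1 * l (modulus_tv \<P> \<theta> (real n powr (-1/2)))))"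
proof -
  obtain \<nu> where \<nu>: "density_family M \<P> \<nu>"
    using dominated_densities[OF assms(4) assms(2)] assms(2) unfolding density_family_def by blast
  obtain C where C: "0 < C" "\<And>w u. 0 \<le> w \<Longrightarrow> 0 \<le> u \<Longrightarrow> l (w * u) \<le> C * exp u * l w"
    using loss_growth_exp[OF assms(7,8,10,11)] by blast
  \<comment> \<open>The coin probabilities allowed by privacy form the interval with centre
    \<open>1 / 2\<close> and half-width \<open>\<kappa> / 2\<close>.\<close>
  define \<kappa> where "\<kappa> = (exp \<alpha> - 1) / (exp \<alpha> + 1)"
  have \<kappa>: "0 < \<kappa>" using assms(12) by (simp add: \<kappa>_def add_pos_pos)
  have \<kappa>_bounds: "1 / (exp \<alpha> + 1) = (1 - \<kappa>) / 2" "exp \<alpha> / (exp \<alpha> + 1) = (1 + \<kappa>) / 2"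
  proof -
    have "exp \<alpha> + 1 \<noteq> 0" using exp_gt_zero[of \<alpha>] by linarith
    then show "1 / (exp \<alpha> + 1) = (1 - \<kappa>) / 2" "exp \<alpha> / (exp \<alpha> + 1) = (1 + \<kappa>) / 2"
      by (simp_all add: \<kappa>_def field_simps)
  qed
  \<comment> \<open>With \<open>v = \<omega> / \<epsilon> / \<kappa>\<close> and
    \<open>\<epsilon>\<^sup>2 = 1 / n\<close>, this makes the noise condition
    \<open>v\<^sup>2 \<le> n * \<omega>\<^sup>2 * D\<close> an equality.\<close>
  define D where "D = 1 / \<kappa>\<^sup>2"
  define c0 where "c0 = 1 / (4 * exp ((exp \<alpha> - 1)\<^sup>2) * a\<^sup>2)"
  define c1 where "c1 = 2 * C * exp 2 * exp (D / 2)"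
  have c0: "0 < c0" using assms(10) by (simp add: c0_def)
  have c1: "0 < c1" using C by (simp add: c1_def)
  have "ennreal (c0 * l (modulus_tv \<P> \<theta> (real n powr (-1/2)))) \<le> private_minimax_risk M n \<alpha> \<P> \<theta> l \<and>
       private_minimax_risk M n \<alpha> \<P> \<theta> l \<le> ennreal ((c0 + c1) * l (modulus_tv \<P> \<theta> (real n powr (-1/2))))"
    if n: "1 \<le> n" for n
  proof
    define \<epsilon> where "\<epsilon> = real n powr (-1/2)"
    define \<omega> where "\<omega> = modulus_tv \<P> \<theta> \<epsilon>"
    have \<epsilon>: "0 < \<epsilon>" "\<epsilon>\<^sup>2 = 1 / n"
    proof -
      show "0 < \<epsilon>" using n by (simp add: \<epsilon>_def)
      have "\<epsilon>\<^sup>2 = real n powr (- 1 / 2 + - 1 / 2)" unfolding \<epsilon>_def power2_eq_square by (rule powr_add[symmetric])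
      then show "\<epsilon>\<^sup>2 = 1 / n" using n by (simp add: powr_minus_divide)
    qed
    have \<omega>: "0 \<le> \<omega>" unfolding \<omega>_def using \<epsilon> by (intro modulus_tv_nonneg assms) auto
    show "ennreal (c0 * l (modulus_tv \<P> \<theta> (real n powr (-1/2)))) \<le> private_minimax_risk M n \<alpha> \<P> \<theta> l"
      using private_minimax_lower_bound[OF \<nu> assms(1,6,7,8,9,10,11,12) n] by (simp add: c0_def)
    have "private_minimax_risk M n \<alpha> \<P> \<theta> l \<le> ennreal (c1 * l \<omega>)"
    \<comment> \<open>If \<open>\<omega> = 0\<close>, the linear growth bound makes
      \<open>\<theta>\<close> constant on \<open>\<P>\<close>.\<close>
    proof (cases "\<omega> = 0")
      case True
      obtain P where P: "P \<in> \<P>" using assms(1) by auto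
      have const: "\<theta> P' = \<theta> P" if "P' \<in> \<P>" for P'
        using modulus_tv_linear_growth[OF assms(2,3,5,6) \<epsilon>(1) that P] True by (simp add: \<omega>_def)
      have "private_minimax_risk M n \<alpha> \<P> \<theta> l = 0"
        by (rule private_minimax_risk_constant[where \<theta> = \<theta> and c = "\<theta> P"])
          (use const assms(9,12) in auto)
      then show ?thesis by simp
    next
      case False
      then have \<omega>p: "0 < \<omega>" using \<omega> by simp
      obtain \<psi> c where \<psi>: "\<psi> \<in> borel_measurable M" "\<And>x. \<bar>\<psi> x\<bar> \<le> \<omega> / \<epsilon>"
        "\<And>P. P \<in> \<P> \<Longrightarrow> \<bar>c + (\<integral>x. \<psi> x \<partial>P) - \<theta> P\<bar> \<le> 2 * \<omega>"
        using ex_nearly_unbiased_function[OF \<nu> assms(1,3,5,6) \<epsilon>(1)] \<omega>p unfolding \<omega>_def by blast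
      \<comment> \<open>The smallest amplitude for which
        \<open>\<bar>\<psi> x\<bar> \<le> \<omega> / \<epsilon>\<close> guarantees
        \<open>\<bar>\<psi> x / v\<bar> \<le> \<kappa>\<close>, so that \<open>\<pi>\<close> stays
        in the private interval while the mean report equals the mean of
        \<open>\<psi>\<close>.\<close>
      define v where "v = \<omega> / \<epsilon> / \<kappa>"
      have v: "0 < v" using \<omega>p \<epsilon> \<kappa> by (simp add: v_def)
      define \<pi> where "\<pi> x = (1 + \<psi> x / v) / 2" for x
      have \<psi>v: "\<bar>\<psi> x / v\<bar> \<le> \<kappa>" for x
      proof -
        have "\<bar>\<psi> x / v\<bar> \<le> (\<omega> / \<epsilon>) / v" using divide_right_mono[OF \<psi>(2)[of x], of v] v by simp
        also have "\<dots> = \<kappa>" using \<omega>p \<epsilon> \<kappa> by (simp add: v_def)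
        finally show ?thesis .
      qed
      show ?thesis
        unfolding c1_def
      proof (rule randomized_response_risk_le[OF assms(2,7) C assms(12) _ _ \<omega>p n])
        show "\<pi> \<in> borel_measurable M" unfolding \<pi>_def using \<psi>(1) by measurable
        show "1 / (exp \<alpha> + 1) \<le> \<pi> x \<and> \<pi> x \<le> exp \<alpha> / (exp \<alpha> + 1)" for x
        proof -
          have "- \<kappa> \<le> \<psi> x / v" "\<psi> x / v \<le> \<kappa>" using \<psi>v[of x] by linarith+
          then show ?thesis unfolding \<kappa>_bounds \<pi>_def by (intro conjI divide_right_mono) auto
        qed
        show "\<bar>c + v * (2 * (\<integral>x. \<pi> x \<partial>P) - 1) - \<theta> P\<bar> \<le> 2 * \<omega>" if PP: "P \<in> \<P>" for P
        proof -
          interpret P: prob_space P using assms(2)[OF PP] by simp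
          have sP: "sets P = sets M" using assms(2)[OF PP] by simp
          have "integrable P \<psi>"
            using \<psi>(1,2) by (intro P.integrable_const_bound[where B = "\<omega> / \<epsilon>"])
              (auto intro!: AE_I2 simp: measurable_cong_sets[OF sP refl])
          then have "v * (2 * (\<integral>x. \<pi> x \<partial>P) - 1) = (\<integral>x. \<psi> x \<partial>P)"
            unfolding \<pi>_def using v by (simp add: P.prob_space add_divide_distrib)
          then show ?thesis using \<psi>(3)[OF PP] by simp
        qed
        show "v\<^sup>2 \<le> real n * \<omega>\<^sup>2 * D"
          using n by (simp add: v_def D_def power_divide power_mult_distrib \<epsilon>(2) mult.commute)
      qed
    qed
    also have "ennreal (c1 * l \<omega>) \<le> ennreal ((c0 + c1) * l \<omega>)"
      using c0 assms(7)[OF \<omega>] by (intro ennreal_leI mult_right_mono) auto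
    finally show "private_minimax_risk M n \<alpha> \<P> \<theta> l \<le> ennreal ((c0 + c1) * l (modulus_tv \<P> \<theta> (real n powr (-1/2))))"
      by (simp add: \<omega>_def \<epsilon>_def)
  qed
  \<comment> \<open>The upper constant is \<open>c0 + c1\<close> to make \<open>c0\<close> strictly
    smaller; \<open>n0 = 1\<close> keeps \<open>\<epsilon>\<close> positive, as
    \<open>0 powr (-1/2)\<close> is \<open>0\<close>.\<close>
  then show ?thesis using c0 c1 by (intro exI[of _ c0] exI[of _ "c0 + c1"] exI[of _ "1::nat"]) auto
qed

end
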